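(* Let $f \in C^2(\mathbb{R}^n, \mathbb{R}^n)$ satisfy the following. 1. $f(x_1, 0, \ldots, 0)=0$ for all $x_1$. 2. The derivative $f'(0)$ has a double index-two zero eigenvalue, and $\mathrm{Re}\,\lambda \neq 0$ for each of the remaining eigenvalues $\lambda$ of $f'(0)$. 3. $f''(0)pq \notin \mathrm{im}\, f'(0)$ if $p \in \ker f'(0)\setminus\{0\}$ and $q \in \ker (f'(0))^2\setminus\ker f'(0)$. Then the system $x'=f(x)$ has a local, two-dimensional, $C^2$ center manifold at the origin, on which the reduced dynamics admits a description in local coordinates $u=(u_1,u_2)$ (with the origin of $\mathbb{R}^n$ corresponding to $u=(0,0)$) of the form $u'=\xi(u)$, where $\xi=(\xi_1,\xi_2)$ is a $C^2$ map defined near $(0,0)$ such that (i) $\xi(u_1,0)=0$ for $u_1$ sufficiently close to $0$; (ii) $\dfrac{\partial \xi_2}{\partial u_2}(0,0)=0$; (iii) $\dfrac{\partial \xi_1}{\partial u_2}(0,0)\neq 0$; (iv) $\dfrac{\partial^2 \xi_2}{\partial u_1\partial u_2}(0,0)\neq 0$.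
   Context: A "double index-two zero eigenvalue" of a square matrix means that $\lambda=0$ is an eigenvalue of algebraic multiplicity two and geometric multiplicity one, i.e. it corresponds to a single $2\times 2$ Jordan block (in particular $n\ge 2$). $f''(0)pq$ denotes the second derivative of $f$ at $0$, as a symmetric bilinear map, evaluated at $(p,q)$. A local center manifold at $0$ is a locally invariant manifold through $0$ tangent at $0$ to the generalized eigenspace of $f'(0)$ for the eigenvalues with zero real part (here $\ker (f'(0))^2$). *)

theory Defs
  imports "HOL-Analysis.Analysis" "HOL-Computational_Algebra.Polynomial"
begin

subsection \<open>Twice continuously differentiable maps\<close>

text \<open>Only meant for open sets \<open>S\<close>; \<open>f'\<close> and \<open>f''\<close> are the first and second derivative of \<open>f\<close>.\<close>

definition C2_on ::
  "'a::real_normed_vector set \<Rightarrow> ('a \<Rightarrow> 'b::real_normed_vector) \<Rightarrow> bool" where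
  "C2_on S f \<longleftrightarrow>
     (\<exists>(f' :: 'a \<Rightarrow> 'a \<Rightarrow>\<^sub>L 'b) (f'' :: 'a \<Rightarrow> 'a \<Rightarrow>\<^sub>L 'a \<Rightarrow>\<^sub>L 'b).
        (\<forall>x\<in>S. (f has_derivative blinfun_apply (f' x)) (at x)) \<and>
        (\<forall>x\<in>S. (f' has_derivative blinfun_apply (f'' x)) (at x)) \<and>
        continuous_on S f'')"

definition second_derivative ::
  "('a::real_normed_vector \<Rightarrow> 'b::real_normed_vector) \<Rightarrow> 'a \<Rightarrow> 'a \<Rightarrow> 'a \<Rightarrow> 'b" where
  "second_derivative f x p q =
     frechet_derivative (\<lambda>y. frechet_derivative f (at y) q) (at x) p"

definition partial_derivative :: "'n \<Rightarrow> (real^'n \<Rightarrow> real) \<Rightarrow> real^'n \<Rightarrow> real" where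
  "partial_derivative j g u = deriv (\<lambda>t. g (u + axis j t)) 0"


subsection \<open>Spectral notions for square matrices\<close>

definition charpoly :: "'a::comm_ring_1^'n^'n \<Rightarrow> 'a poly" where
  "charpoly A = det (mat [:0, 1:] - map_matrix (\<lambda>a. [:a:]) A)"

definition is_eigenvalue :: "'a::field^'n^'n \<Rightarrow> 'a \<Rightarrow> bool" where
  "is_eigenvalue A l \<longleftrightarrow> (\<exists>v. v \<noteq> 0 \<and> A *v v = l *s v)"

definition alg_mult :: "'a::field^'n^'n \<Rightarrow> 'a \<Rightarrow> nat" where
  "alg_mult A l = order l (charpoly A)"

definition geom_mult :: "'a::field^'n^'n \<Rightarrow> 'a \<Rightarrow> nat" where
  "geom_mult A l = vec.dim {v. A *v v = l *s v}"

definition double_index_two_zero_eigenvalue :: "real^'n^'n \<Rightarrow> bool" where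
  "double_index_two_zero_eigenvalue A \<longleftrightarrow>
     is_eigenvalue A 0 \<and> alg_mult A 0 = 2 \<and> geom_mult A 0 = 1"

definition mat_ker :: "'a::field^'n^'m \<Rightarrow> ('a^'n) set" where
  "mat_ker A = {v. A *v v = 0}"

definition complexify :: "real^'n^'m \<Rightarrow> complex^'n^'m" where
  "complexify A = map_matrix complex_of_real A"

definition gen_eigenspace :: "'a::field^'n^'n \<Rightarrow> 'a \<Rightarrow> ('a^'n) set" where
  "gen_eigenspace A l = {v. \<exists>k. (((*v) (A - mat l)) ^^ k) v = 0}"

text \<open>The real part of the complex span of the generalized eigenspaces belonging to all
  eigenvalues on the imaginary axis (a non-eigenvalue contributes only the zero vector).\<close>

definition center_subspace :: "real^'n^'n \<Rightarrow> (real^'n) set" where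
  "center_subspace A =
     {v. (\<chi> i. complex_of_real (v $ i)) \<in>
           vec.span (\<Union>l\<in>{l. Re l = 0}. gen_eigenspace (complexify A) l)}"


subsection \<open>Surfaces, invariance and center manifolds\<close>

text \<open>A regular \<open>C\<^sup>2\<close> parametrization \<open>\<phi>\<close>, with parameter domain \<open>U\<close>, of a relatively open
  part of \<open>M\<close>; its inverse is a system of local coordinates.\<close>

definition C2_param ::
  "'a::euclidean_space set \<Rightarrow> (real^2 \<Rightarrow> 'a) \<Rightarrow> (real^2) set \<Rightarrow> bool" where
  "C2_param M \<phi> U \<longleftrightarrow>
     open U \<and> C2_on U \<phi> \<and> (\<forall>u\<in>U. inj (frechet_derivative \<phi> (at u))) \<and>
     (\<exists>\<psi>. homeomorphism U (\<phi> ` U) \<phi> \<psi>) \<and> openin (top_of_set M) (\<phi> ` U)"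

definition C2_surface :: "'a::euclidean_space set \<Rightarrow> bool" where
  "C2_surface M \<longleftrightarrow> (\<forall>p\<in>M. \<exists>\<phi> U. C2_param M \<phi> U \<and> p \<in> \<phi> ` U)"

definition tangent_space :: "'a::real_normed_vector set \<Rightarrow> 'a \<Rightarrow> 'a set" where
  "tangent_space M p =
     {v. \<exists>\<gamma>. \<gamma> 0 = p \<and> eventually (\<lambda>t. \<gamma> t \<in> M) (nhds (0::real)) \<and>
             (\<gamma> has_vector_derivative v) (at 0)}"

definition solves ::
  "(real \<Rightarrow> 'a::real_normed_vector) \<Rightarrow> ('a \<Rightarrow> 'a) \<Rightarrow> real set \<Rightarrow> bool" where
  "solves x f J \<longleftrightarrow>
     is_interval J \<and> (\<forall>t\<in>J. (x has_vector_derivative f (x t)) (at t within J))"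

text \<open>A solution meeting \<open>M\<close> stays in \<open>M\<close> for as long as it stays in some fixed open
  neighbourhood \<open>V\<close> of \<open>M\<close>.\<close>

definition locally_invariant ::
  "('a::real_normed_vector \<Rightarrow> 'a) \<Rightarrow> 'a set \<Rightarrow> bool" where
  "locally_invariant f M \<longleftrightarrow>
     (\<exists>V. open V \<and> M \<subseteq> V \<and>
        (\<forall>x J. solves x f J \<and> x ` J \<subseteq> V \<and> (\<exists>t\<in>J. x t \<in> M) \<longrightarrow> x ` J \<subseteq> M))"

definition local_C2_center_manifold_2 :: "(real^'n \<Rightarrow> real^'n) \<Rightarrow> (real^'n) set \<Rightarrow> bool" where
  "local_C2_center_manifold_2 f M \<longleftrightarrow>
     C2_surface M \<and> 0 \<in> M \<and> locally_invariant f M \<and>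
     tangent_space M 0 = center_subspace (jacobian f (at 0))"

text \<open>In the coordinates \<open>u\<close> given by \<open>x = \<phi> u\<close>, the system \<open>x' = f x\<close> reads \<open>u' = \<xi> u\<close>.\<close>

definition reads_in_coordinates ::
  "('a::real_normed_vector \<Rightarrow> 'a) \<Rightarrow> ('b::real_normed_vector \<Rightarrow> 'a) \<Rightarrow> 'b set \<Rightarrow>
     ('b \<Rightarrow> 'b) \<Rightarrow> bool" where
  "reads_in_coordinates f \<phi> U \<xi> \<longleftrightarrow>
     (\<forall>u J. u ` J \<subseteq> U \<longrightarrow> (solves (\<phi> \<circ> u) f J \<longleftrightarrow> solves u \<xi> J))"

end

theory Submission
  imports Defs "HOL-Computational_Algebra.Fundamental_Theorem_Algebra"
begin

text \<open>
  Write \<open>f x = A x + r x\<close> with \<open>A = f'(0)\<close>. The statement has two halves: a local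
  center manifold of class \<open>C\<^sup>2\<close> exists, and the reduced vector field in suitable
  coordinates has the stated derivatives.

  The manifold is found by the method of Lyapunov and Perron. The remainder \<open>r\<close> is replaced,
  outside a small ball, so that the new map \<open>g\<close> is globally \<open>C\<^sup>2\<close> with a
  small first derivative (\<open>flat_extension\<close>). The center manifold of \<open>x' = A x + g
  x\<close> consists of the initial values of those solutions on the whole time axis that grow at most like
  \<open>exp (\<eta> \<bar>t\<bar>)\<close>, where \<open>\<eta>\<close> is small compared with the distance
  of the nonzero eigenvalues from the imaginary axis. Such a solution is a fixed point \<open>x = e y + K (g
  \<circ> x)\<close>: here \<open>e y\<close> is the solution of \<open>x' = A x\<close> that starts at the
  point \<open>y\<close> of the center subspace, and \<open>K w\<close> is the only slowly growing solution
  of \<open>z' = A z + w\<close> whose center component vanishes at time zero. Smallness of the derivative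
  of \<open>g\<close> makes this a contraction.

  The operator \<open>K\<close> is built component by component. On the hyperbolic part a product of factors
  \<open>A - l\<close> with \<open>Re l \<noteq> 0\<close> vanishes, and \<open>z' = A z + w\<close> is
  solved by recursion over the list of these \<open>l\<close>, each step being a scalar equation \<open>z' =
  l z + w\<close> (\<open>hyperbolic_resolvent\<close>). On the center part \<open>A\<^sup>2 = 0\<close>,
  and two integrations suffice.

  Regularity of \<open>\<phi> y = x 0\<close> in the parameter \<open>y\<close> is the delicate point,
  because substitution \<open>x \<mapsto> g \<circ> x\<close> is in general not differentiable as a map of a
  space with a fixed exponential weight into itself. The first and second variation are therefore written
  down as solutions of the linearised fixed point equation, and the Taylor remainders are estimated in the
  larger weights \<open>2 \<eta>\<close> and \<open>3 \<eta>\<close>, in which they are small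
  (\<open>variation_error\<close>, \<open>variation2_error\<close>, \<open>variation2_diff\<close>).

  Since time shifts of slowly growing solutions grow slowly, an orbit stays on the graph of
  \<open>\<phi>\<close>. Differentiating this at time zero gives \<open>F (\<phi> y) = \<phi>' y (\<pi> (F
  (\<phi> y)))\<close> for \<open>F x = A x + g x\<close>, with \<open>\<pi>\<close> the coordinates of the
  projection to the center subspace (\<open>parametrization_exists\<close>). Local invariance follows
  because the deviation \<open>x - \<phi> (\<pi> x)\<close> of any solution satisfies a linear differential
  inequality. The coordinates \<open>\<pi>\<close> are linear, so the reduced field \<open>\<xi> = \<pi>
  \<circ> F \<circ> \<phi>\<close> is of class \<open>C\<^sup>2\<close> together with \<open>\<phi>\<close>
  and \<open>F\<close>.

  For the second half let \<open>p\<close> be the unit vector along the line of equilibria, so that \<open>A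
  p = 0\<close>, and let \<open>A q = p\<close>. The multiplicities force such a \<open>q\<close> to exist
  and \<open>ker A\<^sup>2 = span {p, q}\<close> to be the whole generalised kernel
  (\<open>jordan_chain\<close>). The equilibria \<open>s p\<close> are bounded solutions, hence lie on the
  manifold, and \<open>\<xi>\<close> vanishes on the first coordinate axis. In the basis \<open>p, q\<close>
  the linear part of the reduced system is \<open>u\<^sub>1' = u\<^sub>2\<close>, \<open>u\<^sub>2' =
  0\<close>, which gives both first derivatives. The second coordinate of \<open>\<pi>\<close> vanishes
  exactly on the image of \<open>A\<close>. So the mixed second derivative of \<open>\<xi>\<^sub>2\<close>
  at zero is this coordinate of \<open>f''(0) p q\<close>, the term with \<open>A \<phi>''(0)\<close>
  dropping out, and it is nonzero by the assumption on \<open>f''(0)\<close>.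
\<close>

section \<open>Maps with two continuous derivatives\<close>

text \<open>The derivatives are arguments, where \<open>C2_on\<close> only asserts that they exist, because
  the estimates and the final computation refer to them by name.\<close>

definition has_C2_derivs ::
  "('a::real_normed_vector \<Rightarrow> 'b::real_normed_vector) \<Rightarrow> ('a \<Rightarrow> 'a \<Rightarrow>\<^sub>L 'b) \<Rightarrow> ('a \<Rightarrow> 'a \<Rightarrow>\<^sub>L 'a \<Rightarrow>\<^sub>L 'b) \<Rightarrow> bool" where
  "has_C2_derivs f f' f'' \<longleftrightarrow> (\<forall>x. (f has_derivative blinfun_apply (f' x)) (at x)) \<and>
     (\<forall>x. (f' has_derivative blinfun_apply (f'' x)) (at x)) \<and> continuous_on UNIV f''"

lemma C2_on_UNIV_iff: "C2_on UNIV f \<longleftrightarrow> (\<exists>f' f''. has_C2_derivs f f' f'')"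
  by (simp add: C2_on_def has_C2_derivs_def)

lemma has_C2_derivs_imp_C2_on: "has_C2_derivs f f' f'' \<Longrightarrow> C2_on S f"
  unfolding C2_on_def has_C2_derivs_def using continuous_on_subset[OF _ subset_UNIV] by blast

text \<open>Expanding an operator in the finitely many rank-one operators \<open>h \<mapsto> (h \<bullet> k) F
  k\<close> reduces differentiability in the operator norm to differentiability of the values \<open>F x
  k\<close>.\<close>

lemma blinfun_eq_sum_Basis:
  fixes F :: "'a::euclidean_space \<Rightarrow>\<^sub>L 'b::real_normed_vector"
  shows "F = (\<Sum>k\<in>Basis. blinfun_scaleR_left (F k) o\<^sub>L blinfun_inner_left k)"
  by (rule blinfun_euclidean_eqI)
    (simp add: blinfun.sum_left inner_Basis if_distrib[of "\<lambda>c. c *\<^sub>R _"] cong: if_cong)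

lemma has_derivative_blinfun_componentwise:
  fixes F :: "'c::real_normed_vector \<Rightarrow> 'a::euclidean_space \<Rightarrow>\<^sub>L 'b::real_normed_vector"
  assumes "\<And>k. k \<in> Basis \<Longrightarrow> ((\<lambda>x. F x k) has_derivative (\<lambda>h. F' h k)) (at x)"
  shows "(F has_derivative (\<lambda>h. \<Sum>k\<in>Basis. blinfun_scaleR_left (F' h k) o\<^sub>L blinfun_inner_left k)) (at x)"
proof -
  have "((\<lambda>x. \<Sum>k\<in>Basis. blinfun_scaleR_left (F x k) o\<^sub>L blinfun_inner_left k) has_derivative
    (\<lambda>h. \<Sum>k\<in>Basis. blinfun_scaleR_left (F' h k) o\<^sub>L blinfun_inner_left k)) (at x)"
    by (intro has_derivative_sum assms bounded_linear.has_derivative[OF bounded_linear_compose,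
          OF bounded_bilinear.bounded_linear_left[OF bounded_bilinear_blinfun_compose] bounded_linear_blinfun_scaleR_left])
  then show ?thesis
    by (simp only: blinfun_eq_sum_Basis[symmetric])
qed

text \<open>In finite dimensions pointwise calculus suffices: the partial derivatives may be given as plain
  functions, and bilinearity of the second one comes for free from uniqueness of derivatives.\<close>

lemma has_C2_derivsI:
  fixes f :: "'a::euclidean_space \<Rightarrow> 'b::real_normed_vector"
  assumes f: "\<And>x. (f has_derivative F1 x) (at x)"
    and F1: "\<And>x k. ((\<lambda>x. F1 x k) has_derivative (\<lambda>h. F2 x h k)) (at x)"
    and F2: "\<And>h k. continuous_on UNIV (\<lambda>x. F2 x h k)"
  shows "\<exists>f' f''. has_C2_derivs f f' f'' \<and> (\<forall>x k. f' x k = F1 x k) \<and> (\<forall>x h k. f'' x h k = F2 x h k)"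
proof -
  define f' where "f' x = Blinfun (F1 x)" for x
  have f': "blinfun_apply (f' x) = F1 x" for x
    unfolding f'_def by (rule bounded_linear_Blinfun_apply[OF has_derivative_bounded_linear[OF f]])
  define D where "D x h = (\<Sum>k\<in>Basis. blinfun_scaleR_left (F2 x h k) o\<^sub>L blinfun_inner_left k)" for x h
  have D: "(f' has_derivative D x) (at x)" for x
    unfolding D_def by (rule has_derivative_blinfun_componentwise) (simp add: f' F1)
  define f'' where "f'' x = Blinfun (D x)" for x
  have f''D: "blinfun_apply (f'' x) = D x" for x
    unfolding f''_def by (rule bounded_linear_Blinfun_apply[OF has_derivative_bounded_linear[OF D]])
  have f'': "f'' x h k = F2 x h k" for x h k
  proof -
    have "((\<lambda>x. f' x k) has_derivative (\<lambda>h. D x h k)) (at x)"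
      by (rule bounded_linear.has_derivative[OF blinfun.bounded_linear_left D])
    then have "(\<lambda>h. D x h k) = (\<lambda>h. F2 x h k)"
      unfolding f' using F1 has_derivative_unique by blast
    then show ?thesis by (simp add: f''D fun_eq_iff)
  qed
  have "has_C2_derivs f f' f''"
    unfolding has_C2_derivs_def f' f''D
    by (intro conjI allI f D continuous_on_blinfun_componentwise) (simp add: f'' F2)
  with f' f'' show ?thesis by metis
qed

lemma has_C2_derivs_cont:
  assumes "has_C2_derivs f f' f''" "continuous_on S u"
  shows "continuous_on S (\<lambda>x. f (u x))" "continuous_on S (\<lambda>x. f' (u x))" "continuous_on S (\<lambda>x. f'' (u x))"
proof -
  have "continuous_on UNIV f" "continuous_on UNIV f'" "continuous_on UNIV f''"
    using assms(1) has_derivative_continuous unfolding has_C2_derivs_def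
    by (blast intro: continuous_at_imp_continuous_on)+
  from this[THEN continuous_on_compose2, OF assms(2)] show
    "continuous_on S (\<lambda>x. f (u x))" "continuous_on S (\<lambda>x. f' (u x))" "continuous_on S (\<lambda>x. f'' (u x))"
    by auto
qed

lemma has_C2_derivs_deriv:
  assumes "has_C2_derivs f f' f''" "(u has_derivative u') (at x within S)"
  shows "((\<lambda>x. f (u x)) has_derivative (\<lambda>h. f' (u x) (u' h))) (at x within S)"
    "((\<lambda>x. f' (u x)) has_derivative (\<lambda>h. f'' (u x) (u' h))) (at x within S)"
  using has_derivative_compose[OF assms(2)] assms(1) unfolding has_C2_derivs_def by blast+

lemma has_C2_derivs_compose:
  fixes f :: "'a::euclidean_space \<Rightarrow> 'b::real_normed_vector" and g :: "'b \<Rightarrow> 'c::real_normed_vector"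
  assumes f: "has_C2_derivs f f' f''" and g: "has_C2_derivs g g' g''"
  shows "\<exists>d d2. has_C2_derivs (\<lambda>x. g (f x)) d d2 \<and> (\<forall>x k. d x k = g' (f x) (f' x k)) \<and>
    (\<forall>x h k. d2 x h k = g'' (f x) (f' x h) (f' x k) + g' (f x) (f'' x h k))"
proof (rule has_C2_derivsI)
  note ff = has_C2_derivs_deriv[OF f has_derivative_ident]
  note gg = has_C2_derivs_deriv[OF g ff(1)]
  show "((\<lambda>x. g (f x)) has_derivative (\<lambda>k. g' (f x) (f' x k))) (at x)" for x
    by (rule gg)
  show "((\<lambda>x. g' (f x) (f' x k)) has_derivative
      (\<lambda>h. g'' (f x) (f' x h) (f' x k) + g' (f x) (f'' x h k))) (at x)" for x k
  proof -
    have "((\<lambda>x. f' x k) has_derivative (\<lambda>h. f'' x h k)) (at x)"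
      by (rule bounded_linear.has_derivative[OF blinfun.bounded_linear_left ff(2)])
    from blinfun.FDERIV[OF gg(2) this] show ?thesis
      by (simp add: add.commute)
  qed
  show "continuous_on UNIV (\<lambda>x. g'' (f x) (f' x h) (f' x k) + g' (f x) (f'' x h k))" for h k
    by (intro continuous_intros has_C2_derivs_cont[OF f] has_C2_derivs_cont[OF g])
qed

lemma has_C2_derivs_add_linear:
  assumes g: "has_C2_derivs g g' g''"
  shows "has_C2_derivs (\<lambda>x. blinfun_apply l x + g x) (\<lambda>x. l + g' x) g''"
  using g unfolding has_C2_derivs_def
  by (auto intro!: derivative_eq_intros simp: blinfun.bilinear_simps blinfun.bounded_linear_right bounded_linear_imp_has_derivative)

section \<open>Modifying the nonlinearity away from the origin\<close>

text \<open>A bump function on the line that is only \<open>C\<^sup>2\<close>: composing the cubic ramp with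
  itself is enough here and keeps all derivatives explicit.\<close>

definition ramp3 :: "real \<Rightarrow> real" where "ramp3 r = max 0 r ^ 3"

lemma ramp_power_deriv:
  "((\<lambda>r. max 0 r ^ Suc (Suc n)) has_real_derivative real (Suc (Suc n)) * max 0 r ^ Suc n) (at (r::real))"
proof -
  consider "r < 0" | "r > 0" | "r = 0" by linarith
  then show ?thesis
  proof cases
    case 1
    have "((\<lambda>r. 0) has_real_derivative 0) (at r)" by simp
    then have "((\<lambda>r. max 0 r ^ Suc (Suc n)) has_real_derivative 0) (at r)"
      by (rule has_field_derivative_transform_within_open[of _ _ _ "{..<0}"]) (use 1 in auto)
    then show ?thesis using 1 by simp
  next
    case 2
    have "((\<lambda>r. r ^ Suc (Suc n)) has_real_derivative real (Suc (Suc n)) * r ^ Suc n) (at r)"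
      by (rule derivative_eq_intros refl | simp)+
    then have "((\<lambda>r. max 0 r ^ Suc (Suc n)) has_real_derivative real (Suc (Suc n)) * r ^ Suc n) (at r)"
      by (rule has_field_derivative_transform_within_open[of _ _ _ "{0<..}"]) (use 2 in auto)
    then show ?thesis using 2 by simp
  next
    case 3
    have "((\<lambda>h. max 0 h ^ Suc n) \<longlongrightarrow> max 0 0 ^ Suc n) (at (0::real))"
      by (intro tendsto_intros)
    then have "((\<lambda>h. max 0 h ^ Suc n) \<longlongrightarrow> 0) (at (0::real))" by simp
    moreover have "eventually (\<lambda>h::real. max 0 h ^ Suc n = max 0 h ^ Suc (Suc n) / h) (at 0)"
      by (auto simp: eventually_at_filter max_def)
    ultimately have "((\<lambda>h. max 0 h ^ Suc (Suc n) / h) \<longlongrightarrow> 0) (at (0::real))"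
      by (rule Lim_transform_eventually)
    then show ?thesis using 3 by (simp add: has_field_derivative_def[symmetric] DERIV_def)
  qed
qed

lemma ramp3_deriv: "(ramp3 has_real_derivative 3 * max 0 r ^ 2) (at r)"
  using ramp_power_deriv[of 1 r] by (simp add: ramp3_def[abs_def] numeral_eq_Suc)

lemma ramp2_deriv: "((\<lambda>r. max 0 r ^ 2) has_real_derivative 2 * max 0 r) (at (r::real))"
  using ramp_power_deriv[of 0 r] by (simp add: numeral_eq_Suc)

definition bump :: "real \<Rightarrow> real" where "bump r = ramp3 (1 - ramp3 (r - 1))"
definition bump' :: "real \<Rightarrow> real" where
  "bump' r = - (3 * max 0 (1 - ramp3 (r - 1)) ^ 2 * (3 * max 0 (r - 1) ^ 2))"
definition bump'' :: "real \<Rightarrow> real" where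
  "bump'' r = 6 * max 0 (1 - ramp3 (r - 1)) * (3 * max 0 (r - 1) ^ 2) ^ 2 -
     3 * max 0 (1 - ramp3 (r - 1)) ^ 2 * (6 * max 0 (r - 1))"

lemma ramp3_shift_deriv:
  "((\<lambda>r. 1 - ramp3 (r - 1)) has_real_derivative - (3 * max 0 (r - 1) ^ 2)) (at r)"
proof -
  have "((\<lambda>r. r - 1) has_real_derivative 1) (at r)"
    by (rule derivative_eq_intros refl | simp)+
  from DERIV_diff[OF DERIV_const DERIV_chain2[OF ramp3_deriv this], of 1] show ?thesis by simp
qed

lemma bump_deriv: "(bump has_real_derivative bump' r) (at r)"
  unfolding bump_def[abs_def] bump'_def
  using DERIV_chain2[OF ramp3_deriv ramp3_shift_deriv, of r] by simp

lemma bump'_deriv: "(bump' has_real_derivative bump'' r) (at r)"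
proof -
  have "((\<lambda>r. r - 1) has_real_derivative 1) (at r)"
    by (rule derivative_eq_intros refl | simp)+
  note d = DERIV_mult[OF DERIV_chain2[OF ramp2_deriv ramp3_shift_deriv, of r] DERIV_chain2[OF ramp2_deriv this]]
  have "((\<lambda>r. - 9 * (max 0 (1 - ramp3 (r - 1)) ^ 2 * max 0 (r - 1) ^ 2)) has_real_derivative bump'' r) (at r)"
    by (rule DERIV_cong[OF DERIV_cmult[OF d]]) (simp add: bump''_def power2_eq_square algebra_simps)
  moreover have "bump' = (\<lambda>r. - 9 * (max 0 (1 - ramp3 (r - 1)) ^ 2 * max 0 (r - 1) ^ 2))"
    by (simp add: bump'_def fun_eq_iff)
  ultimately show ?thesis by simp
qed

lemma bump''_cont: "continuous_on UNIV bump''"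
  unfolding bump''_def[abs_def] ramp3_def by (intro continuous_intros)

lemma bump_eq_1: "r \<le> 1 \<Longrightarrow> bump r = 1"
  by (simp add: bump_def ramp3_def max_def)

lemma bump_eq_0:
  assumes "2 \<le> r" shows "bump r = 0" "bump' r = 0" "bump'' r = 0"
proof -
  have "1 \<le> ramp3 (r - 1)" using assms by (simp add: ramp3_def)
  then have "max 0 (1 - ramp3 (r - 1)) = 0" by simp
  then show "bump r = 0" "bump' r = 0" "bump'' r = 0"
    by (simp_all add: bump_def bump'_def bump''_def ramp3_def)
qed

lemma bump_bound: "\<bar>bump r\<bar> \<le> 1"
  by (auto simp: bump_def ramp3_def intro!: power_le_one)

lemma bump'_bound: "\<bar>bump' r\<bar> \<le> 9"
proof (cases "2 \<le> r")
  case False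
  have "max 0 (1 - ramp3 (r - 1)) ^ 2 \<le> 1" "max 0 (r - 1) ^ 2 \<le> 1"
    using False by (auto simp: ramp3_def intro!: power_le_one)
  then have "max 0 (1 - ramp3 (r - 1)) ^ 2 * max 0 (r - 1) ^ 2 \<le> 1 * 1"
    by (intro mult_mono) auto
  then show ?thesis by (simp add: bump'_def abs_mult)
qed (simp add: bump_eq_0)

lemma bump_has_derivative:
  assumes "(u has_derivative u') (at x)"
  shows "((\<lambda>x. bump (u x)) has_derivative (\<lambda>h. bump' (u x) * u' h)) (at x)"
    "((\<lambda>x. bump' (u x)) has_derivative (\<lambda>h. bump'' (u x) * u' h)) (at x)"
  using has_derivative_compose[OF assms bump_deriv[unfolded has_field_derivative_def]]
    has_derivative_compose[OF assms bump'_deriv[unfolded has_field_derivative_def]] by auto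

lemma bump_cont:
  assumes "continuous_on S u"
  shows "continuous_on S (\<lambda>x. bump (u x))" "continuous_on S (\<lambda>x. bump' (u x))" "continuous_on S (\<lambda>x. bump'' (u x))"
proof -
  have "continuous_on UNIV bump" "continuous_on UNIV bump'"
    using bump_deriv bump'_deriv by (meson DERIV_isCont continuous_at_imp_continuous_on)+
  from this[THEN continuous_on_compose2, OF assms] bump''_cont[THEN continuous_on_compose2, OF assms]
  show "continuous_on S (\<lambda>x. bump (u x))" "continuous_on S (\<lambda>x. bump' (u x))" "continuous_on S (\<lambda>x. bump'' (u x))"
    by auto
qed

text \<open>The nonlinearity is precomposed with this map instead of being multiplied by a bump function. The
  values of the modified map are then values of the original one on the same ray, so zeros along a line
  through the origin survive.\<close>

definition cutoff :: "real \<Rightarrow> 'e::real_inner \<Rightarrow> 'e" where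
  "cutoff \<rho> x = bump (x \<bullet> x / \<rho>\<^sup>2) *\<^sub>R x"

text \<open>The bound on the derivative is independent of \<open>\<rho>\<close>, because the derivative
  depends on \<open>x\<close> and \<open>\<rho>\<close> only through \<open>x / \<rho>\<close>. The number 37
  is \<open>1 + 2 \<cdot> 9 \<cdot> 2\<close>: the bounds for \<open>bump\<close> and \<open>bump'\<close> at
  \<open>x \<bullet> x \<le> 2 \<rho>\<^sup>2\<close>.\<close>

lemma cutoff_C2:
  assumes "0 < \<rho>"
  obtains T' T'' where "has_C2_derivs (cutoff \<rho> :: 'e::euclidean_space \<Rightarrow> 'e) T' T''"
    "\<And>x. norm (T' x) \<le> 37" "\<And>x. 2 * \<rho> \<le> norm x \<Longrightarrow> cutoff \<rho> x = 0 \<and> T' x = 0 \<and> T'' x = 0"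
proof -
  let ?q = "\<lambda>x::'e. x \<bullet> x / \<rho>\<^sup>2"
  let ?F1 = "\<lambda>x k. bump (?q x) *\<^sub>R k + (bump' (?q x) * (2 * (x \<bullet> k) / \<rho>\<^sup>2)) *\<^sub>R x"
  let ?F2 = "\<lambda>x h k. (bump' (?q x) * (2 * (x \<bullet> h) / \<rho>\<^sup>2)) *\<^sub>R k +
      ((bump'' (?q x) * (2 * (x \<bullet> h) / \<rho>\<^sup>2) * (2 * (x \<bullet> k) / \<rho>\<^sup>2) + bump' (?q x) * (2 * (h \<bullet> k) / \<rho>\<^sup>2)) *\<^sub>R x +
      (bump' (?q x) * (2 * (x \<bullet> k) / \<rho>\<^sup>2)) *\<^sub>R h)"
  have q: "(?q has_derivative (\<lambda>h. 2 * (x \<bullet> h) / \<rho>\<^sup>2)) (at x)" for x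
    by (rule has_derivative_eq_rhs[OF bounded_linear.has_derivative[OF bounded_linear_divide
            has_derivative_inner[OF has_derivative_ident has_derivative_ident]]]) (simp add: inner_commute fun_eq_iff)
  have lin: "((\<lambda>x. 2 * (x \<bullet> k) / \<rho>\<^sup>2) has_derivative (\<lambda>h. 2 * (h \<bullet> k) / \<rho>\<^sup>2)) (at x)" for x k
    by (intro bounded_linear_imp_has_derivative bounded_linear_compose[OF bounded_linear_divide]
        bounded_linear_compose[OF bounded_linear_mult_right] bounded_linear_inner_left)
  have "\<exists>T' T''. has_C2_derivs (cutoff \<rho>) T' T'' \<and> (\<forall>x k. T' x k = ?F1 x k) \<and> (\<forall>x h k. T'' x h k = ?F2 x h k)"
  proof (rule has_C2_derivsI)
    show "(cutoff \<rho> has_derivative ?F1 x) (at x)" for x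
      unfolding cutoff_def[abs_def]
      by (rule has_derivative_eq_rhs[OF has_derivative_scaleR[OF bump_has_derivative(1)[OF q] has_derivative_ident]]) simp
    show "((\<lambda>x. ?F1 x k) has_derivative (\<lambda>h. ?F2 x h k)) (at x)" for x k
      by (rule has_derivative_eq_rhs[OF has_derivative_add[OF
              has_derivative_scaleR[OF bump_has_derivative(1)[OF q] has_derivative_const]
              has_derivative_scaleR[OF has_derivative_mult[OF bump_has_derivative(2)[OF q] lin] has_derivative_ident]]])
        (simp add: fun_eq_iff algebra_simps)
    show "continuous_on UNIV (\<lambda>x. ?F2 x h k)" for h k
      using assms by (intro continuous_intros bump_cont) auto
  qed
  then obtain T' T'' where T: "has_C2_derivs (cutoff \<rho>) T' T''" "\<And>x k. T' x k = ?F1 x k" "\<And>x h k. T'' x h k = ?F2 x h k"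
    by blast
  have out: "cutoff \<rho> x = 0 \<and> T' x = 0 \<and> T'' x = 0" if "2 \<le> ?q x" for x
    using bump_eq_0[OF that] by (auto intro!: blinfun_eqI simp: T cutoff_def)
  show thesis
  proof (rule that[OF T(1)])
    fix x :: 'e
    show "norm (T' x) \<le> 37"
    proof (cases "2 \<le> ?q x")
      case False
      show ?thesis
      proof (rule norm_blinfun_bound)
        fix k
        have "norm ((bump' (?q x) * (2 * (x \<bullet> k) / \<rho>\<^sup>2)) *\<^sub>R x) = \<bar>bump' (?q x)\<bar> * (2 * \<bar>x \<bullet> k\<bar> / \<rho>\<^sup>2) * norm x"
          by (simp add: abs_mult)
        also have "\<dots> \<le> 9 * (2 * (norm x * norm k) / \<rho>\<^sup>2) * norm x"
          by (intro mult_mono divide_right_mono mult_left_mono bump'_bound Cauchy_Schwarz_ineq2) auto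
        also have "\<dots> = 18 * ?q x * norm k"
          by (simp add: dot_square_norm power2_eq_square)
        also have "\<dots> \<le> 36 * norm k"
          using False by (intro mult_right_mono) auto
        finally have "norm (?F1 x k) \<le> norm (bump (?q x) *\<^sub>R k) + 36 * norm k"
          by (intro norm_triangle_le) auto
        also have "\<dots> \<le> 37 * norm k"
          using mult_right_mono[OF bump_bound norm_ge_zero, of "?q x" k] by simp
        finally show "norm (T' x k) \<le> 37 * norm k" by (simp add: T)
      qed simp
    qed (simp add: out)
    assume "2 * \<rho> \<le> norm x"
    then have "(2 * \<rho>)\<^sup>2 \<le> (norm x)\<^sup>2"
      using assms by (intro power_mono) auto
    then have "4 \<le> ?q x"
      using assms by (simp add: dot_square_norm field_simps)
    then show "cutoff \<rho> x = 0 \<and> T' x = 0 \<and> T'' x = 0"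
      by (intro out) simp
  qed
qed

lemma cutoff_eq_self:
  assumes "norm x < \<rho>" shows "cutoff \<rho> x = x"
proof -
  have "(norm x)\<^sup>2 \<le> \<rho>\<^sup>2"
    using assms by (intro power_mono) auto
  then have "x \<bullet> x / \<rho>\<^sup>2 \<le> 1"
    by (simp add: dot_square_norm divide_le_eq)
  then show ?thesis by (simp add: cutoff_def bump_eq_1)
qed

text \<open>Uniform continuity and boundedness combined into one inequality without case distinction. In this
  form it survives multiplication with exponential weights: a difference that grows like \<open>exp (\<eta>
  \<bar>t\<bar>)\<close> may be inserted for \<open>a - b\<close>.\<close>

lemma compactly_supported_modulus:
  fixes H :: "'a::euclidean_space \<Rightarrow> 'b::real_normed_vector"
  assumes H: "continuous_on UNIV H" and supp: "\<And>x. R \<le> norm x \<Longrightarrow> H x = 0"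
  obtains B where "\<And>x. norm (H x) \<le> B"
    "\<And>\<epsilon>. 0 < \<epsilon> \<Longrightarrow> \<exists>C\<ge>0. \<forall>a b. norm (H a - H b) \<le> \<epsilon> + C * norm (a - b)"
proof -
  let ?S = "cball 0 (R + 1) :: 'a set"
  have HS: "continuous_on ?S H" using H continuous_on_subset by blast
  obtain B where B: "0 < B" "\<And>x. x \<in> ?S \<Longrightarrow> norm (H x) \<le> B"
    using compact_imp_bounded[OF compact_continuous_image[OF HS compact_cball]]
    unfolding bounded_pos by auto
  have bd: "norm (H x) \<le> B" for x
    using B supp[of x] by (cases "norm x \<le> R + 1") auto
  have "\<exists>C\<ge>0. \<forall>a b. norm (H a - H b) \<le> \<epsilon> + C * norm (a - b)" if e: "0 < \<epsilon>" for \<epsilon>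
  proof -
    obtain d where d: "0 < d" "\<And>a b. a \<in> ?S \<Longrightarrow> b \<in> ?S \<Longrightarrow> dist b a < d \<Longrightarrow> dist (H b) (H a) < \<epsilon>"
      using compact_uniformly_continuous[OF HS compact_cball] e unfolding uniformly_continuous_on_def by metis
    \<comment> \<open>With \<open>d' \<le> 1\<close> two close points are both in the slightly larger ball or both outside the support.\<close>
    define d' where "d' = min d 1"
    have d': "0 < d'" "d' \<le> d" "d' \<le> 1" using d(1) by (auto simp: d'_def)
    have "norm (H a - H b) \<le> \<epsilon> + 2 * B / d' * norm (a - b)" for a b
    proof (cases "norm (a - b) < d'")
      case True
      have "norm (H a - H b) \<le> \<epsilon>"
      proof (cases "a \<in> ?S \<and> b \<in> ?S")
        case True
        then show ?thesis using d(2)[of b a] \<open>norm (a - b) < d'\<close> d' by (simp add: dist_norm)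
      next
        case False
        then have "R + 1 < norm a \<or> R + 1 < norm b" by auto
        moreover have "norm a \<le> norm b + norm (a - b)" "norm b \<le> norm a + norm (a - b)"
          using norm_triangle_sub[of a b] norm_triangle_sub[of b a] by (auto simp: norm_minus_commute)
        ultimately have "R \<le> norm a" "R \<le> norm b"
          using True d'(3) by auto
        then show ?thesis using e by (simp add: supp)
      qed
      moreover have "0 \<le> 2 * B / d' * norm (a - b)" using B(1) d'(1) by simp
      ultimately show ?thesis by linarith
    next
      case False
      have "norm (H a - H b) \<le> 2 * B"
        using norm_triangle_ineq4[of "H a" "H b"] bd[of a] bd[of b] by linarith
      also have "\<dots> \<le> 2 * B / d' * norm (a - b)"
        using False B(1) d'(1) by (simp add: field_simps)
      finally show ?thesis using e by linarith
    qed
    then show ?thesis using B(1) d'(1) by (intro exI[of _ "2 * B / d'"]) auto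
  qed
  with bd that show thesis by blast
qed

text \<open>On a ball of radius tending to zero the derivative of \<open>G\<close> becomes arbitrarily small
  while that of the cutoff stays below 37, so the derivative of the composition can be made smaller than any
  \<open>\<delta>\<close>.\<close>

lemma flat_extension:
  fixes G :: "'e::euclidean_space \<Rightarrow> 'e"
  assumes G: "has_C2_derivs G G' G''" and "G 0 = 0" "G' 0 = 0" and "0 < \<delta>"
  obtains \<rho> g g' g'' B where "0 < \<rho>" "has_C2_derivs g g' g''"
    "\<And>x. norm x < \<rho> \<Longrightarrow> g x = G x" "\<And>x. \<exists>c. g x = G (c *\<^sub>R x)"
    "\<And>x. norm (g' x) \<le> \<delta>" "\<And>x. norm (g'' x) \<le> B"
    "\<And>\<epsilon>. 0 < \<epsilon> \<Longrightarrow> \<exists>C\<ge>0. \<forall>a b. norm (g'' a - g'' b) \<le> \<epsilon> + C * norm (a - b)"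
proof -
  have "continuous (at 0) G'"
    using G has_derivative_continuous unfolding has_C2_derivs_def by blast
  moreover have "0 < \<delta> / 37" using \<open>0 < \<delta>\<close> by simp
  ultimately obtain d where d: "0 < d" "\<And>z. dist z 0 < d \<Longrightarrow> dist (G' z) (G' 0) < \<delta> / 37"
    unfolding continuous_at_eps_delta by blast
  define \<rho> where "\<rho> = d / 2"
  have \<rho>: "0 < \<rho>" using d by (simp add: \<rho>_def)
  obtain T' T'' where T: "has_C2_derivs (cutoff \<rho> :: 'e \<Rightarrow> 'e) T' T''"
    and T37: "\<And>x. norm (T' x) \<le> 37"
    and Tout: "\<And>x. 2 * \<rho> \<le> norm x \<Longrightarrow> cutoff \<rho> x = 0 \<and> T' x = 0 \<and> T'' x = 0"
    using cutoff_C2[OF \<rho>] by blast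
  obtain g' g'' where g: "has_C2_derivs (\<lambda>x. G (cutoff \<rho> x)) g' g''"
    and g': "\<And>x k. g' x k = G' (cutoff \<rho> x) (T' x k)"
    and g'': "\<And>x h k. g'' x h k = G'' (cutoff \<rho> x) (T' x h) (T' x k) + G' (cutoff \<rho> x) (T'' x h k)"
    using has_C2_derivs_compose[OF T G] by blast
  have small: "norm (cutoff \<rho> x) < d" for x :: 'e
  proof (cases "2 * \<rho> \<le> norm x")
    case False
    have "norm (cutoff \<rho> x) \<le> 1 * norm x"
      unfolding cutoff_def norm_scaleR by (intro mult_right_mono bump_bound) auto
    then show ?thesis using False by (simp add: \<rho>_def)
  qed (use Tout d in auto)
  have g'bd: "norm (g' x) \<le> \<delta>" for x
  proof (rule norm_blinfun_bound)
    fix k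
    have "norm (g' x k) \<le> norm (G' (cutoff \<rho> x)) * (norm (T' x) * norm k)"
      unfolding g' by (intro order_trans[OF norm_blinfun] mult_left_mono norm_blinfun) auto
    also have "\<dots> \<le> \<delta> / 37 * (37 * norm k)"
      using d(2)[of "cutoff \<rho> x"] small[of x] \<open>0 < \<delta>\<close> \<open>G' 0 = 0\<close>
      by (intro mult_mono T37) auto
    finally show "norm (g' x k) \<le> \<delta> * norm k" by simp
  qed (use \<open>0 < \<delta>\<close> in simp)
  have "continuous_on UNIV g''" using g by (simp add: has_C2_derivs_def)
  moreover have "g'' x = 0" if "2 * \<rho> \<le> norm x" for x
    using Tout[OF that] by (auto intro!: blinfun_eqI simp: g'')
  ultimately obtain B where B: "\<And>x. norm (g'' x) \<le> B"
    "\<And>\<epsilon>. 0 < \<epsilon> \<Longrightarrow> \<exists>C\<ge>0. \<forall>a b. norm (g'' a - g'' b) \<le> \<epsilon> + C * norm (a - b)"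
    using compactly_supported_modulus[of g'' "2 * \<rho>"] by metis
  show thesis
  proof (rule that[OF \<rho> g _ _ g'bd B])
    show "G (cutoff \<rho> x) = G x" if "norm x < \<rho>" for x
      using cutoff_eq_self[OF that] by simp
    show "\<exists>c. G (cutoff \<rho> x) = G (c *\<^sub>R x)" for x
      unfolding cutoff_def by blast
  qed
qed

section \<open>Functions of exponential growth\<close>

text \<open>Membership with norm at most \<open>c\<close> in the space of continuous functions with weight
  \<open>exp (- \<theta> \<bar>t\<bar>)\<close>. A predicate, unlike a type of such functions, lets one
  function be measured in several weights.\<close>

definition growth :: "real \<Rightarrow> real \<Rightarrow> (real \<Rightarrow> 'a::real_normed_vector) \<Rightarrow> bool" where
  "growth \<theta> c w \<longleftrightarrow> continuous_on UNIV w \<and> (\<forall>t. norm (w t) \<le> c * exp (\<theta> * \<bar>t\<bar>))"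

lemma growthI:
  "continuous_on UNIV w \<Longrightarrow> (\<And>t. norm (w t) \<le> c * exp (\<theta> * \<bar>t\<bar>)) \<Longrightarrow> growth \<theta> c w"
  by (simp add: growth_def)

lemma growthD: "growth \<theta> c w \<Longrightarrow> norm (w t) \<le> c * exp (\<theta> * \<bar>t\<bar>)"
  by (simp add: growth_def)

lemma growth_cont: "growth \<theta> c w \<Longrightarrow> continuous_on UNIV w"
  by (simp add: growth_def)

lemma growth_at_0: "growth \<theta> c w \<Longrightarrow> norm (w 0) \<le> c"
  using growthD[of \<theta> c w 0] by simp

lemma growth_nonneg: "growth \<theta> c w \<Longrightarrow> 0 \<le> c"
  using growth_at_0 norm_ge_zero order_trans by blast

lemma growth_mono:
  assumes "growth \<theta> c w" "\<theta> \<le> \<theta>'" "c \<le> c'"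
  shows "growth \<theta>' c' w"
proof (rule growthI)
  fix t
  have "c * exp (\<theta> * \<bar>t\<bar>) \<le> c' * exp (\<theta>' * \<bar>t\<bar>)"
    using assms growth_nonneg[OF assms(1)] by (intro mult_mono) (auto intro: mult_right_mono)
  then show "norm (w t) \<le> c' * exp (\<theta>' * \<bar>t\<bar>)"
    using growthD[OF assms(1), of t] by linarith
qed (rule growth_cont[OF assms(1)])

lemma growth_add:
  "growth \<theta> c v \<Longrightarrow> growth \<theta> d w \<Longrightarrow> growth \<theta> (c + d) (\<lambda>t. v t + w t)"
  unfolding growth_def
  by (auto intro!: continuous_intros norm_triangle_le simp: distrib_right add_mono)

lemma growth_diff:
  "growth \<theta> c v \<Longrightarrow> growth \<theta> d w \<Longrightarrow> growth \<theta> (c + d) (\<lambda>t. v t - w t)"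
  unfolding growth_def
  by (auto intro!: continuous_intros norm_triangle_le_diff simp: distrib_right add_mono)

lemma growth_scaleR: "growth \<theta> c v \<Longrightarrow> growth \<theta> (\<bar>r\<bar> * c) (\<lambda>t. r *\<^sub>R v t)"
  unfolding growth_def
  by (auto intro!: continuous_intros mult_left_mono simp: mult.assoc)

lemma growth_zero: "growth \<theta> 0 (\<lambda>t. 0)"
  by (simp add: growth_def)

lemma growth_zero_imp: "growth \<theta> 0 w \<Longrightarrow> w = (\<lambda>t. 0)"
  by (auto simp: growth_def)

lemma growth_dominated:
  assumes "continuous_on UNIV h" "growth \<theta> c a" "\<And>t. norm (h t) \<le> k * norm (a t)" "0 \<le> k"
  shows "growth \<theta> (k * c) h"
proof (rule growthI[OF assms(1)])
  fix t
  have "k * norm (a t) \<le> k * (c * exp (\<theta> * \<bar>t\<bar>))"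
    using growthD[OF assms(2)] assms(4) by (intro mult_left_mono) auto
  then show "norm (h t) \<le> k * c * exp (\<theta> * \<bar>t\<bar>)"
    using assms(3)[of t] by (simp add: mult.assoc)
qed

lemma growth_dominated_mult:
  assumes "continuous_on UNIV h" "growth \<theta> c a" "growth \<theta>' d b"
    and "\<And>t. norm (h t) \<le> k * norm (a t) * norm (b t)" "0 \<le> k" and "\<theta> + \<theta>' = \<sigma>"
  shows "growth \<sigma> (k * c * d) h"
proof (rule growthI[OF assms(1)])
  fix t
  have "k * norm (a t) * norm (b t) \<le> k * (c * exp (\<theta> * \<bar>t\<bar>)) * (d * exp (\<theta>' * \<bar>t\<bar>))"
    using growthD[OF assms(2)] growthD[OF assms(3)] assms(5) growth_nonneg[OF assms(2)]
    by (intro mult_mono) auto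
  also have "\<dots> = k * c * d * exp (\<sigma> * \<bar>t\<bar>)"
    unfolding assms(6)[symmetric] distrib_right exp_add by (simp add: ac_simps)
  finally show "norm (h t) \<le> k * c * d * exp (\<sigma> * \<bar>t\<bar>)"
    using assms(4)[of t] by linarith
qed

section \<open>Fixed points in weighted spaces\<close>

text \<open>The operator acts with the same bound in all weights between \<open>\<eta>\<close> and \<open>3
  \<eta>\<close>. The range is needed since every differentiation of the fixed point with respect to a
  parameter costs a factor \<open>exp (\<eta> \<bar>t\<bar>)\<close>. The product \<open>M * \<delta>\<close>
  is the contraction constant for nonlinearities with Lipschitz constant \<open>\<delta>\<close>.\<close>

locale growth_operator =
  fixes K :: "(real \<Rightarrow> 'e::euclidean_space) \<Rightarrow> real \<Rightarrow> 'e" and \<eta> M \<delta> :: real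
  assumes eta_pos: "0 < \<eta>" and M_nonneg: "0 \<le> M" and delta_nonneg: "0 \<le> \<delta>"
    and small: "M * \<delta> \<le> 1 / 2"
    and K_growth: "\<And>\<theta> c w. \<eta> \<le> \<theta> \<Longrightarrow> \<theta> \<le> 3 * \<eta> \<Longrightarrow> growth \<theta> c w \<Longrightarrow> growth \<theta> (M * c) (K w)"
    and K_add: "\<And>c d v w. growth (3 * \<eta>) c v \<Longrightarrow> growth (3 * \<eta>) d w \<Longrightarrow>
        K (\<lambda>t. v t + w t) = (\<lambda>t. K v t + K w t)"
    and K_scaleR: "\<And>c r v. growth (3 * \<eta>) c v \<Longrightarrow> K (\<lambda>t. r *\<^sub>R v t) = (\<lambda>t. r *\<^sub>R K v t)"
begin

lemma K_diff:
  assumes "growth (3 * \<eta>) c v" "growth (3 * \<eta>) d w"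
  shows "K (\<lambda>t. v t - w t) = (\<lambda>t. K v t - K w t)"
  using K_add[OF assms(1) growth_scaleR[OF assms(2), of "-1"]] K_scaleR[OF assms(2), of "-1"]
  by simp

lemma K_zero: "K (\<lambda>t. 0) = (\<lambda>t. 0)"
  using K_scaleR[OF growth_zero, of 0] by simp

text \<open>The best constant \<open>N\<close> for \<open>z\<close> satisfies \<open>N \<le> c + N /
  2\<close>. All later estimates, for the nonlinear equation and for its linearisations alike, rest on this
  one.\<close>

lemma a_priori_bound:
  assumes th: "\<eta> \<le> \<theta>" "\<theta> \<le> 3 * \<eta>" and z: "growth \<theta> C z" and w: "growth \<theta> c w"
    and v: "continuous_on UNIV v" "\<And>t. norm (v t) \<le> \<delta> * norm (z t)"
    and eq: "z = (\<lambda>t. w t + K v t)"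
  shows "growth \<theta> (2 * c) z"
proof -
  define N where "N = (SUP t. norm (z t) * exp (- (\<theta> * \<bar>t\<bar>)))"
  have *: "norm (z t) * exp (- (\<theta> * \<bar>t\<bar>)) \<le> D \<longleftrightarrow> norm (z t) \<le> D * exp (\<theta> * \<bar>t\<bar>)" for t D
    by (simp add: exp_minus field_simps)
  have bdd: "bdd_above (range (\<lambda>t. norm (z t) * exp (- (\<theta> * \<bar>t\<bar>))))"
    using growthD[OF z] unfolding *[symmetric] by (auto intro!: bdd_aboveI)
  have "growth \<theta> N z"
  proof (rule growthI[OF growth_cont[OF z]])
    show "norm (z t) \<le> N * exp (\<theta> * \<bar>t\<bar>)" for t
      unfolding *[symmetric] N_def by (rule cSUP_upper[OF _ bdd]) simp
  qed
  then have g: "growth \<theta> (c + M * (\<delta> * N)) z"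
    using growth_add[OF w K_growth[OF th growth_dominated[OF v(1) _ v(2) delta_nonneg]]] eq by metis
  have "N \<le> c + M * (\<delta> * N)"
    unfolding N_def[symmetric]
    by (subst N_def, rule cSUP_least) (auto simp: * growthD[OF g])
  moreover have "M * (\<delta> * N) \<le> 1 / 2 * N"
    using mult_right_mono[OF small growth_nonneg[OF \<open>growth \<theta> N z\<close>]] by (simp add: mult.assoc)
  ultimately have "N \<le> 2 * c" by simp
  then show ?thesis using growth_mono[OF \<open>growth \<theta> N z\<close>] by simp
qed

text \<open>Multiplication with the weight identifies the weighted space with bounded continuous functions,
  where Banach's fixed point theorem applies.\<close>

lemma fixed_point_exists:
  assumes th: "\<eta> \<le> \<theta>" "\<theta> \<le> 3 * \<eta>" and w: "growth \<theta> c w"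
    and G_cont: "\<And>z. continuous_on UNIV z \<Longrightarrow> continuous_on UNIV (\<lambda>t. G t (z t))"
    and G_0: "\<And>t. G t 0 = 0"
    and G_lip: "\<And>t a b. norm (G t a - G t b) \<le> \<delta> * norm (a - b)"
  shows "\<exists>z. growth \<theta> (2 * c) z \<and> z = (\<lambda>t. w t + K (\<lambda>t. G t (z t)) t)"
proof -
  define E where "E = (\<lambda>(u :: real \<Rightarrow>\<^sub>C 'e) t. exp (\<theta> * \<bar>t\<bar>) *\<^sub>R apply_bcontfun u t)"
  define \<Phi> where "\<Phi> = (\<lambda>z t. w t + K (\<lambda>t. G t (z t)) t)"
  define \<Psi> where "\<Psi> = (\<lambda>u. Bcontfun (\<lambda>t. exp (- (\<theta> * \<bar>t\<bar>)) *\<^sub>R \<Phi> (E u) t))"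
  have Ediff: "growth \<theta> (dist u v) (\<lambda>t. E u t - E v t)" for u v
    unfolding E_def
    by (intro growthI continuous_intros)
      (auto simp: scaleR_diff_right[symmetric] dist_norm[symmetric] dist_bounded mult.commute)
  have E: "growth \<theta> (norm u) (E u)" for u
    using Ediff[of u 0] by (simp add: E_def zero_bcontfun.rep_eq)
  have Gg: "growth \<theta> (\<delta> * C) (\<lambda>t. G t (z t))" if "growth \<theta> C z" for z C
    using G_lip[of _ _ 0] G_0
    by (intro growth_dominated[OF G_cont[OF growth_cont[OF that]] that _ delta_nonneg]) auto
  have \<Phi>g: "growth \<theta> (c + M * (\<delta> * C)) (\<Phi> z)" if "growth \<theta> C z" for z C
    unfolding \<Phi>_def by (intro growth_add w K_growth th Gg that)
  have bc: "(\<lambda>t. exp (- (\<theta> * \<bar>t\<bar>)) *\<^sub>R z t) \<in> bcontfun" if "growth \<theta> C z" for z :: "real \<Rightarrow> 'e" and C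
  proof (rule bcontfun_normI[where b = C])
    show "continuous_on UNIV (\<lambda>t. exp (- (\<theta> * \<bar>t\<bar>)) *\<^sub>R z t)"
      by (intro continuous_intros growth_cont[OF that])
    show "norm (exp (- (\<theta> * \<bar>t\<bar>)) *\<^sub>R z t) \<le> C" for t
      using growthD[OF that, of t] by (simp add: exp_minus field_simps)
  qed
  have ap: "apply_bcontfun (\<Psi> u) t = exp (- (\<theta> * \<bar>t\<bar>)) *\<^sub>R \<Phi> (E u) t" for u t
    unfolding \<Psi>_def using Bcontfun_inverse[OF bc[OF \<Phi>g[OF E]]] by metis
  have E\<Psi>: "E (\<Psi> u) = \<Phi> (E u)" for u
  proof
    have "E (\<Psi> u) t = exp (\<theta> * \<bar>t\<bar>) *\<^sub>R apply_bcontfun (\<Psi> u) t" for t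
      by (simp add: E_def)
    then show "E (\<Psi> u) t = \<Phi> (E u) t" for t
      by (simp add: ap exp_minus)
  qed
  have rescale_diff: "dist (exp (- a) *\<^sub>R p) (exp (- a) *\<^sub>R q) \<le> D"
    if "norm (p - q) \<le> D * exp a" for a D and p q :: 'e
  proof -
    have "dist (exp (- a) *\<^sub>R p) (exp (- a) *\<^sub>R q) = exp (- a) * norm (p - q)"
      by (simp add: dist_norm flip: scaleR_diff_right)
    also have "\<dots> \<le> D"
      using that by (simp add: exp_minus field_simps)
    finally show ?thesis .
  qed
  have "dist (\<Psi> u) (\<Psi> v) \<le> 1 / 2 * dist u v" for u v
  proof (rule dist_bound)
    fix t
    have g3: "growth (3 * \<eta>) (\<delta> * norm u) (\<lambda>t. G t (E u t))" for u
      using growth_mono[OF Gg[OF E] th(2)] by simp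
    have eq: "\<Phi> (E u) t - \<Phi> (E v) t = K (\<lambda>t. G t (E u t) - G t (E v t)) t"
      unfolding \<Phi>_def K_diff[OF g3 g3] by simp
    have "growth \<theta> (\<delta> * dist u v) (\<lambda>t. G t (E u t) - G t (E v t))"
      by (intro growth_dominated[OF _ Ediff _ delta_nonneg] G_lip continuous_on_diff G_cont
          growth_cont[OF E])
    note * = growthD[OF K_growth[OF th this], of t]
    have "M * (\<delta> * dist u v) \<le> 1 / 2 * dist u v"
      using mult_right_mono[OF small, of "dist u v"] by (simp add: mult.assoc)
    then have "M * (\<delta> * dist u v) * exp (\<theta> * \<bar>t\<bar>) \<le> 1 / 2 * dist u v * exp (\<theta> * \<bar>t\<bar>)"
      by (intro mult_right_mono) auto
    then have "norm (\<Phi> (E u) t - \<Phi> (E v) t) \<le> 1 / 2 * dist u v * exp (\<theta> * \<bar>t\<bar>)"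
      using * unfolding eq by linarith
    then show "dist (apply_bcontfun (\<Psi> u) t) (apply_bcontfun (\<Psi> v) t) \<le> 1 / 2 * dist u v"
      unfolding ap using rescale_diff by blast
  qed
  then obtain u where "\<Psi> u = u"
    using banach_fix_type[of "1/2" \<Psi>] by auto
  then have fixed: "E u = (\<lambda>t. w t + K (\<lambda>t. G t (E u t)) t)"
    using E\<Psi>[of u] by (simp add: \<Phi>_def)
  have "growth \<theta> (2 * c) (E u)"
  proof (rule a_priori_bound[OF th E w _ _ fixed])
    show "norm (G t (E u t)) \<le> \<delta> * norm (E u t)" for t
      using G_lip[of t _ 0] G_0 by simp
  qed (rule growth_cont[OF Gg[OF E]])
  with fixed show ?thesis by blast
qed

end

section \<open>Smooth dependence of the fixed point on a parameter\<close>

lemma differentiable_bound_blinfun: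
  assumes "\<And>x. (h has_derivative blinfun_apply (h' x)) (at x)" "\<And>x. norm (h' x) \<le> D"
  shows "norm (h b - h a) \<le> D * norm (b - a)"
  by (rule differentiable_bound[of UNIV h "\<lambda>x. blinfun_apply (h' x)"])
    (use assms in \<open>auto simp: norm_blinfun.rep_eq[symmetric]\<close>)

lemma linearization_error_blinfun:
  assumes "\<And>x. (h has_derivative blinfun_apply (h' x)) (at x)"
    and "\<And>x. x \<in> closed_segment a b \<Longrightarrow> norm (h' x - h' a) \<le> D"
  shows "norm (h b - h a - h' a (b - a)) \<le> norm (b - a) * D"
proof (rule differentiable_bound_linearization[of a b "closed_segment a b" h "\<lambda>x. blinfun_apply (h' x)"])
  show "a + t *\<^sub>R (b - a) \<in> closed_segment a b" if "t \<in> {0..1}" for t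
  proof -
    have "a + t *\<^sub>R (b - a) = (1 - t) *\<^sub>R a + t *\<^sub>R b"
      by (simp add: algebra_simps)
    then show ?thesis
      using that by (auto simp only: in_segment atLeastAtMost_iff)
  qed
  show "(h has_derivative blinfun_apply (h' x)) (at x within closed_segment a b)" for x
    by (rule has_derivative_at_withinI[OF assms(1)])
  show "onorm (blinfun_apply (h' x) - blinfun_apply (h' a)) \<le> D" if "x \<in> closed_segment a b" for x
    using assms(2)[OF that] by (simp add: norm_blinfun.rep_eq minus_blinfun.rep_eq fun_diff_def)
qed simp

lemma norm_blinfun2: "norm (blinfun_apply (blinfun_apply G a) b) \<le> norm G * norm a * norm b"
  by (rule order_trans[OF norm_blinfun mult_right_mono[OF norm_blinfun norm_ge_zero]])

lemma norm_blinfun2_le: "norm G \<le> B \<Longrightarrow> norm (blinfun_apply (blinfun_apply G a) b) \<le> B * norm a * norm b"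
  by (rule order_trans[OF norm_blinfun2]) (intro mult_right_mono norm_ge_zero)

text \<open>A remainder estimate of the shape that \<open>compactly_supported_modulus\<close> produces implies
  differentiability.\<close>

lemma has_derivativeI_modulus:
  fixes f :: "'a::real_normed_vector \<Rightarrow> 'b::real_normed_vector"
  assumes "bounded_linear f'"
    and "\<And>\<epsilon>. 0 < \<epsilon> \<Longrightarrow> \<exists>C\<ge>0. \<forall>y. norm (f y - f x - f' (y - x)) \<le> (\<epsilon> + C * norm (y - x)) * norm (y - x)"
  shows "(f has_derivative f') (at x)"
proof (rule has_derivative_at_withinI[of _ _ _ UNIV, simplified], unfold has_derivative_at_alt, intro conjI allI impI)
  fix \<epsilon> :: real assume e: "0 < \<epsilon>"
  then obtain C where C: "0 \<le> C" "\<And>y. norm (f y - f x - f' (y - x)) \<le> (\<epsilon> / 2 + C * norm (y - x)) * norm (y - x)"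
    using assms(2)[of "\<epsilon> / 2"] by auto
  show "\<exists>d>0. \<forall>y. norm (y - x) < d \<longrightarrow> norm (f y - f x - f' (y - x)) \<le> \<epsilon> * norm (y - x)"
  proof (intro exI[of _ "\<epsilon> / 2 / (C + 1)"] conjI allI impI)
    fix y assume y: "norm (y - x) < \<epsilon> / 2 / (C + 1)"
    have "C * norm (y - x) \<le> (C + 1) * norm (y - x)"
      by (intro mult_right_mono) auto
    also have "\<dots> \<le> \<epsilon> / 2"
      using y C(1) by (simp add: field_simps)
    finally have "(\<epsilon> / 2 + C * norm (y - x)) * norm (y - x) \<le> \<epsilon> * norm (y - x)"
      by (intro mult_right_mono) auto
    then show "norm (f y - f x - f' (y - x)) \<le> \<epsilon> * norm (y - x)"
      using C(2)[of y] by linarith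
  qed (use e C in auto)
qed (rule assms(1))

text \<open>The fixed point problem \<open>x = e y + K (g \<circ> x)\<close> with parameter \<open>y\<close>.
  Since \<open>K\<close> is nonlocal in time, even the derivatives of the initial value \<open>x 0\<close>
  with respect to \<open>y\<close> require control for all times.\<close>

locale smooth_growth_problem = growth_operator K \<eta> M \<delta>
  for K :: "(real \<Rightarrow> 'e::euclidean_space) \<Rightarrow> real \<Rightarrow> 'e" and \<eta> M \<delta> +
  fixes e :: "'a::euclidean_space \<Rightarrow> real \<Rightarrow> 'e" and L B :: real
    and g :: "'e \<Rightarrow> 'e" and g' :: "'e \<Rightarrow> 'e \<Rightarrow>\<^sub>L 'e" and g'' :: "'e \<Rightarrow> 'e \<Rightarrow>\<^sub>L 'e \<Rightarrow>\<^sub>L 'e"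
  assumes e_add: "\<And>u v. e (u + v) = (\<lambda>t. e u t + e v t)"
    and e_scaleR: "\<And>r u. e (r *\<^sub>R u) = (\<lambda>t. r *\<^sub>R e u t)"
    and e_growth: "\<And>v. growth \<eta> (L * norm v) (e v)" and L_nonneg: "0 \<le> L"
    and g_zero: "g 0 = 0"
    and g_der: "\<And>a. (g has_derivative blinfun_apply (g' a)) (at a)"
    and g'_der: "\<And>a. (g' has_derivative blinfun_apply (g'' a)) (at a)"
    and g''_cont: "continuous_on UNIV g''"
    and g'_bound: "\<And>a. norm (g' a) \<le> \<delta>" and g''_bound: "\<And>a. norm (g'' a) \<le> B"
    and g''_modulus: "\<And>\<epsilon>. 0 < \<epsilon> \<Longrightarrow> \<exists>C\<ge>0. \<forall>a b. norm (g'' a - g'' b) \<le> \<epsilon> + C * norm (a - b)"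
begin

lemma B_nonneg: "0 \<le> B"
  using g''_bound norm_ge_zero order_trans by blast

lemma g_cont: "continuous_on UNIV g"
  using has_derivative_continuous[OF g_der] by (simp add: continuous_on_eq_continuous_at)

lemma g'_cont: "continuous_on UNIV g'"
  using has_derivative_continuous[OF g'_der] by (simp add: continuous_on_eq_continuous_at)

lemma g_comp: "continuous_on S z \<Longrightarrow> continuous_on S (\<lambda>t. g (z t))"
  by (rule continuous_on_compose2[OF g_cont]) auto

lemma g'_comp: "continuous_on S z \<Longrightarrow> continuous_on S (\<lambda>t. g' (z t))"
  by (rule continuous_on_compose2[OF g'_cont]) auto

lemma g''_comp: "continuous_on S z \<Longrightarrow> continuous_on S (\<lambda>t. g'' (z t))"
  by (rule continuous_on_compose2[OF g''_cont]) auto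

lemmas conts = continuous_intros g_comp g'_comp g''_comp

lemma g_lip: "norm (g a - g b) \<le> \<delta> * norm (a - b)"
  by (rule differentiable_bound_blinfun[OF g_der g'_bound])

lemma g'_lip: "norm (g' a - g' b) \<le> B * norm (a - b)"
  by (rule differentiable_bound_blinfun[OF g'_der g''_bound])

lemma g'_apply_bound: "norm (g' a z) \<le> \<delta> * norm z"
  by (rule order_trans[OF norm_blinfun mult_right_mono[OF g'_bound norm_ge_zero]])

lemma g_taylor: "norm (g b - g a - g' a (b - a)) \<le> B * norm (b - a) * norm (b - a)"
proof -
  have "norm (g b - g a - g' a (b - a)) \<le> norm (b - a) * (B * norm (b - a))"
  proof (rule linearization_error_blinfun[OF g_der])
    fix z assume "z \<in> closed_segment a b"
    then have "norm (z - a) \<le> norm (b - a)"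
      using segment_bound(1) by blast
    then show "norm (g' z - g' a) \<le> B * norm (b - a)"
      by (intro order_trans[OF g'_lip] mult_left_mono B_nonneg)
  qed
  then show ?thesis by (simp add: mult.commute)
qed

lemma g'_taylor:
  assumes C: "\<And>a b. norm (g'' a - g'' b) \<le> \<epsilon> + C * norm (a - b)" "0 \<le> C"
  shows "norm (g' b - g' a - g'' a (b - a)) \<le> (\<epsilon> + C * norm (b - a)) * norm (b - a)"
proof -
  have "norm (g' b - g' a - g'' a (b - a)) \<le> norm (b - a) * (\<epsilon> + C * norm (b - a))"
  proof (rule linearization_error_blinfun[OF g'_der])
    fix z assume "z \<in> closed_segment a b"
    then have "norm (z - a) \<le> norm (b - a)"
      using segment_bound(1) by blast
    then have "C * norm (z - a) \<le> C * norm (b - a)"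
      using C(2) by (rule mult_left_mono)
    then show "norm (g'' z - g'' a) \<le> \<epsilon> + C * norm (b - a)"
      using C(1)[of z a] by linarith
  qed
  then show ?thesis by (simp add: mult.commute)
qed

lemma e_diff: "e (u - v) = (\<lambda>t. e u t - e v t)"
  using e_add[of u "(-1) *\<^sub>R v"] e_scaleR[of "-1" v] by simp

definition orbit :: "'a \<Rightarrow> real \<Rightarrow> 'e" where
  "orbit y = (SOME z. growth \<eta> (2 * (L * norm y)) z \<and> z = (\<lambda>t. e y t + K (\<lambda>t. g (z t)) t))"

lemma orbit:
  shows orbit_growth: "growth \<eta> (2 * (L * norm y)) (orbit y)"
    and orbit_eq: "orbit y = (\<lambda>t. e y t + K (\<lambda>t. g (orbit y t)) t)"
proof -
  have "\<exists>z. growth \<eta> (2 * (L * norm y)) z \<and> z = (\<lambda>t. e y t + K (\<lambda>t. g (z t)) t)"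
    using eta_pos
    by (intro fixed_point_exists[OF order_refl _ e_growth, of "\<lambda>_. g", OF _ g_comp g_zero g_lip]) simp_all
  from someI_ex[OF this] show "growth \<eta> (2 * (L * norm y)) (orbit y)"
    "orbit y = (\<lambda>t. e y t + K (\<lambda>t. g (orbit y t)) t)"
    unfolding orbit_def by auto
qed

lemma orbit_cont: "continuous_on S (orbit y)"
  using growth_cont[OF orbit_growth] continuous_on_subset by blast

lemma g_growth:
  assumes "growth \<theta> C z" shows "growth \<theta> (\<delta> * C) (\<lambda>t. g (z t))"
  by (rule growth_dominated[OF g_comp[OF growth_cont[OF assms]] assms _ delta_nonneg])
    (use g_lip[of _ 0] g_zero in auto)

lemma orbit_lipschitz_growth: "growth \<eta> (2 * L * norm (y' - y)) (\<lambda>t. orbit y' t - orbit y t)"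
proof -
  have th: "\<eta> \<le> 3 * \<eta>" using eta_pos by simp
  have g: "growth (3 * \<eta>) (\<delta> * (2 * (L * norm y))) (\<lambda>t. g (orbit y t))" for y
    using growth_mono[OF g_growth[OF orbit_growth] th] by simp
  have "growth \<eta> (2 * (L * norm (y' - y))) (\<lambda>t. orbit y' t - orbit y t)"
  proof (rule a_priori_bound[OF order_refl th growth_diff[OF orbit_growth orbit_growth] e_growth])
    show "continuous_on UNIV (\<lambda>t. g (orbit y' t) - g (orbit y t))"
      by (intro conts orbit_cont)
    show "(\<lambda>t. orbit y' t - orbit y t) =
      (\<lambda>t. e (y' - y) t + K (\<lambda>t. g (orbit y' t) - g (orbit y t)) t)"
      unfolding K_diff[OF g g] e_diff add_diff_add[symmetric]
      by (rule ext) (rule arg_cong2[where f = "(-)", OF fun_cong[OF orbit_eq] fun_cong[OF orbit_eq]])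
  qed (rule g_lip)
  then show ?thesis by (simp add: mult.assoc)
qed

text \<open>Uniqueness holds in the largest of the weighted spaces; this is what identifies an arbitrary
  slowly growing solution with an orbit.\<close>

lemma orbit_unique:
  assumes z: "growth (3 * \<eta>) C z" and eq: "z = (\<lambda>t. e y t + K (\<lambda>t. g (z t)) t)"
  shows "z = orbit y"
proof -
  have th: "\<eta> \<le> 3 * \<eta>" using eta_pos by simp
  have o: "growth (3 * \<eta>) (2 * (L * norm y)) (orbit y)"
    using growth_mono[OF orbit_growth th] by simp
  have "growth (3 * \<eta>) (2 * 0) (\<lambda>t. z t - orbit y t)"
  proof (rule a_priori_bound[OF th order_refl growth_diff[OF z o] growth_zero])
    show "continuous_on UNIV (\<lambda>t. g (z t) - g (orbit y t))"
      by (intro conts orbit_cont growth_cont[OF z])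
    show "(\<lambda>t. z t - orbit y t) = (\<lambda>t. 0 + K (\<lambda>t. g (z t) - g (orbit y t)) t)"
      unfolding K_diff[OF g_growth[OF z] g_growth[OF o]]
    proof
      show "z t - orbit y t = 0 + (K (\<lambda>t. g (z t)) t - K (\<lambda>t. g (orbit y t)) t)" for t
        using fun_cong[OF eq, of t] fun_cong[OF orbit_eq[of y], of t] by simp
    qed
  qed (rule g_lip)
  then have "(\<lambda>t. z t - orbit y t) = (\<lambda>t. 0)"
    by (intro growth_zero_imp) simp
  then show ?thesis by (simp add: fun_eq_iff)
qed

text \<open>Along the orbit of \<open>y\<close> every variational equation has the form \<open>z = w + K (g'
  (orbit y) z)\<close>, with an inhomogeneity \<open>w\<close> that depends on the order of the
  derivative.\<close>

definition solves_linearized :: "'a \<Rightarrow> (real \<Rightarrow> 'e) \<Rightarrow> (real \<Rightarrow> 'e) \<Rightarrow> bool" where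
  "solves_linearized y w z \<longleftrightarrow>
     (\<exists>C. growth (3 * \<eta>) C z) \<and> z = (\<lambda>t. w t + K (\<lambda>t. g' (orbit y t) (z t)) t)"

lemma g'_growth:
  assumes "growth \<theta> C z" shows "growth \<theta> (\<delta> * C) (\<lambda>t. g' (orbit y t) (z t))"
  by (rule growth_dominated[OF _ assms g'_apply_bound delta_nonneg])
    (intro conts orbit_cont growth_cont[OF assms])

lemma solves_linearized_unique:
  assumes z: "solves_linearized y w z" and z': "solves_linearized y w z'"
  shows "z = z'"
proof -
  obtain C C' where C: "growth (3 * \<eta>) C z" "growth (3 * \<eta>) C' z'"
    using z z' unfolding solves_linearized_def by auto
  have th: "\<eta> \<le> 3 * \<eta>" using eta_pos by simp
  have "growth (3 * \<eta>) (2 * 0) (\<lambda>t. z t - z' t)"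
  proof (rule a_priori_bound[OF th order_refl growth_diff[OF C] growth_zero])
    show "continuous_on UNIV (\<lambda>t. g' (orbit y t) (z t) - g' (orbit y t) (z' t))"
      by (intro conts orbit_cont growth_cont[OF C(1)] growth_cont[OF C(2)])
    have "z = (\<lambda>t. w t + K (\<lambda>t. g' (orbit y t) (z t)) t)"
      "z' = (\<lambda>t. w t + K (\<lambda>t. g' (orbit y t) (z' t)) t)"
      using z z' unfolding solves_linearized_def by auto
    then have "z t - z' t = (w t + K (\<lambda>t. g' (orbit y t) (z t)) t) - (w t + K (\<lambda>t. g' (orbit y t) (z' t)) t)" for t
      by metis
    then show "(\<lambda>t. z t - z' t) = (\<lambda>t. 0 + K (\<lambda>t. g' (orbit y t) (z t) - g' (orbit y t) (z' t)) t)"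
      unfolding K_diff[OF g'_growth[OF C(1)] g'_growth[OF C(2)]] by auto
    show "norm (g' (orbit y t) (z t) - g' (orbit y t) (z' t)) \<le> \<delta> * norm (z t - z' t)" for t
      by (metis g'_apply_bound blinfun.diff_right)
  qed
  then have "(\<lambda>t. z t - z' t) = (\<lambda>t. 0)"
    by (intro growth_zero_imp) simp
  then show ?thesis by (simp add: fun_eq_iff)
qed

text \<open>The inverse of \<open>1 - K g' (orbit y)\<close>.\<close>

definition response :: "'a \<Rightarrow> (real \<Rightarrow> 'e) \<Rightarrow> real \<Rightarrow> 'e" where
  "response y w = (SOME z. solves_linearized y w z)"

lemma response:
  assumes th: "\<eta> \<le> \<theta>" "\<theta> \<le> 3 * \<eta>" and w: "growth \<theta> c w"
  shows response_growth: "growth \<theta> (2 * c) (response y w)"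
    and response_solves: "solves_linearized y w (response y w)"
proof -
  have "\<exists>z. growth \<theta> (2 * c) z \<and> z = (\<lambda>t. w t + K (\<lambda>t. g' (orbit y t) (z t)) t)"
  proof (rule fixed_point_exists[OF th w])
    show "continuous_on UNIV (\<lambda>t. g' (orbit y t) (z t))" if "continuous_on UNIV z" for z
      by (intro conts orbit_cont that)
    show "norm (g' (orbit y t) a - g' (orbit y t) b) \<le> \<delta> * norm (a - b)" for t a b
      by (metis g'_apply_bound blinfun.diff_right)
  qed simp
  then obtain z where z: "growth \<theta> (2 * c) z" "z = (\<lambda>t. w t + K (\<lambda>t. g' (orbit y t) (z t)) t)"
    by blast
  then have s: "solves_linearized y w z"
    using growth_mono[OF z(1) th(2)] by (auto simp: solves_linearized_def)
  then show "solves_linearized y w (response y w)"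
    unfolding response_def by (rule someI[of "solves_linearized y w"])
  then show "growth \<theta> (2 * c) (response y w)"
    using solves_linearized_unique[OF s] z(1) by simp
qed

lemma response_eq:
  assumes "growth (3 * \<eta>) c w"
  shows "response y w = (\<lambda>t. w t + K (\<lambda>t. g' (orbit y t) (response y w t)) t)"
  using response_solves[OF _ order_refl assms, of y] eta_pos unfolding solves_linearized_def by auto

lemma response_unique:
  assumes "growth (3 * \<eta>) c w" "solves_linearized y w z"
  shows "z = response y w"
  using response_solves[OF _ order_refl assms(1), of y] eta_pos
    solves_linearized_unique[OF assms(2)] by simp

lemma response_add:
  assumes v: "growth (3 * \<eta>) c v" and w: "growth (3 * \<eta>) d w"
  shows "response y (\<lambda>t. v t + w t) = (\<lambda>t. response y v t + response y w t)"
proof (rule response_unique[OF growth_add[OF v w], symmetric])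
  have th: "\<eta> \<le> 3 * \<eta>" using eta_pos by simp
  note g = response_growth[OF th order_refl v, of y] response_growth[OF th order_refl w, of y]
  show "solves_linearized y (\<lambda>t. v t + w t) (\<lambda>t. response y v t + response y w t)"
    unfolding solves_linearized_def blinfun.add_right K_add[OF g'_growth[OF g(1)] g'_growth[OF g(2)]]
  proof (intro conjI exI ext)
    show "response y v t + response y w t = v t + w t +
        (K (\<lambda>t. g' (orbit y t) (response y v t)) t + K (\<lambda>t. g' (orbit y t) (response y w t)) t)" for t
      using fun_cong[OF response_eq[OF v, of y], of t] fun_cong[OF response_eq[OF w, of y], of t]
      by (simp add: algebra_simps)
  qed (rule growth_add[OF g])
qed

lemma response_scaleR:
  assumes v: "growth (3 * \<eta>) c v"
  shows "response y (\<lambda>t. r *\<^sub>R v t) = (\<lambda>t. r *\<^sub>R response y v t)"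
proof (rule response_unique[OF growth_scaleR[OF v], symmetric])
  have th: "\<eta> \<le> 3 * \<eta>" using eta_pos by simp
  note g = response_growth[OF th order_refl v, of y]
  show "solves_linearized y (\<lambda>t. r *\<^sub>R v t) (\<lambda>t. r *\<^sub>R response y v t)"
    unfolding solves_linearized_def blinfun.scaleR_right K_scaleR[OF g'_growth[OF g]]
  proof (intro conjI exI ext)
    show "r *\<^sub>R response y v t = r *\<^sub>R v t + r *\<^sub>R K (\<lambda>t. g' (orbit y t) (response y v t)) t" for t
      using fun_cong[OF response_eq[OF v, of y], of t] by (simp add: scaleR_add_right)
  qed (rule growth_scaleR[OF g])
qed

text \<open>The pattern common to all error estimates: if two quantities arise through \<open>K\<close> from
  integrands whose difference is \<open>g' r\<close> plus an error \<open>N\<close>, where \<open>r\<close> is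
  the difference of the quantities, then \<open>r\<close> solves a linearised equation and is controlled by
  \<open>N\<close>.\<close>

lemma residual_growth:
  assumes th: "\<eta> \<le> \<theta>" "\<theta> \<le> 3 * \<eta>"
    and a: "growth (3 * \<eta>) Ca a" and b: "growth (3 * \<eta>) Cb b" and r: "growth (3 * \<eta>) Cr r"
    and r_eq: "\<And>t. r t = K a t - K b t"
    and split: "\<And>t. a t - b t = g' (orbit y t) (r t) + N t" and N: "growth \<theta> c N"
  shows "growth \<theta> (2 * (M * c)) r"
proof -
  have N3: "growth (3 * \<eta>) c N"
    using growth_mono[OF N th(2)] by simp
  have "r = (\<lambda>t. K N t + K (\<lambda>t. g' (orbit y t) (r t)) t)"
    using K_diff[OF a b] K_add[OF g'_growth[OF r] N3] unfolding split by (simp add: fun_eq_iff r_eq add.commute)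
  then have "solves_linearized y (K N) r"
    using r by (auto simp: solves_linearized_def)
  then have "r = response y (K N)"
    by (rule response_unique[rotated]) (rule K_growth[OF _ order_refl N3], use eta_pos in simp)
  with response_growth[OF th K_growth[OF th N]] show ?thesis by simp
qed

text \<open>The candidate for the derivative of \<open>orbit y\<close> in direction \<open>v\<close>, obtained
  by formally differentiating the fixed point equation.\<close>

definition variation :: "'a \<Rightarrow> 'a \<Rightarrow> real \<Rightarrow> 'e" where
  "variation y v = response y (e v)"

text \<open>The term that appears in the second formal derivative besides the linearised one.\<close>

definition forcing :: "'a \<Rightarrow> 'a \<Rightarrow> 'a \<Rightarrow> real \<Rightarrow> 'e" where
  "forcing y w v = (\<lambda>t. g'' (orbit y t) (variation y w t) (variation y v t))"

definition variation2 :: "'a \<Rightarrow> 'a \<Rightarrow> 'a \<Rightarrow> real \<Rightarrow> 'e" where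
  "variation2 y w v = response y (K (forcing y w v))"

lemma eta_le: "\<eta> \<le> 3 * \<eta>" "\<eta> \<le> 2 * \<eta>" "2 * \<eta> \<le> 3 * \<eta>"
  using eta_pos by auto

lemma e_growth3: "growth (3 * \<eta>) (L * norm v) (e v)"
  by (rule growth_mono[OF e_growth eta_le(1) order_refl])

lemma variation_growth: "growth \<eta> (2 * L * norm v) (variation y v)"
  unfolding variation_def
  using response_growth[OF order_refl eta_le(1) e_growth] by (simp add: mult.assoc)

lemmas variation_cont = growth_cont[OF variation_growth]

lemma variation_eq: "variation y v = (\<lambda>t. e v t + K (\<lambda>t. g' (orbit y t) (variation y v t)) t)"
  unfolding variation_def by (rule response_eq[OF e_growth3])

lemma variation_add: "variation y (u + v) = (\<lambda>t. variation y u t + variation y v t)"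
  unfolding variation_def e_add by (rule response_add[OF e_growth3 e_growth3])

lemma variation_scaleR: "variation y (r *\<^sub>R v) = (\<lambda>t. r *\<^sub>R variation y v t)"
  unfolding variation_def e_scaleR by (rule response_scaleR[OF e_growth3])

lemma forcing_growth: "growth (2 * \<eta>) (B * (2 * L * norm w) * (2 * L * norm v)) (forcing y w v)"
  unfolding forcing_def
  by (rule growth_dominated_mult[OF _ variation_growth[of w y] variation_growth[of v y] _ B_nonneg])
    (intro conts orbit_cont variation_cont norm_blinfun2_le[OF g''_bound] | simp)+

lemma forcing_growth3: "growth (3 * \<eta>) (B * (2 * L * norm w) * (2 * L * norm v)) (forcing y w v)"
  by (rule growth_mono[OF forcing_growth eta_le(3) order_refl])

lemma K_forcing_growth:
  "growth (2 * \<eta>) (M * (B * (2 * L * norm w) * (2 * L * norm v))) (K (forcing y w v))"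
  by (rule K_growth[OF eta_le(2,3) forcing_growth])

lemma K_forcing_growth3:
  "growth (3 * \<eta>) (M * (B * (2 * L * norm w) * (2 * L * norm v))) (K (forcing y w v))"
  by (rule growth_mono[OF K_forcing_growth eta_le(3) order_refl])

lemma variation2_growth:
  "growth (2 * \<eta>) (8 * M * B * L * L * norm w * norm v) (variation2 y w v)"
  unfolding variation2_def
  using response_growth[OF eta_le(2,3) K_forcing_growth[of w v y], of y] by (simp add: algebra_simps)

lemmas variation2_growth3 = growth_mono[OF variation2_growth eta_le(3) order_refl]

lemmas variation2_cont = growth_cont[OF variation2_growth]

lemma variation2_eq:
  "variation2 y w v = (\<lambda>t. K (forcing y w v) t + K (\<lambda>t. g' (orbit y t) (variation2 y w v t)) t)"
  unfolding variation2_def by (rule response_eq[OF K_forcing_growth3])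

lemma variation2_add_right:
  "variation2 y w (u + v) = (\<lambda>t. variation2 y w u t + variation2 y w v t)"
proof -
  have "forcing y w (u + v) = (\<lambda>t. forcing y w u t + forcing y w v t)"
    by (simp add: forcing_def variation_add blinfun.bilinear_simps)
  then show ?thesis
    unfolding variation2_def
    by (simp only: K_add[OF forcing_growth3 forcing_growth3] response_add[OF K_forcing_growth3 K_forcing_growth3])
qed

lemma variation2_add_left:
  "variation2 y (u + v) w = (\<lambda>t. variation2 y u w t + variation2 y v w t)"
proof -
  have "forcing y (u + v) w = (\<lambda>t. forcing y u w t + forcing y v w t)"
    by (simp add: forcing_def variation_add blinfun.bilinear_simps)
  then show ?thesis
    unfolding variation2_def
    by (simp only: K_add[OF forcing_growth3 forcing_growth3] response_add[OF K_forcing_growth3 K_forcing_growth3])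
qed

lemma variation2_scaleR_right:
  "variation2 y w (r *\<^sub>R v) = (\<lambda>t. r *\<^sub>R variation2 y w v t)"
proof -
  have "forcing y w (r *\<^sub>R v) = (\<lambda>t. r *\<^sub>R forcing y w v t)"
    by (simp add: forcing_def variation_scaleR blinfun.bilinear_simps)
  then show ?thesis
    unfolding variation2_def
    by (simp only: K_scaleR[OF forcing_growth3] response_scaleR[OF K_forcing_growth3])
qed

lemma variation2_scaleR_left:
  "variation2 y (r *\<^sub>R w) v = (\<lambda>t. r *\<^sub>R variation2 y w v t)"
proof -
  have "forcing y (r *\<^sub>R w) v = (\<lambda>t. r *\<^sub>R forcing y w v t)"
    by (simp add: forcing_def variation_scaleR blinfun.bilinear_simps)
  then show ?thesis
    unfolding variation2_def
    by (simp only: K_scaleR[OF forcing_growth3] response_scaleR[OF K_forcing_growth3])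
qed

lemma g_orbit_growth3: "growth (3 * \<eta>) (\<delta> * (2 * (L * norm y))) (\<lambda>t. g (orbit y t))"
  by (rule growth_mono[OF g_growth[OF orbit_growth] eta_le(1) order_refl])

lemma g'_variation_growth3:
  "growth (3 * \<eta>) (\<delta> * (2 * L * norm v)) (\<lambda>t. g' (orbit y t) (variation y v t))"
  by (rule growth_mono[OF g'_growth[OF variation_growth] eta_le(1) order_refl])

lemma g'_variation2_growth3:
  "growth (3 * \<eta>) (\<delta> * (8 * M * B * L * L * norm w * norm v)) (\<lambda>t. g' (orbit y t) (variation2 y w v t))"
  by (rule growth_mono[OF g'_growth[OF variation2_growth] eta_le(3) order_refl])

text \<open>Taylor's formula for \<open>g\<close> leaves a remainder that is quadratic in the difference of
  two orbits. A product of two functions of rate \<open>\<eta>\<close> has rate \<open>2 \<eta>\<close>,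
  whence the larger weight.\<close>

lemma variation_error:
  "growth (2 * \<eta>) (8 * M * B * L * L * norm (y' - y) * norm (y' - y))
     (\<lambda>t. orbit y' t - orbit y t - variation y (y' - y) t)"
proof -
  let ?v = "y' - y"
  let ?r = "\<lambda>t. orbit y' t - orbit y t - variation y ?v t"
  let ?N = "\<lambda>t. g (orbit y' t) - g (orbit y t) - g' (orbit y t) (orbit y' t - orbit y t)"
  have N: "growth (2 * \<eta>) (B * (2 * L * norm ?v) * (2 * L * norm ?v)) ?N"
    by (rule growth_dominated_mult[OF _ orbit_lipschitz_growth orbit_lipschitz_growth _ B_nonneg])
      (intro conts orbit_cont g_taylor | simp)+
  have "growth (2 * \<eta>) (2 * (M * (B * (2 * L * norm ?v) * (2 * L * norm ?v)))) ?r"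
  proof (rule residual_growth[where y = y, OF eta_le(2,3) _ _ _ _ _ N])
    show "growth (3 * \<eta>) (\<delta> * (2 * (L * norm y'))) (\<lambda>t. g (orbit y' t))"
      by (rule g_orbit_growth3)
    show b: "growth (3 * \<eta>) (\<delta> * (2 * (L * norm y)) + \<delta> * (2 * L * norm ?v))
      (\<lambda>t. g (orbit y t) + g' (orbit y t) (variation y ?v t))"
      by (intro growth_add g_orbit_growth3 g'_variation_growth3)
    show "growth (3 * \<eta>) (2 * L * norm ?v + 2 * L * norm ?v) ?r"
      by (intro growth_mono[OF growth_diff[OF orbit_lipschitz_growth variation_growth] eta_le(1)]) simp
    show "?r t = K (\<lambda>t. g (orbit y' t)) t - K (\<lambda>t. g (orbit y t) + g' (orbit y t) (variation y ?v t)) t" for t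
      unfolding K_add[OF g_orbit_growth3 g'_variation_growth3]
      using fun_cong[OF orbit_eq[of y], of t] fun_cong[OF orbit_eq[of y'], of t]
        fun_cong[OF variation_eq[of y ?v], of t] fun_cong[OF e_diff[of y' y], of t]
      by (simp add: algebra_simps)
  qed (simp add: blinfun.bilinear_simps)
  then show ?thesis by (simp add: algebra_simps)
qed

lemma variation_diff_growth:
  "growth (2 * \<eta>) (8 * M * B * L * L * norm (y' - y) * norm v) (\<lambda>t. variation y' v t - variation y v t)"
proof -
  let ?N = "\<lambda>t. (g' (orbit y' t) - g' (orbit y t)) (variation y' v t)"
  have N: "growth (2 * \<eta>) (B * (2 * L * norm (y' - y)) * (2 * L * norm v)) ?N"
  proof (rule growth_dominated_mult[OF _ orbit_lipschitz_growth variation_growth _ B_nonneg])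
    show "norm (?N t) \<le> B * norm (orbit y' t - orbit y t) * norm (variation y' v t)" for t
      by (rule order_trans[OF norm_blinfun mult_right_mono[OF g'_lip norm_ge_zero]])
  qed (intro conts orbit_cont variation_cont | simp)+
  have "growth (2 * \<eta>) (2 * (M * (B * (2 * L * norm (y' - y)) * (2 * L * norm v))))
     (\<lambda>t. variation y' v t - variation y v t)"
  proof (rule residual_growth[where y = y, OF eta_le(2,3) g'_variation_growth3 g'_variation_growth3 _ _ _ N])
    show "growth (3 * \<eta>) (2 * L * norm v + 2 * L * norm v) (\<lambda>t. variation y' v t - variation y v t)"
      by (rule growth_mono[OF growth_diff[OF variation_growth variation_growth] eta_le(1) order_refl])
    show "variation y' v t - variation y v t =
      K (\<lambda>t. g' (orbit y' t) (variation y' v t)) t - K (\<lambda>t. g' (orbit y t) (variation y v t)) t" for t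
      using fun_cong[OF variation_eq[of y' v], of t] fun_cong[OF variation_eq[of y v], of t]
      by (simp add: algebra_simps)
  qed (simp add: blinfun.bilinear_simps)
  then show ?thesis by (simp add: algebra_simps)
qed

text \<open>The remainder splits into a Taylor error for \<open>g'\<close> and two products of terms that were
  estimated before. In each of the three terms the growth rates of the factors add up to \<open>3
  \<eta>\<close>. Only the Taylor error is not quadratic; it inherits the modulus of continuity of
  \<open>g''\<close>.\<close>

lemma variation2_error:
  assumes C: "\<And>a b. norm (g'' a - g'' b) \<le> \<epsilon> + C * norm (a - b)" "0 \<le> C" "0 \<le> \<epsilon>"
  shows "growth (3 * \<eta>)
    (2 * (M * ((\<epsilon> + C * (2 * L * norm (y' - y))) * (2 * L * norm (y' - y)) * (2 * L * norm v) +
       B * (8 * M * B * L * L * norm (y' - y) * norm (y' - y)) * (2 * L * norm v) +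
       B * (2 * L * norm (y' - y)) * (8 * M * B * L * L * norm (y' - y) * norm v))))
     (\<lambda>t. variation y' v t - variation y v t - variation2 y (y' - y) v t)"
    (is "growth _ (2 * (M * (?c1 + ?c2 + ?c3))) ?r")
proof -
  let ?w = "y' - y" and ?d = "\<lambda>t. orbit y' t - orbit y t"
  let ?N1 = "\<lambda>t. (g' (orbit y' t) - g' (orbit y t) - g'' (orbit y t) (?d t)) (variation y' v t)"
  let ?N2 = "\<lambda>t. g'' (orbit y t) (?d t - variation y ?w t) (variation y' v t)"
  let ?N3 = "\<lambda>t. g'' (orbit y t) (variation y ?w t) (variation y' v t - variation y v t)"
  have N1: "growth (3 * \<eta>) ?c1 ?N1"
  proof (rule growthI)
    fix t
    let ?E = "exp (\<eta> * \<bar>t\<bar>)"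
    have E: "1 \<le> ?E" using eta_pos by simp
    have d: "norm (?d t) \<le> 2 * L * norm ?w * ?E"
      by (rule growthD[OF orbit_lipschitz_growth])
    have "\<epsilon> + C * norm (?d t) \<le> \<epsilon> * ?E + C * (2 * L * norm ?w * ?E)"
      using d C E by (intro add_mono mult_left_mono) (auto intro: mult_right_mono[of 1 _ \<epsilon>, simplified] simp: mult.commute[of \<epsilon>])
    also have "\<dots> = (\<epsilon> + C * (2 * L * norm ?w)) * ?E"
      by (simp add: algebra_simps)
    finally have "(\<epsilon> + C * norm (?d t)) * norm (?d t) \<le>
        (\<epsilon> + C * (2 * L * norm ?w)) * ?E * (2 * L * norm ?w * ?E)"
      using d C L_nonneg by (intro mult_mono) auto
    with g'_taylor[OF C(1,2), of "orbit y' t" "orbit y t"]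
    have "norm (g' (orbit y' t) - g' (orbit y t) - g'' (orbit y t) (?d t)) \<le> \<dots>"
      by linarith
    then have "norm (?N1 t) \<le> \<dots> * (2 * L * norm v * ?E)"
      by (intro order_trans[OF norm_blinfun] mult_mono growthD[OF variation_growth])
        (use C L_nonneg in auto)
    also have "\<dots> = ?c1 * exp (3 * \<eta> * \<bar>t\<bar>)"
    proof -
      have "exp (3 * \<eta> * \<bar>t\<bar>) = ?E * ?E * ?E"
        unfolding exp_add[symmetric] by (simp add: algebra_simps)
      then show ?thesis by (simp only: ac_simps)
    qed
    finally show "norm (?N1 t) \<le> ?c1 * exp (3 * \<eta> * \<bar>t\<bar>)" .
  qed (intro conts orbit_cont variation_cont)
  have N2: "growth (3 * \<eta>) ?c2 ?N2"
    by (rule growth_dominated_mult[OF _ variation_error[of y' y] variation_growth[of v y'] _ B_nonneg])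
      (intro conts orbit_cont variation_cont norm_blinfun2_le[OF g''_bound] | simp)+
  have N3: "growth (3 * \<eta>) ?c3 ?N3"
    by (rule growth_dominated_mult[OF _ variation_growth[of ?w y] variation_diff_growth[of y' y v] _ B_nonneg])
      (intro conts orbit_cont variation_cont norm_blinfun2_le[OF g''_bound] | simp)+
  have b1: "growth (3 * \<eta>) (B * (2 * L * norm ?w) * (2 * L * norm v) + \<delta> * (8 * M * B * L * L * norm ?w * norm v))
      (\<lambda>t. forcing y ?w v t + g' (orbit y t) (variation2 y ?w v t))"
    by (intro growth_add forcing_growth3 g'_variation2_growth3)
  show ?thesis
  proof (rule residual_growth[where y = y, OF _ order_refl g'_variation_growth3[of v y']
        growth_add[OF g'_variation_growth3[of v y] b1] _ _ _ growth_add[OF growth_add[OF N1 N2] N3]])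
    show "\<eta> \<le> 3 * \<eta>" by (rule eta_le)
    show "growth (3 * \<eta>) (2 * L * norm v + 2 * L * norm v + 8 * M * B * L * L * norm ?w * norm v) ?r"
      by (rule growth_diff[OF growth_mono[OF growth_diff[OF variation_growth variation_growth] eta_le(1) order_refl]
            variation2_growth3])
    show "?r t = K (\<lambda>t. g' (orbit y' t) (variation y' v t)) t -
      K (\<lambda>t. g' (orbit y t) (variation y v t) + (forcing y ?w v t + g' (orbit y t) (variation2 y ?w v t))) t" for t
      unfolding K_add[OF g'_variation_growth3 b1] K_add[OF forcing_growth3 g'_variation2_growth3]
      using fun_cong[OF variation_eq[of y v], of t] fun_cong[OF variation_eq[of y' v], of t]
        fun_cong[OF variation2_eq[of y ?w v], of t]
      by (simp add: algebra_simps)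
  qed (simp add: forcing_def blinfun.bilinear_simps)
qed

text \<open>The same splitting for the dependence of the second variation on \<open>y\<close>, with one more
  term because the second variation itself enters the linearised equation.\<close>

lemma variation2_diff:
  assumes C: "\<And>a b. norm (g'' a - g'' b) \<le> \<epsilon> + C * norm (a - b)" "0 \<le> C" "0 \<le> \<epsilon>"
  shows "growth (3 * \<eta>)
    (2 * (M * ((\<epsilon> + C * (2 * L * norm (y' - y))) * (2 * L * norm w) * (2 * L * norm v) +
       B * (8 * M * B * L * L * norm (y' - y) * norm w) * (2 * L * norm v) +
       B * (2 * L * norm w) * (8 * M * B * L * L * norm (y' - y) * norm v) +
       B * (2 * L * norm (y' - y)) * (8 * M * B * L * L * norm w * norm v))))
     (\<lambda>t. variation2 y' w v t - variation2 y w v t)"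
    (is "growth _ (2 * (M * (?c1 + ?c2 + ?c3 + ?c4))) ?r")
proof -
  let ?d = "\<lambda>t. orbit y' t - orbit y t"
  let ?N1 = "\<lambda>t. (g'' (orbit y' t) - g'' (orbit y t)) (variation y' w t) (variation y' v t)"
  let ?N2 = "\<lambda>t. g'' (orbit y t) (variation y' w t - variation y w t) (variation y' v t)"
  let ?N3 = "\<lambda>t. g'' (orbit y t) (variation y w t) (variation y' v t - variation y v t)"
  let ?N4 = "\<lambda>t. (g' (orbit y' t) - g' (orbit y t)) (variation2 y' w v t)"
  have N1: "growth (3 * \<eta>) ?c1 ?N1"
  proof (rule growthI)
    fix t
    let ?E = "exp (\<eta> * \<bar>t\<bar>)"
    have E: "1 \<le> ?E" using eta_pos by simp
    have d: "norm (?d t) \<le> 2 * L * norm (y' - y) * ?E"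
      by (rule growthD[OF orbit_lipschitz_growth])
    have "\<epsilon> + C * norm (?d t) \<le> \<epsilon> * ?E + C * (2 * L * norm (y' - y) * ?E)"
      using d C E by (intro add_mono mult_left_mono) (auto intro: mult_right_mono[of 1 _ \<epsilon>, simplified] simp: mult.commute[of \<epsilon>])
    also have "\<dots> = (\<epsilon> + C * (2 * L * norm (y' - y))) * ?E"
      by (simp add: algebra_simps)
    finally have "norm (g'' (orbit y' t) - g'' (orbit y t)) \<le> (\<epsilon> + C * (2 * L * norm (y' - y))) * ?E"
      using C(1)[of "orbit y' t" "orbit y t"] by linarith
    then have "norm (?N1 t) \<le> (\<epsilon> + C * (2 * L * norm (y' - y))) * ?E * (2 * L * norm w * ?E) * (2 * L * norm v * ?E)"
      by (intro order_trans[OF norm_blinfun2] mult_mono growthD[OF variation_growth])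
        (use C L_nonneg in auto)
    also have "\<dots> = ?c1 * exp (3 * \<eta> * \<bar>t\<bar>)"
    proof -
      have "exp (3 * \<eta> * \<bar>t\<bar>) = ?E * ?E * ?E"
        unfolding exp_add[symmetric] by (simp add: algebra_simps)
      then show ?thesis by (simp only: ac_simps)
    qed
    finally show "norm (?N1 t) \<le> ?c1 * exp (3 * \<eta> * \<bar>t\<bar>)" .
  qed (intro conts orbit_cont variation_cont)
  have N2: "growth (3 * \<eta>) ?c2 ?N2"
    by (rule growth_dominated_mult[OF _ variation_diff_growth[of y' y w] variation_growth[of v y'] _ B_nonneg])
      (intro conts orbit_cont variation_cont norm_blinfun2_le[OF g''_bound] | simp)+
  have N3: "growth (3 * \<eta>) ?c3 ?N3"
    by (rule growth_dominated_mult[OF _ variation_growth[of w y] variation_diff_growth[of y' y v] _ B_nonneg])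
      (intro conts orbit_cont variation_cont norm_blinfun2_le[OF g''_bound] | simp)+
  have N4: "growth (3 * \<eta>) ?c4 ?N4"
  proof (rule growth_dominated_mult[OF _ orbit_lipschitz_growth variation2_growth _ B_nonneg])
    show "norm (?N4 t) \<le> B * norm (orbit y' t - orbit y t) * norm (variation2 y' w v t)" for t
      by (rule order_trans[OF norm_blinfun mult_right_mono[OF g'_lip norm_ge_zero]])
  qed (intro conts orbit_cont variation2_cont | simp)+
  show ?thesis
  proof (rule residual_growth[where y = y, OF _ order_refl
        growth_add[OF forcing_growth3 g'_variation2_growth3]
        growth_add[OF forcing_growth3 g'_variation2_growth3]
        growth_diff[OF variation2_growth3 variation2_growth3] _ _
        growth_add[OF growth_add[OF growth_add[OF N1 N2] N3] N4]])
    show "\<eta> \<le> 3 * \<eta>" by (rule eta_le)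
    show "?r t = K (\<lambda>t. forcing y' w v t + g' (orbit y' t) (variation2 y' w v t)) t -
      K (\<lambda>t. forcing y w v t + g' (orbit y t) (variation2 y w v t)) t" for t
      unfolding K_add[OF forcing_growth3 g'_variation2_growth3]
      using fun_cong[OF variation2_eq[of y w v], of t] fun_cong[OF variation2_eq[of y' w v], of t]
      by (simp add: algebra_simps)
  qed (simp add: forcing_def blinfun.bilinear_simps)
qed

definition initial' :: "'a \<Rightarrow> 'a \<Rightarrow>\<^sub>L 'e" where
  "initial' y = Blinfun (\<lambda>v. variation y v 0)"

definition initial'' :: "'a \<Rightarrow> 'a \<Rightarrow>\<^sub>L 'a \<Rightarrow>\<^sub>L 'e" where
  "initial'' y = Blinfun (\<lambda>w. Blinfun (\<lambda>v. variation2 y w v 0))"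

lemma initial'_apply: "blinfun_apply (initial' y) v = variation y v 0"
proof -
  have "bounded_linear (\<lambda>v. variation y v 0)"
    by (rule bounded_linear_intro[where K = "2 * L"])
      (use growth_at_0[OF variation_growth[of _ y]] in \<open>auto simp: variation_add variation_scaleR mult.commute\<close>)
  then show ?thesis by (simp add: initial'_def bounded_linear_Blinfun_apply)
qed

lemma initial''_apply: "blinfun_apply (blinfun_apply (initial'' y) w) v = variation2 y w v 0"
proof -
  have bd: "norm (variation2 y w v 0) \<le> norm v * (8 * M * B * L * L * norm w)" for w v
    using growth_at_0[OF variation2_growth[of w v y]] by (simp add: ac_simps)
  have 1: "bounded_linear (\<lambda>v. variation2 y w v 0)" for w
    by (rule bounded_linear_intro[OF _ _ bd]) (auto simp: variation2_add_right variation2_scaleR_right)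
  have 2: "bounded_linear (\<lambda>w. Blinfun (\<lambda>v. variation2 y w v 0))"
  proof (rule bounded_linear_intro[where K = "8 * M * B * L * L"])
    show "norm (Blinfun (\<lambda>v. variation2 y w v 0)) \<le> norm w * (8 * M * B * L * L)" for w
      by (rule norm_blinfun_bound)
        (use bd[of w] M_nonneg B_nonneg L_nonneg in \<open>auto simp: bounded_linear_Blinfun_apply[OF 1] ac_simps\<close>)
    show "Blinfun (\<lambda>v. variation2 y (a + b) v 0) =
        Blinfun (\<lambda>v. variation2 y a v 0) + Blinfun (\<lambda>v. variation2 y b v 0)" for a b
      by (rule blinfun_eqI)
        (simp only: bounded_linear_Blinfun_apply[OF 1] blinfun.add_left, simp only: variation2_add_left)
    show "Blinfun (\<lambda>v. variation2 y (r *\<^sub>R a) v 0) = r *\<^sub>R Blinfun (\<lambda>v. variation2 y a v 0)" for r a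
      by (rule blinfun_eqI)
        (simp only: bounded_linear_Blinfun_apply[OF 1] blinfun.scaleR_left, simp only: variation2_scaleR_left)
  qed
  show ?thesis
    by (simp add: initial''_def bounded_linear_Blinfun_apply[OF 1] bounded_linear_Blinfun_apply[OF 2])
qed

lemma initial_has_derivative:
  "((\<lambda>y. orbit y 0) has_derivative blinfun_apply (initial' y)) (at y)"
proof (rule has_derivativeI_modulus[OF blinfun.bounded_linear_right])
  fix \<epsilon> :: real assume "0 < \<epsilon>"
  show "\<exists>C\<ge>0. \<forall>y'. norm (orbit y' 0 - orbit y 0 - initial' y (y' - y)) \<le> (\<epsilon> + C * norm (y' - y)) * norm (y' - y)"
  proof (intro exI[of _ "8 * M * B * L * L"] conjI allI)
    fix y'
    have "norm (orbit y' 0 - orbit y 0 - initial' y (y' - y)) \<le> 8 * M * B * L * L * norm (y' - y) * norm (y' - y)"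
      using growth_at_0[OF variation_error[of y' y]] by (simp add: initial'_apply)
    also have "\<dots> \<le> (\<epsilon> + 8 * M * B * L * L * norm (y' - y)) * norm (y' - y)"
      using \<open>0 < \<epsilon>\<close> by (intro mult_right_mono) auto
    finally show "norm (orbit y' 0 - orbit y 0 - initial' y (y' - y)) \<le> \<dots>" .
  qed (use M_nonneg B_nonneg L_nonneg in auto)
qed

text \<open>At time zero all weights equal one. The two previous estimates become a remainder estimate for the
  derivative and a modulus of continuity for the second derivative.\<close>

lemma derivative_modulus:
  assumes "0 < \<epsilon>"
  shows "\<exists>C\<ge>0. \<forall>y' v w.
     norm (variation y' v 0 - variation y v 0 - variation2 y (y' - y) v 0)
        \<le> (\<epsilon> + C * norm (y' - y)) * norm (y' - y) * norm v \<and>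
     norm (variation2 y' w v 0 - variation2 y w v 0) \<le> (\<epsilon> + C * norm (y' - y)) * norm w * norm v"
proof -
  \<comment> \<open>The factor of \<open>\<epsilon>\<close> in both estimates.\<close>
  define c where "c = 8 * M * L * L"
  define \<epsilon>' where "\<epsilon>' = \<epsilon> / (c + 1)"
  have "0 \<le> c" using M_nonneg L_nonneg by (simp add: c_def)
  then have e': "0 < \<epsilon>'" and ce: "c * \<epsilon>' \<le> \<epsilon>"
    using assms by (auto simp: \<epsilon>'_def field_simps)
  obtain C where C: "0 \<le> C" "\<And>a b. norm (g'' a - g'' b) \<le> \<epsilon>' + C * norm (a - b)"
    using g''_modulus[OF e'] by blast
  note C' = C(2,1) less_imp_le[OF e']
  define D where "D = 16 * M * C * L * L * L + 96 * M * M * B * B * L * L * L"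
  have MB: "0 \<le> M * M * B * B * L * L * L" using M_nonneg B_nonneg L_nonneg by simp
  have "norm (variation y' v 0 - variation y v 0 - variation2 y (y' - y) v 0)
        \<le> (\<epsilon> + D * norm (y' - y)) * norm (y' - y) * norm v"
    and "norm (variation2 y' w v 0 - variation2 y w v 0) \<le> (\<epsilon> + D * norm (y' - y)) * norm w * norm v" for y' v w
  proof -
    let ?d = "norm (y' - y)"
    have "norm (variation y' v 0 - variation y v 0 - variation2 y (y' - y) v 0) \<le>
      (c * \<epsilon>' + D * ?d) * ?d * norm v - 32 * (M * M * B * B * L * L * L) * ?d * ?d * norm v"
      by (rule order_trans[OF growth_at_0[OF variation2_error[OF C']]])
        (simp add: c_def D_def algebra_simps)
    also have "\<dots> \<le> (c * \<epsilon>' + D * ?d) * ?d * norm v"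
      using MB by simp
    also have "\<dots> \<le> (\<epsilon> + D * ?d) * ?d * norm v"
      using ce by (intro mult_right_mono) auto
    finally show "norm (variation y' v 0 - variation y v 0 - variation2 y (y' - y) v 0) \<le> \<dots>" .
    have "norm (variation2 y' w v 0 - variation2 y w v 0) \<le> (c * \<epsilon>' + D * ?d) * norm w * norm v"
      by (rule order_trans[OF growth_at_0[OF variation2_diff[OF C']]])
        (simp add: c_def D_def algebra_simps)
    also have "\<dots> \<le> (\<epsilon> + D * ?d) * norm w * norm v"
      using ce by (intro mult_right_mono) auto
    finally show "norm (variation2 y' w v 0 - variation2 y w v 0) \<le> \<dots>" .
  qed
  moreover have "0 \<le> D"
    unfolding D_def using M_nonneg B_nonneg L_nonneg C(1) by simp
  ultimately show ?thesis by blast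
qed

lemma initial'_has_derivative: "(initial' has_derivative blinfun_apply (initial'' y)) (at y)"
proof (rule has_derivativeI_modulus[OF blinfun.bounded_linear_right])
  fix \<epsilon> :: real assume e: "0 < \<epsilon>"
  from derivative_modulus[OF this, of y] obtain C where C: "0 \<le> C"
    and bd: "\<forall>y' v w. norm (variation y' v 0 - variation y v 0 - variation2 y (y' - y) v 0)
        \<le> (\<epsilon> + C * norm (y' - y)) * norm (y' - y) * norm v \<and>
     norm (variation2 y' w v 0 - variation2 y w v 0) \<le> (\<epsilon> + C * norm (y' - y)) * norm w * norm v"
    by (elim exE conjE)
  show "\<exists>C\<ge>0. \<forall>y'. norm (initial' y' - initial' y - initial'' y (y' - y)) \<le> (\<epsilon> + C * norm (y' - y)) * norm (y' - y)"
  proof (intro exI[of _ C] conjI allI norm_blinfun_bound)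
    show "norm (blinfun_apply (initial' y' - initial' y - initial'' y (y' - y)) v) \<le>
        (\<epsilon> + C * norm (y' - y)) * norm (y' - y) * norm v" for y' v
      using bd by (simp add: blinfun.diff_left initial'_apply initial''_apply)
  qed (use C e in auto)
qed

lemma initial''_cont: "continuous_on UNIV initial''"
proof (intro continuous_at_imp_continuous_on ballI)
  fix y
  show "isCont initial'' y"
    unfolding continuous_at_eps_delta
  proof (intro allI impI)
    fix \<epsilon> :: real assume e: "0 < \<epsilon>"
    then have "0 < \<epsilon> / 3" by simp
    from derivative_modulus[OF this, of y] obtain C where C: "0 \<le> C"
      and bd: "\<forall>y' v w. norm (variation y' v 0 - variation y v 0 - variation2 y (y' - y) v 0)
          \<le> (\<epsilon> / 3 + C * norm (y' - y)) * norm (y' - y) * norm v \<and>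
       norm (variation2 y' w v 0 - variation2 y w v 0) \<le> (\<epsilon> / 3 + C * norm (y' - y)) * norm w * norm v"
      by (elim exE conjE)
    show "\<exists>d>0. \<forall>y'. dist y' y < d \<longrightarrow> dist (initial'' y') (initial'' y) < \<epsilon>"
    proof (rule exI[of _ "\<epsilon> / 3 / (C + 1)"], intro conjI allI impI)
      fix y' assume d: "dist y' y < \<epsilon> / 3 / (C + 1)"
      have "C * norm (y' - y) \<le> (C + 1) * norm (y' - y)"
        by (intro mult_right_mono) auto
      also have "\<dots> \<le> \<epsilon> / 3"
        using d C by (simp add: dist_norm field_simps)
      finally have *: "\<epsilon> / 3 + C * norm (y' - y) \<le> 2 * \<epsilon> / 3"
        by simp
      have "norm (initial'' y' - initial'' y) \<le> 2 * \<epsilon> / 3"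
      proof (intro norm_blinfun_bound)
        fix w v
        have "norm (blinfun_apply (blinfun_apply (initial'' y' - initial'' y) w) v) \<le>
            (\<epsilon> / 3 + C * norm (y' - y)) * norm w * norm v"
          using bd by (simp add: blinfun.diff_left initial''_apply)
        also have "\<dots> \<le> 2 * \<epsilon> / 3 * norm w * norm v"
          by (intro mult_right_mono *) auto
        finally show "norm (blinfun_apply (blinfun_apply (initial'' y' - initial'' y) w) v) \<le> \<dots>" .
      qed (use e in auto)
      then show "dist (initial'' y') (initial'' y) < \<epsilon>"
        using e by (simp add: dist_norm)
    qed (use C e in auto)
  qed
qed

end

section \<open>Slowly growing solutions of linear equations\<close>

lemma antiderivative_exists:
  fixes w :: "real \<Rightarrow> 'a::euclidean_space"
  assumes "continuous_on UNIV w"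
  obtains W where "W 0 = 0" "\<And>t. (W has_vector_derivative w t) (at t)"
proof (rule that[of "\<lambda>u. LBINT y=ereal 0..u. w y"])
  fix t :: real
  let ?S = "{- \<bar>t\<bar> - 1..\<bar>t\<bar> + 1}"
  have "((\<lambda>u. LBINT y=ereal 0..u. w y) has_vector_derivative w t) (at t within ?S)"
    by (rule interval_integral_FTC2) (auto intro: continuous_on_subset[OF assms])
  moreover have "t \<in> interior ?S" by auto
  ultimately show "((\<lambda>u. LBINT y=ereal 0..u. w y) has_vector_derivative w t) (at t)"
    by (simp only: at_within_interior)
qed simp

lemma has_vector_derivative_cont:
  assumes "\<And>t. (z has_vector_derivative z' t) (at t)"
  shows "continuous_on S z"
  using assms has_vector_derivative_continuous by (blast intro: continuous_at_imp_continuous_on)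

text \<open>Comparing derivatives replaces the estimation of integrals throughout this part.\<close>

lemma increment_le:
  fixes f :: "real \<Rightarrow> 'a::real_normed_vector"
  assumes "a \<le> b" "\<And>t. (f has_vector_derivative f' t) (at t)"
    and "\<And>t. (\<phi> has_real_derivative \<phi>' t) (at t)" "\<And>t. a \<le> t \<Longrightarrow> t \<le> b \<Longrightarrow> norm (f' t) \<le> \<phi>' t"
  shows "norm (f b - f a) \<le> \<phi> b - \<phi> a"
proof (cases "a = b")
  case False
  then show ?thesis
    using assms
    by (intro differentiable_bound_general[of a b f \<phi> f' \<phi>'] has_vector_derivative_cont[OF assms(2)]
        has_vector_derivative_cont[OF assms(3)[unfolded has_real_derivative_iff_has_vector_derivative]])
      (auto simp: has_real_derivative_iff_has_vector_derivative)
qed simp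

lemma vector_derivative_reflect:
  assumes "\<And>t. (f has_vector_derivative f' t) (at t)"
  shows "((\<lambda>t. f (- t)) has_vector_derivative - f' (- t)) (at t)"
proof -
  have "(uminus has_vector_derivative -1) (at t)" for t :: real
    by (rule has_vector_derivative_eq_rhs[OF has_vector_derivative_minus[OF has_vector_derivative_id]]) simp
  from vector_diff_chain_at[OF this assms] show ?thesis
    by (simp add: o_def)
qed

lemma growth_reflect: "growth \<theta> c w \<Longrightarrow> growth \<theta> c (\<lambda>t. w (- t))"
  unfolding growth_def by (auto intro!: continuous_on_compose2[of UNIV w] continuous_intros dest: spec[of _ "- _"])

lemma antiderivative_growth:
  fixes W :: "real \<Rightarrow> 'a::real_normed_vector"
  assumes w: "growth \<theta> c w" and "0 < \<theta>" and W: "W 0 = 0" "\<And>t. (W has_vector_derivative w t) (at t)"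
  shows "growth \<theta> (c / \<theta>) W"
proof -
  have pos: "norm (W t) \<le> c / \<theta> * exp (\<theta> * t)" if "0 \<le> t" "growth \<theta> c w" "W 0 = 0" "\<And>t. (W has_vector_derivative w t) (at t)"
    for t and w W :: "real \<Rightarrow> 'a"
  proof -
    have d: "((\<lambda>t. c / \<theta> * exp (\<theta> * t)) has_real_derivative c * exp (\<theta> * t)) (at t)" for t
      by (rule derivative_eq_intros refl | use \<open>0 < \<theta>\<close> in simp)+
    have "norm (W t - W 0) \<le> c / \<theta> * exp (\<theta> * t) - c / \<theta> * exp (\<theta> * 0)"
    proof (rule increment_le[OF that(1,4) d])
      show "norm (w s) \<le> c * exp (\<theta> * s)" if "0 \<le> s" for s
        using growthD[OF \<open>growth \<theta> c w\<close>, of s] that by simp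
    qed
    moreover have "0 \<le> c / \<theta>" using growth_nonneg[OF that(2)] \<open>0 < \<theta>\<close> by simp
    ultimately show ?thesis using that(3) by simp
  qed
  show ?thesis
  proof (rule growthI[OF has_vector_derivative_cont[OF W(2)]])
    fix t
    have r: "((\<lambda>t. W (- t)) has_vector_derivative - w (- t)) (at t)" for t
      by (rule vector_derivative_reflect[OF W(2)])
    have "growth \<theta> c (\<lambda>t. - w (- t))"
      using growth_scaleR[OF growth_reflect[OF w], of "-1"] by simp
    from pos[OF _ this _ r] pos[OF _ w W] W(1) show "norm (W t) \<le> c / \<theta> * exp (\<theta> * \<bar>t\<bar>)"
      by (cases "0 \<le> t") (auto simp: abs_if dest: meta_spec[of _ "-t"])
  qed
qed

text \<open>For \<open>Re l > 0\<close> every solution other than the one that integrates the inhomogeneity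
  from infinity grows like \<open>exp (Re l t)\<close> at plus infinity. The integral over the half line is
  obtained as the limit of the antiderivative along the integers.\<close>

lemma scalar_resolvent_pos:
  fixes l :: complex
  assumes w: "growth \<theta> c w" and "0 \<le> \<theta>" "\<theta> < Re l"
  shows "\<exists>z. (\<forall>t. (z has_vector_derivative l * z t + w t) (at t)) \<and> growth \<theta> (c / (Re l - \<theta>)) z"
proof -
  let ?d = "Re l - \<theta>"
  have d: "0 < ?d" using assms by simp
  have c: "0 \<le> c" by (rule growth_nonneg[OF w])
  let ?u = "\<lambda>t. exp (- (l * of_real t)) * w t"
  have "continuous_on UNIV ?u"
    by (intro continuous_intros growth_cont[OF w])
  then obtain W where W: "\<And>t. (W has_vector_derivative ?u t) (at t)"
    using antiderivative_exists by blast
  have W_le: "norm (W b - W a) \<le> c / ?d * (exp (\<theta> * \<bar>a\<bar>) * exp (- (Re l * a)))" if "a \<le> b" for a b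
  proof -
    let ?K = "c / ?d * exp (\<theta> * \<bar>a\<bar> - \<theta> * a)"
    have dphi: "((\<lambda>s. - k * exp (- d * s)) has_real_derivative k * d * exp (- d * s)) (at s)" for k d s :: real
      by (rule DERIV_cong[OF DERIV_cmult[OF DERIV_fun_exp[OF DERIV_cmult[OF DERIV_ident]]]]) simp
    have "norm (W b - W a) \<le> - ?K * exp (- ?d * b) - - ?K * exp (- ?d * a)"
    proof (rule increment_le[OF that W dphi[of ?K ?d]])
      fix s assume s: "a \<le> s"
      then have "\<bar>s\<bar> \<le> \<bar>a\<bar> + (s - a)" by auto
      then have "\<theta> * \<bar>s\<bar> \<le> \<theta> * (\<bar>a\<bar> + (s - a))"
        using \<open>0 \<le> \<theta>\<close> by (rule mult_left_mono)
      then have "exp (- (Re l * s)) * exp (\<theta> * \<bar>s\<bar>) \<le> exp (- (Re l * s)) * exp (\<theta> * (\<bar>a\<bar> + (s - a)))"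
        by (intro mult_left_mono) auto
      also have "\<dots> = exp (\<theta> * \<bar>a\<bar> - \<theta> * a) * exp (- ?d * s)"
        unfolding exp_add[symmetric] by (simp add: algebra_simps)
      finally have le: "c * (exp (- (Re l * s)) * exp (\<theta> * \<bar>s\<bar>)) \<le> c * (exp (\<theta> * \<bar>a\<bar> - \<theta> * a) * exp (- ?d * s))"
        using c by (rule mult_left_mono)
      have "norm (?u s) \<le> exp (- (Re l * s)) * (c * exp (\<theta> * \<bar>s\<bar>))"
        unfolding norm_mult by (intro mult_mono growthD[OF w]) auto
      also have "\<dots> \<le> ?K * ?d * exp (- ?d * s)"
        using le d by (simp add: ac_simps)
      finally show "norm (?u s) \<le> ?K * ?d * exp (- ?d * s)" .
    qed
    also have "\<dots> \<le> ?K * exp (- ?d * a)"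
      using c d by simp
    also have "\<dots> = c / ?d * (exp (\<theta> * \<bar>a\<bar>) * exp (- (Re l * a)))"
      unfolding mult.assoc exp_add[symmetric] by (simp add: algebra_simps)
    finally show ?thesis .
  qed
  have lim0: "(\<lambda>n. c / ?d * exp (- ?d) ^ n) \<longlonglongrightarrow> c / ?d * 0"
    using d by (intro tendsto_mult tendsto_const LIMSEQ_realpow_zero) auto
  have "Cauchy (\<lambda>n. W (real n))"
  proof (rule CauchyI')
    fix e :: real assume "0 < e"
    with lim0 have "eventually (\<lambda>n. c / ?d * exp (- ?d) ^ n < e) sequentially"
      by (intro order_tendstoD) auto
    then obtain n0 where n0: "\<And>n. n \<ge> n0 \<Longrightarrow> c / ?d * exp (- ?d) ^ n < e"
      unfolding eventually_sequentially by blast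
    show "\<exists>M. \<forall>m\<ge>M. \<forall>n>m. dist (W (real m)) (W (real n)) < e"
    proof (intro exI[of _ n0] allI impI)
      fix m n assume mn: "n0 \<le> m" "m < n"
      have "norm (W (real m) - W (real n)) \<le> c / ?d * (exp (\<theta> * real m) * exp (- (Re l * real m)))"
        using W_le[of "real m" "real n"] mn by (simp add: norm_minus_commute)
      also have "exp (\<theta> * real m) * exp (- (Re l * real m)) = exp (- ?d) ^ m"
        unfolding exp_add[symmetric] exp_of_nat_mult[symmetric] by (simp add: algebra_simps)
      finally show "dist (W (real m)) (W (real n)) < e"
        using n0[OF mn(1)] by (simp add: dist_norm)
    qed
  qed
  then obtain I where I: "(\<lambda>n. W (real n)) \<longlonglongrightarrow> I"
    using convergent_eq_Cauchy convergent_def by blast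
  have I_le: "norm (I - W a) \<le> c / ?d * (exp (\<theta> * \<bar>a\<bar>) * exp (- (Re l * a)))" for a
  proof -
    have "(\<lambda>n. norm (W (real n) - W a)) \<longlonglongrightarrow> norm (I - W a)"
      by (intro tendsto_intros I)
    moreover have "eventually (\<lambda>n. a \<le> real n) sequentially"
      using eventually_ge_at_top[of "nat \<lceil>a\<rceil>"] by eventually_elim linarith
    then have "eventually (\<lambda>n. norm (W (real n) - W a) \<le> c / ?d * (exp (\<theta> * \<bar>a\<bar>) * exp (- (Re l * a)))) sequentially"
      by eventually_elim (rule W_le)
    ultimately show ?thesis
      by (rule tendsto_upperbound) simp
  qed
  \<comment> \<open>Variation of constants, with the constant chosen so that the exponentially growing part cancels.\<close>
  define z where "z t = exp (l * of_real t) * (W t - I)" for t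
  have zd: "(z has_vector_derivative l * z t + w t) (at t)" for t
  proof -
    have "((\<lambda>t. exp (l * of_real t)) has_vector_derivative l * exp (l * of_real t)) (at t)" for t
      by (rule has_vector_derivative_real_field) (rule derivative_eq_intros refl | simp)+
    from has_vector_derivative_mult[OF this has_vector_derivative_diff[OF W has_vector_derivative_const[of I]], of t]
    have "(z has_vector_derivative exp (l * of_real t) * (?u t - 0) + l * exp (l * of_real t) * (W t - I)) (at t)"
      by (simp add: z_def[abs_def])
    moreover have "exp (l * of_real t) * (?u t - 0) + l * exp (l * of_real t) * (W t - I) = l * z t + w t"
      by (simp add: z_def exp_minus)
    ultimately show ?thesis by simp
  qed
  have "growth \<theta> (c / ?d) z"
  proof (rule growthI[OF has_vector_derivative_cont[OF zd]])
    fix t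
    have "norm (z t) = exp (Re l * t) * norm (I - W t)"
      by (simp add: z_def norm_mult norm_minus_commute)
    also have "\<dots> \<le> exp (Re l * t) * (c / ?d * (exp (\<theta> * \<bar>t\<bar>) * exp (- (Re l * t))))"
      by (intro mult_left_mono I_le) auto
    also have "\<dots> = c / ?d * exp (\<theta> * \<bar>t\<bar>)"
      by (simp add: exp_minus)
    finally show "norm (z t) \<le> c / ?d * exp (\<theta> * \<bar>t\<bar>)" .
  qed
  with zd show ?thesis by blast
qed

text \<open>Time reversal changes the sign of \<open>l\<close>.\<close>

lemma scalar_resolvent:
  fixes l :: complex
  assumes w: "growth \<theta> c w" and th: "0 \<le> \<theta>" "\<theta> < \<bar>Re l\<bar>"
  shows "\<exists>z. (\<forall>t. (z has_vector_derivative l * z t + w t) (at t)) \<and> growth \<theta> (c / (\<bar>Re l\<bar> - \<theta>)) z"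
proof (cases "0 < Re l")
  case True
  then show ?thesis using scalar_resolvent_pos[OF w th(1)] th(2) by simp
next
  case False
  have "growth \<theta> c (\<lambda>t. - w (- t))"
    using growth_scaleR[OF growth_reflect[OF w], of "-1"] by simp
  then obtain y where y: "\<And>t. (y has_vector_derivative - l * y t - w (- t)) (at t)" "growth \<theta> (c / (- Re l - \<theta>)) y"
    using scalar_resolvent_pos[of \<theta> c "\<lambda>t. - w (- t)" "- l"] th False by auto
  have "((\<lambda>t. y (- t)) has_vector_derivative l * y (- t) + w t) (at t)" for t
    using vector_derivative_reflect[OF y(1), of t] by (simp add: add.commute)
  with growth_reflect[OF y(2)] False show ?thesis
    by (intro exI[of _ "\<lambda>t. y (- t)"]) auto
qed

lemma scalar_homogeneous_zero:
  fixes l :: complex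
  assumes v: "growth \<theta> c v" and th: "\<theta> < \<bar>Re l\<bar>"
    and vd: "\<And>t. (v has_vector_derivative l * v t) (at t)"
  shows "v = (\<lambda>t. 0)"
proof -
  let ?E = "\<lambda>t. exp (- l * of_real t)"
  have Ed: "(?E has_vector_derivative - l * ?E t) (at t)" for t
    by (rule has_vector_derivative_real_field) (rule derivative_eq_intros refl | simp)+
  have "((\<lambda>t. ?E t * v t) has_vector_derivative ?E t * (l * v t) + - l * ?E t * v t) (at t)" for t
    by (rule has_vector_derivative_mult[OF Ed vd])
  then have "((\<lambda>t. ?E t * v t) has_vector_derivative 0) (at t)" for t
    by (simp add: algebra_simps)
  then have const: "?E t * v t = ?E 0 * v 0" for t
    using has_vector_derivative_zero_constant[of UNIV "\<lambda>t. ?E t * v t"] by (metis UNIV_I convex_UNIV)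
  have v_eq: "v t = exp (l * of_real t) * v 0" for t
  proof -
    have "v t = exp (l * of_real t) * (?E t * v t)"
      by (simp add: exp_minus)
    also have "?E t * v t = v 0"
      using const[of t] by simp
    finally show ?thesis .
  qed
  define \<sigma> where "\<sigma> = sgn (Re l)"
  have s: "Re l * \<sigma> = \<bar>Re l\<bar>" "\<bar>\<sigma>\<bar> \<le> 1" "Re l \<noteq> 0 \<Longrightarrow> \<bar>\<sigma>\<bar> = 1"
    by (auto simp: \<sigma>_def abs_sgn sgn_if)
  \<comment> \<open>Going to infinity in the direction in which \<open>exp (l t)\<close> grows forces \<open>v 0 = 0\<close>.\<close>
  let ?d = "\<bar>Re l\<bar> - \<theta>"
  have le: "norm (v 0) \<le> c * exp (- ?d) ^ n" for n
  proof (cases "Re l = 0")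
    case True
    have "exp (- (\<bar>Re l\<bar> - \<theta>)) ^ n = exp (\<theta> * real n)"
      using True by (simp add: exp_of_nat_mult[symmetric] mult.commute)
    have "norm (v (real n)) = norm (v 0)"
      using v_eq[of "real n"] True by (simp add: norm_mult)
    then show ?thesis
      using growthD[OF v, of "real n"] True by (simp add: exp_of_nat_mult[symmetric] mult.commute)
  next
    case False
    let ?t = "real n * \<sigma>"
    have t: "\<bar>?t\<bar> = real n" using s(3) False by (simp add: abs_mult)
    have "exp (\<bar>Re l\<bar> * real n) * norm (v 0) = norm (v ?t)"
      using v_eq[of ?t] s(1) by (simp add: norm_mult ac_simps)
    also have "\<dots> \<le> c * exp (\<theta> * real n)"
      using growthD[OF v, of ?t] t by simp
    finally have "norm (v 0) \<le> c * (exp (\<theta> * real n) * exp (- (\<bar>Re l\<bar> * real n)))"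
      by (simp add: exp_minus field_simps)
    also have "exp (\<theta> * real n) * exp (- (\<bar>Re l\<bar> * real n)) = exp (- ?d) ^ n"
      unfolding exp_add[symmetric] exp_of_nat_mult[symmetric] by (simp add: algebra_simps)
    finally show ?thesis .
  qed
  have "(\<lambda>n. c * exp (- ?d) ^ n) \<longlonglongrightarrow> c * 0"
    using th by (intro tendsto_mult tendsto_const LIMSEQ_realpow_zero) auto
  then have "norm (v 0) \<le> c * 0"
    by (rule LIMSEQ_le_const) (use le in auto)
  then have "v t = 0" for t
    using v_eq[of t] by simp
  then show ?thesis by blast
qed

lemma bounded_linear_axis: "bounded_linear (axis i :: 'a::euclidean_space \<Rightarrow> 'a^'n)"
  unfolding linear_conv_bounded_linear[symmetric] by (rule linearI) (auto simp: vec_eq_iff axis_def)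

lemma vec_eq_sum_axis: "(z :: 'a::euclidean_space^'n) = (\<Sum>i\<in>UNIV. axis i (z $ i))"
  by (auto simp: vec_eq_iff axis_def if_distrib cong: if_cong)

lemma has_vector_derivative_componentwise:
  fixes z :: "real \<Rightarrow> 'a::euclidean_space^'n"
  assumes "\<And>i. ((\<lambda>t. z t $ i) has_vector_derivative d $ i) (at t)"
  shows "(z has_vector_derivative d) (at t)"
proof -
  have "((\<lambda>t. \<Sum>i\<in>UNIV. axis i (z t $ i)) has_vector_derivative (\<Sum>i\<in>UNIV. axis i (d $ i))) (at t)"
    by (intro has_vector_derivative_sum bounded_linear.has_vector_derivative[OF bounded_linear_axis] assms)
  then show ?thesis unfolding vec_eq_sum_axis[symmetric] .
qed

lemma growth_componentwise:
  fixes z :: "real \<Rightarrow> 'a::euclidean_space^'n"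
  assumes "\<And>i. growth \<theta> c (\<lambda>t. z t $ i)"
  shows "growth \<theta> (real CARD('n) * c) z"
proof (rule growthI)
  have "continuous_on UNIV (\<lambda>t. \<chi> i. z t $ i)"
    by (intro continuous_on_vec_lambda growth_cont[OF assms])
  then show "continuous_on UNIV z" by simp
  fix t
  have "norm (z t) \<le> (\<Sum>i\<in>UNIV. norm (z t $ i))"
    unfolding norm_vec_def by (rule L2_set_le_sum) simp
  also have "\<dots> \<le> (\<Sum>i\<in>(UNIV::'n set). c * exp (\<theta> * \<bar>t\<bar>))"
    by (intro sum_mono growthD[OF assms])
  finally show "norm (z t) \<le> CARD('n) * c * exp (\<theta> * \<bar>t\<bar>)" by simp
qed

lemma growth_component: "growth \<theta> c w \<Longrightarrow> growth \<theta> c (\<lambda>t. w t $ i)"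
  unfolding growth_def
  by (auto intro!: continuous_intros order_trans[OF Finite_Cartesian_Product.norm_nth_le])

lemma vector_resolvent:
  fixes w :: "real \<Rightarrow> complex^'n"
  assumes w: "growth \<theta> c w" and th: "0 \<le> \<theta>" "\<theta> < \<bar>Re l\<bar>"
  shows "\<exists>z. (\<forall>t. (z has_vector_derivative l *s z t + w t) (at t)) \<and> growth \<theta> (CARD('n) * (c / (\<bar>Re l\<bar> - \<theta>))) z"
proof -
  have "\<forall>i. \<exists>z. (\<forall>t. (z has_vector_derivative l * z t + w t $ i) (at t)) \<and> growth \<theta> (c / (\<bar>Re l\<bar> - \<theta>)) z"
    using scalar_resolvent[OF growth_component[OF w] th] by blast
  then obtain z where z: "\<And>i t. (z i has_vector_derivative l * z i t + w t $ i) (at t)"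
    "\<And>i. growth \<theta> (c / (\<bar>Re l\<bar> - \<theta>)) (z i)"
    by metis
  show ?thesis
  proof (intro exI[of _ "\<lambda>t. \<chi> i. z i t"] conjI allI)
    show "((\<lambda>t. \<chi> i. z i t) has_vector_derivative l *s (\<chi> i. z i t) + w t) (at t)" for t
      by (rule has_vector_derivative_componentwise) (simp add: z)
    show "growth \<theta> (CARD('n) * (c / (\<bar>Re l\<bar> - \<theta>))) (\<lambda>t. \<chi> i. z i t)"
      by (rule growth_componentwise) (simp add: z)
  qed
qed

lemma vector_homogeneous_zero:
  fixes v :: "real \<Rightarrow> complex^'n"
  assumes v: "growth \<theta> c v" and th: "\<theta> < \<bar>Re l\<bar>"
    and vd: "\<And>t. (v has_vector_derivative l *s v t) (at t)"
  shows "v t = 0"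
proof -
  have "(\<lambda>t. v t $ i) = (\<lambda>t. 0)" for i
    using bounded_linear.has_vector_derivative[OF bounded_linear_vec_nth vd]
    by (intro scalar_homogeneous_zero[OF growth_component[OF v] th]) simp
  then show ?thesis by (simp add: vec_eq_iff fun_eq_iff)
qed

text \<open>The product of the operators \<open>M - l\<close> over the list, applied to a vector.\<close>

fun roots_apply :: "complex^'n^'n \<Rightarrow> complex list \<Rightarrow> complex^'n \<Rightarrow> complex^'n" where
  "roots_apply M [] v = v"
| "roots_apply M (l # ls) v = roots_apply M ls (M *v v - l *s v)"

lemma linear_scale_complex: "linear (\<lambda>v::complex^'n. l *s v)"
  by (rule linearI) (auto simp: vec_eq_iff algebra_simps)

lemma linear_shift: "linear (\<lambda>v::complex^'n. M *v v - l *s v)"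
  by (intro linear_compose_sub matrix_vector_mul_linear linear_scale_complex)

lemma linear_roots_apply: "linear (roots_apply M ls)"
proof (induction ls)
  case Nil
  then show ?case by (simp add: linear_id[unfolded id_def])
next
  case (Cons l ls)
  have eq: "roots_apply M (l # ls) = roots_apply M ls \<circ> (\<lambda>v. M *v v - l *s v)"
    by (simp add: fun_eq_iff)
  show ?case
    unfolding eq by (rule linear_compose[OF linear_shift Cons])
qed

lemma roots_apply_scale: "roots_apply M ls (c *s v) = c *s roots_apply M ls v"
proof (induction ls arbitrary: v)
  case (Cons l ls)
  have "M *v (c *s v) - l *s (c *s v) = c *s (M *v v - l *s v)"
    by (simp add: vector_scalar_commute vec.scale_right_diff_distrib vector_smult_assoc mult.commute)
  then show ?case by (simp only: roots_apply.simps Cons)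
qed simp

lemma growth_linear:
  fixes f :: "'a::euclidean_space \<Rightarrow> 'b::real_normed_vector"
  assumes "linear f"
  obtains k where "0 \<le> k" "\<And>\<theta> c w. growth \<theta> c w \<Longrightarrow> growth \<theta> (k * c) (\<lambda>t. f (w t))"
proof -
  have bl: "bounded_linear f" using assms by (simp add: linear_conv_bounded_linear)
  then obtain k where k: "0 \<le> k" "\<And>x. norm (f x) \<le> norm x * k"
    using bounded_linear.nonneg_bounded by blast
  show thesis
  proof (rule that[OF k(1)])
    show "growth \<theta> (k * c) (\<lambda>t. f (w t))" if "growth \<theta> c w" for \<theta> c w
      using k by (intro growth_dominated[OF _ that] bounded_linear.continuous_on[OF bl] growth_cont[OF that])
        (auto simp: mult.commute)
  qed
qed

lemma linear_has_vector_derivative: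
  fixes f :: "'a::euclidean_space \<Rightarrow> 'b::real_normed_vector"
  assumes "linear f" "(z has_vector_derivative d) F"
  shows "((\<lambda>t. f (z t)) has_vector_derivative f d) F"
  using assms bounded_linear.has_vector_derivative by (auto simp: linear_conv_bounded_linear)

text \<open>If \<open>y\<close> solves the componentwise scalar equation \<open>y' = l y + w\<close>, then the
  correction \<open>z\<close> with \<open>z' = M z + (M - l) y\<close> makes \<open>y + z\<close> a solution
  of \<open>z' = M z + w\<close>. The new inhomogeneity is annihilated by the product of the remaining
  factors, because \<open>y\<close> is annihilated by the full product: applying that product to
  \<open>y\<close> gives a slowly growing solution of \<open>v' = l v\<close>, and this vanishes. So the
  recursion over the list of roots closes.\<close>

lemma hyperbolic_resolvent:
  fixes M :: "complex^'n^'n"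
  assumes \<alpha>: "0 < \<alpha>" and ls: "\<And>l. l \<in> set ls \<Longrightarrow> \<alpha> \<le> \<bar>Re l\<bar>"
  shows "\<exists>N\<ge>0. \<forall>\<theta> c w. 0 \<le> \<theta> \<longrightarrow> \<theta> \<le> \<alpha> / 2 \<longrightarrow> growth \<theta> c w \<longrightarrow> (\<forall>t. roots_apply M ls (w t) = 0) \<longrightarrow>
    (\<exists>z. (\<forall>t. (z has_vector_derivative M *v z t + w t) (at t)) \<and> growth \<theta> (N * c) z)"
  using ls
proof (induction ls)
  case Nil
  show ?case
  proof (intro exI[of _ 0] conjI allI impI)
    fix \<theta> c and w :: "real \<Rightarrow> complex^'n" assume "\<forall>t. roots_apply M [] (w t) = 0"
    then have "w = (\<lambda>t. 0)" by (simp add: fun_eq_iff)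
    then show "\<exists>z. (\<forall>t. (z has_vector_derivative M *v z t + w t) (at t)) \<and> growth \<theta> (0 * c) z"
      by (intro exI[of _ "\<lambda>t. 0"]) (simp add: growth_zero matrix_vector_mult_0_right)
  qed simp
next
  case (Cons l ls)
  obtain N where N: "0 \<le> N" "\<And>\<theta> c w. 0 \<le> \<theta> \<Longrightarrow> \<theta> \<le> \<alpha> / 2 \<Longrightarrow> growth \<theta> c w \<Longrightarrow> (\<forall>t. roots_apply M ls (w t) = 0) \<Longrightarrow>
    (\<exists>z. (\<forall>t. (z has_vector_derivative M *v z t + w t) (at t)) \<and> growth \<theta> (N * c) z)"
    using Cons.IH Cons.prems by (metis list.set_intros(2))
  obtain k where k: "0 \<le> k" "\<And>\<theta> c w. growth \<theta> c w \<Longrightarrow> growth \<theta> (k * c) (\<lambda>t. M *v w t - l *s w t)"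
    using growth_linear[OF linear_shift] by metis
  obtain k' where k': "\<And>\<theta> c w. growth \<theta> c w \<Longrightarrow> growth \<theta> (k' * c) (\<lambda>t. roots_apply M (l # ls) (w t))"
    using growth_linear[OF linear_roots_apply[of M "l # ls"]] by metis
  define R where "R = CARD('n) * (2 / \<alpha>)"
  have R: "0 \<le> R" using \<alpha> by (simp add: R_def)
  show ?case
  proof (intro exI[of _ "R + N * (k * R)"] conjI allI impI)
    fix \<theta> c and w :: "real \<Rightarrow> complex^'n"
    assume th: "0 \<le> \<theta>" "\<theta> \<le> \<alpha> / 2" and w: "growth \<theta> c w" and ann: "\<forall>t. roots_apply M (l # ls) (w t) = 0"
    have l: "\<alpha> \<le> \<bar>Re l\<bar>" using Cons.prems by simp
    have th': "\<theta> < \<bar>Re l\<bar>" using th l \<alpha> by linarith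
    obtain y where y: "\<And>t. (y has_vector_derivative l *s y t + w t) (at t)"
      "growth \<theta> (CARD('n) * (c / (\<bar>Re l\<bar> - \<theta>))) y"
      using vector_resolvent[OF w th(1) th'] by blast
    have "c / (\<bar>Re l\<bar> - \<theta>) \<le> c / (\<alpha> / 2)"
      using th l \<alpha> growth_nonneg[OF w] by (intro divide_left_mono) auto
    then have "CARD('n) * (c / (\<bar>Re l\<bar> - \<theta>)) \<le> CARD('n) * (c / (\<alpha> / 2))"
      by (intro mult_left_mono) auto
    then have yR: "growth \<theta> (R * c) y"
      by (intro growth_mono[OF y(2) order_refl]) (simp add: R_def ac_simps)
    have "((\<lambda>t. roots_apply M (l # ls) (y t)) has_vector_derivative l *s roots_apply M (l # ls) (y t)) (at t)" for t
      using linear_has_vector_derivative[OF linear_roots_apply y(1), of M "l # ls" t] ann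
      by (simp only: linear_add[OF linear_roots_apply] roots_apply_scale) simp
    then have "roots_apply M (l # ls) (y t) = 0" for t
      by (intro vector_homogeneous_zero[OF k'[OF yR] th'])
    then have "\<forall>t. roots_apply M ls (M *v y t - l *s y t) = 0" by simp
    then obtain z where z: "\<And>t. (z has_vector_derivative M *v z t + (M *v y t - l *s y t)) (at t)"
      "growth \<theta> (N * (k * (R * c))) z"
      using N(2)[OF th k(2)[OF yR]] by blast
    show "\<exists>z. (\<forall>t. (z has_vector_derivative M *v z t + w t) (at t)) \<and> growth \<theta> ((R + N * (k * R)) * c) z"
    proof (intro exI[of _ "\<lambda>t. y t + z t"] conjI allI)
      show "((\<lambda>t. y t + z t) has_vector_derivative M *v (y t + z t) + w t) (at t)" for t
        by (rule has_vector_derivative_eq_rhs[OF has_vector_derivative_add[OF y(1) z(1)]])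
          (simp add: matrix_vector_right_distrib)
      show "growth \<theta> ((R + N * (k * R)) * c) (\<lambda>t. y t + z t)"
        using growth_add[OF yR z(2)] by (simp add: algebra_simps)
    qed
  qed (use R N(1) k(1) in simp)
qed

lemma hyperbolic_homogeneous_zero:
  fixes M :: "complex^'n^'n"
  assumes "growth \<theta> c z" "\<And>l. l \<in> set ls \<Longrightarrow> \<theta> < \<bar>Re l\<bar>"
    and "\<And>t. (z has_vector_derivative M *v z t) (at t)" "\<And>t. roots_apply M ls (z t) = 0"
  shows "z t = 0"
  using assms
proof (induction ls arbitrary: z c t)
  case (Cons l ls)
  obtain k where k: "0 \<le> k" "\<And>\<theta> c w. growth \<theta> c w \<Longrightarrow> growth \<theta> (k * c) (\<lambda>t. M *v w t - l *s w t)"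
    using growth_linear[OF linear_shift] by metis
  have d: "((\<lambda>t. M *v z t - l *s z t) has_vector_derivative M *v (M *v z t - l *s z t)) (at t)" for t
    using linear_has_vector_derivative[OF linear_shift Cons.prems(3)]
    by (simp add: matrix_vector_mult_diff_distrib vector_scalar_commute)
  have "M *v z t - l *s z t = 0" for t
  proof (rule Cons.IH[OF k(2)[OF Cons.prems(1)] _ d])
    show "roots_apply M ls (M *v z t - l *s z t) = 0" for t
      using Cons.prems(4)[of t] by simp
  qed (use Cons.prems(2) in simp)
  then have "M *v z t = l *s z t" for t
    by (rule eq_iff_diff_eq_0[THEN iffD2])
  then have "(z has_vector_derivative l *s z t) (at t)" for t
    using Cons.prems(3)[of t] by metis
  then show ?case
    by (rule vector_homogeneous_zero[OF Cons.prems(1), rotated]) (use Cons.prems(2) in simp)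
qed simp

section \<open>The Jordan chain at eigenvalue zero\<close>

lemma poly_charpoly: "poly (charpoly A) x = det (mat x - A)"
proof -
  have "poly (if P then [:0, 1:] else 0) x = (if P then x else 0)" for P
    by simp
  then show ?thesis
    by (simp add: charpoly_def det_def poly_sum poly_prod mat_def map_matrix_def)
qed

lemma mat_apply: "mat x *v v = x *s (v :: 'a::comm_ring_1^'n)"
  by (simp add: vec_eq_iff matrix_vector_mult_def mat_def if_distrib[of "\<lambda>c. c * _"] cong: if_cong)

lemma mat_minus_apply: "(mat x - A) *v v = x *s v - A *v (v :: 'a::comm_ring_1^'n)"
  by (simp add: matrix_vector_mult_diff_rdistrib mat_apply)

lemma det_eq_0_imp_dependent_rows:
  fixes c :: "'n::finite \<Rightarrow> real^'n"
  assumes "det (\<chi> j. c j) = 0"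
  obtains a where "(\<Sum>j\<in>UNIV. a j *s c j) = 0" "\<exists>j. a j \<noteq> 0"
proof -
  let ?B = "\<chi> j. c j"
  have "\<not> (\<exists>B'. ?B ** B' = mat 1)"
    using assms invertible_det_nz[of ?B] invertible_right_inverse by blast
  then show thesis
    unfolding matrix_right_invertible_independent_rows using that
    by (auto simp: row_def)
qed

lemma det_shift_rows:
  fixes b :: "'n::finite \<Rightarrow> real^'n"
  shows "det (\<chi> j. x *s b j - A *v b j) = det (mat x - A) * det (\<chi> j. b j)"
proof -
  have "(\<chi> j. (mat x - A) *v b j) = (\<chi> j. b j) ** transpose (mat x - A)"
    by (simp add: vec_eq_iff matrix_matrix_mult_def matrix_vector_mult_def transpose_def mult.commute)
  then show ?thesis by (simp add: det_mul mat_minus_apply)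
qed

text \<open>A factor \<open>x\<close> can be taken out of a row as soon as the rest of that row is in the span
  of the other rows.\<close>

lemma det_replace_row:
  fixes c :: "'n::finite \<Rightarrow> real^'n"
  assumes "c k = x *s a + w" "w \<in> vec.span {c j |j. j \<noteq> k}"
  shows "det (\<chi> j. c j) = x * det (\<chi> j. (c(k := a)) j)"
proof -
  let ?B = "\<chi> j. if j = k then x *s a else c j"
  have "{row j ?B |j. j \<noteq> k} = {c j |j. j \<noteq> k}"
    by (force simp: row_def)
  then have "det (\<chi> j. if j = k then row k ?B + w else row j ?B) = det ?B"
    using assms(2) by (intro det_row_span) simp
  moreover have "(\<chi> j. if j = k then row k ?B + w else row j ?B) = (\<chi> j. c j)"
    by (auto simp: vec_eq_iff row_def assms(1))
  ultimately have "det (\<chi> j. c j) = det ?B" by (simp only:)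
  also have "\<dots> = x * det (\<chi> j. if j = k then a else c j)"
    by (rule det_row_mul)
  also have "(\<chi> j. if j = k then a else c j) = (\<chi> j. (c(k := a)) j)"
    by (auto simp: vec_eq_iff)
  finally show ?thesis .
qed

lemma continuous_on_det_rows:
  fixes c :: "real \<Rightarrow> 'n::finite \<Rightarrow> real^'n"
  assumes "\<And>j. continuous_on UNIV (\<lambda>x. c x j)"
  shows "continuous_on UNIV (\<lambda>x. det (\<chi> j. c x j))"
  unfolding det_def by (auto intro!: continuous_intros assms)

lemma basis_indexed:
  fixes S :: "(real^'n::finite) set"
  assumes "independent S"
  obtains b :: "'n \<Rightarrow> real^'n" where "inj b" "independent (range b)" "S \<subseteq> range b"
proof -
  obtain B where B: "S \<subseteq> B" "independent B" "UNIV \<subseteq> span B"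
    using maximal_independent_subset_extend[OF subset_UNIV assms] by metis
  then have "card B = CARD('n)"
    using basis_card_eq_dim[of B UNIV] by simp
  moreover have "finite B" using B(2) by (rule independent_imp_finite)
  ultimately obtain b where "bij_betw b (UNIV :: 'n set) B"
    using finite_same_card_bij[of "UNIV :: 'n set" B] by auto
  then show thesis
    using that[of b] B by (auto simp: bij_betw_def)
qed

lemma det_basis_nonzero:
  fixes b :: "'n::finite \<Rightarrow> real^'n"
  assumes "inj b" "independent (range b)"
  shows "(\<Sum>j\<in>UNIV. a j *s b j) = 0 \<Longrightarrow> a j = 0" "det (\<chi> j. b j) \<noteq> 0"
proof -
  show *: "a j = 0" if "(\<Sum>j\<in>UNIV. a j *s b j) = 0" for a j
  proof -
    have "(\<Sum>v\<in>range b. a (inv b v) *\<^sub>R v) = 0"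
      using that by (simp add: sum.reindex[OF assms(1)] assms(1) scalar_mult_eq_scaleR)
    then show ?thesis
      using independentD[OF assms(2), of "range b" "\<lambda>v. a (inv b v)" "b j"] by (simp add: assms(1))
  qed
  then show "det (\<chi> j. b j) \<noteq> 0"
    using det_eq_0_imp_dependent_rows by metis
qed

lemma charpoly_nonzero:
  fixes A :: "real^'n^'n"
  shows "charpoly A \<noteq> 0"
proof
  assume 0: "charpoly A = 0"
  obtain k where k: "0 \<le> k" "\<And>v. norm (A *v v) \<le> norm v * k"
    using bounded_linear.nonneg_bounded[OF matrix_vector_mul_bounded_linear[of A]] by blast
  have "det (mat (k + 1) - A) = 0"
    using 0 by (simp flip: poly_charpoly)
  then obtain v where v: "v \<noteq> 0" "(mat (k + 1) - A) *v v = 0"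
    using invertible_det_nz invertible_left_inverse matrix_left_invertible_ker by metis
  then have "A *v v = (k + 1) *s v"
    by (simp add: mat_minus_apply)
  then have "(k + 1) * norm v \<le> norm v * k"
    using k(2)[of v] k(1) by (simp add: scalar_mult_eq_scaleR)
  then show False using v(1) by (simp add: algebra_simps)
qed

lemma isCont_zero_at:
  fixes h :: "real \<Rightarrow> real"
  assumes "continuous_on UNIV h" "\<And>x. x \<noteq> 0 \<Longrightarrow> h x = 0"
  shows "h 0 = 0"
proof -
  have "(h \<longlongrightarrow> h 0) (at 0)"
    using assms(1) by (simp add: continuous_on_def)
  moreover have "(h \<longlongrightarrow> 0) (at 0)"
    by (rule tendsto_eventually) (auto simp: eventually_at_filter assms(2))
  ultimately show ?thesis using tendsto_unique[OF trivial_limit_at] by blast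
qed

text \<open>The algebraic multiplicity enters only as the exact rate at which \<open>det (x - A)\<close>
  vanishes at zero.\<close>

lemma charpoly_order_two:
  fixes A :: "real^'n^'n"
  assumes "alg_mult A 0 = 2"
  obtains g where "continuous_on UNIV g" "g 0 \<noteq> 0" "\<And>x. det (mat x - A) = x\<^sup>2 * g x"
proof -
  obtain q where q: "charpoly A = [:- 0, 1:] ^ 2 * q" "\<not> [:- 0, 1:] dvd q"
    using order_decomp[OF charpoly_nonzero[of A], of 0] assms by (auto simp: alg_mult_def)
  show thesis
  proof (rule that[of "poly q"])
    show "poly q 0 \<noteq> 0" using q(2) poly_eq_0_iff_dvd[of q 0] by simp
    show "det (mat x - A) = x\<^sup>2 * poly q x" for x
      unfolding poly_charpoly[symmetric] q(1) by (simp add: power2_eq_square)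
  qed (intro continuous_intros)
qed

text \<open>In a basis that starts with \<open>p\<close> the matrix \<open>x - A\<close> maps \<open>p\<close>
  to \<open>x p\<close>, so the determinant is \<open>x * D x\<close>. If \<open>p\<close> were not in the
  image of \<open>A\<close>, then \<open>D 0 \<noteq> 0\<close> and the zero of the determinant would be
  simple.\<close>

lemma jordan_chain_exists:
  fixes A :: "real^'n^'n"
  assumes am: "alg_mult A 0 = 2" and p: "p \<noteq> 0" "A *v p = 0"
    and ker: "\<And>v. A *v v = 0 \<Longrightarrow> \<exists>s. v = s *s p"
  shows "\<exists>q. A *v q = p"
proof (rule ccontr)
  assume no: "\<nexists>q. A *v q = p"
  obtain b :: "'n \<Rightarrow> real^'n" where b: "inj b" "independent (range b)" "{p} \<subseteq> range b"
    using basis_indexed[of "{p}"] p(1) by (metis dependent_single)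
  then obtain j1 where j1: "b j1 = p" by auto
  let ?c = "\<lambda>x. (\<lambda>j. x *s b j - A *v b j)(j1 := p)"
  define D where "D x = det (\<chi> j. ?c x j)" for x
  have D_eq: "det (mat x - A) * det (\<chi> j. b j) = x * D x" for x
    unfolding det_shift_rows[symmetric] D_def
    by (rule det_replace_row[where w = 0]) (simp_all add: j1 p vec.span_zero)
  \<comment> \<open>A linear relation between \<open>p\<close> and the vectors \<open>A b\<^sub>j\<close> would give \<open>A v = a p\<close> for a combination \<open>v\<close> of the other basis vectors.\<close>
  have "D 0 \<noteq> 0"
  proof
    assume "D 0 = 0"
    then obtain a where a: "(\<Sum>j\<in>UNIV. a j *s ?c 0 j) = 0" "\<exists>j. a j \<noteq> 0"
      unfolding D_def using det_eq_0_imp_dependent_rows by blast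
    define v where "v = (\<Sum>j\<in>UNIV - {j1}. a j *s b j)"
    have "(\<Sum>j\<in>UNIV. a j *s ?c 0 j) = a j1 *s p + (\<Sum>j\<in>UNIV - {j1}. a j *s (- (A *v b j)))"
      by (subst sum.remove[of _ j1]) (auto intro!: sum.cong)
    also have "(\<Sum>j\<in>UNIV - {j1}. a j *s (- (A *v b j))) = - (A *v v)"
      by (simp add: v_def vec.linear_sum[OF matrix_vector_mul_linear_gen] vector_scalar_commute sum_negf)
    finally have Av: "A *v v = a j1 *s p" using a(1) by simp
    show False
    proof (cases "a j1 = 0")
      case True
      then obtain s where "v = s *s p" using ker Av by fastforce
      then have "(\<Sum>j\<in>UNIV. (if j = j1 then - s else a j) *s b j) = 0"
        by (subst sum.remove[of _ j1]) (auto simp: v_def j1 intro!: sum.cong)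
      from det_basis_nonzero(1)[OF b(1,2) this] a(2) True show False
        by (metis)
    next
      case False
      then have "A *v ((1 / a j1) *s v) = p"
        by (simp add: vector_scalar_commute Av vector_smult_assoc)
      with no show False by blast
    qed
  qed
  obtain g where g: "continuous_on UNIV g" "g 0 \<noteq> 0" "\<And>x. det (mat x - A) = x\<^sup>2 * g x"
    using charpoly_order_two[OF am] by blast
  have "(\<lambda>x. x * g x * det (\<chi> j. b j) - D x) 0 = 0"
  proof (rule isCont_zero_at)
    show "continuous_on UNIV (\<lambda>x. x * g x * det (\<chi> j. b j) - D x)"
      unfolding D_def
    proof (intro continuous_intros g continuous_on_det_rows)
      show "continuous_on UNIV (\<lambda>x. ?c x j)" for j
        by (cases "j = j1") (auto simp: scalar_mult_eq_scaleR intro!: continuous_intros)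
    qed
    show "x * g x * det (\<chi> j. b j) - D x = 0" if "x \<noteq> 0" for x
      using D_eq[of x] that by (simp add: g(3) power2_eq_square)
  qed
  with \<open>D 0 \<noteq> 0\<close> show False by simp
qed

text \<open>If \<open>r\<close> were not a combination of \<open>p\<close> and \<open>q\<close>, then
  \<open>p, q, r\<close> would start a basis in which \<open>x - A\<close> is triangular on the first three
  vectors, with \<open>x\<close> on the diagonal, and the determinant would be divisible by
  \<open>x\<^sup>3\<close>.\<close>

lemma jordan_chain_maximal:
  fixes A :: "real^'n^'n"
  assumes am: "alg_mult A 0 = 2" and p: "p \<noteq> 0" "A *v p = 0" and q: "A *v q = p"
    and r: "A *v r = \<alpha> *s p + \<beta> *s q"
  shows "\<exists>s t. r = s *s p + t *s q"
proof (rule ccontr)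
  assume no: "\<nexists>s t. r = s *s p + t *s q"
  have qp: "q \<notin> span {p}"
  proof
    assume "q \<in> span {p}"
    then obtain s where "q = s *s p" by (auto simp: span_singleton scalar_mult_eq_scaleR)
    then show False using p q by (simp add: vector_scalar_commute)
  qed
  have rq: "r \<notin> span {q, p}"
  proof
    assume "r \<in> span {q, p}"
    then obtain t where "r - t *s q \<in> span {p}" by (auto simp: span_insert scalar_mult_eq_scaleR)
    then obtain s where "r - t *s q = s *s p" by (auto simp: span_singleton scalar_mult_eq_scaleR)
    then have "r = s *s p + t *s q" by (simp add: algebra_simps)
    with no show False by blast
  qed
  have "independent {r, q, p}"
    using p(1) qp rq by (intro independent_insertI) (auto simp: independent_empty)
  then obtain b :: "'n \<Rightarrow> real^'n" where b: "inj b" "independent (range b)" "{r, q, p} \<subseteq> range b"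
    using basis_indexed by metis
  then obtain j1 j2 j3 where j: "b j1 = p" "b j2 = q" "b j3 = r" by auto
  have "p \<noteq> q" "r \<noteq> p" "r \<noteq> q"
    using qp rq by (auto simp: span_base)
  then have ne: "j1 \<noteq> j2" "j3 \<noteq> j1" "j3 \<noteq> j2" using j by auto
  let ?c0 = "\<lambda>x j. x *s b j - A *v b j"
  let ?c1 = "\<lambda>x. (?c0 x)(j1 := p)"
  let ?c2 = "\<lambda>x. (?c1 x)(j2 := q)"
  let ?c3 = "\<lambda>x. (?c2 x)(j3 := r)"
  define D where "D x = det (\<chi> j. ?c3 x j)" for x
  have D_eq: "det (mat x - A) * det (\<chi> j. b j) = x * (x * (x * D x))" for x
  proof -
    have "det (\<chi> j. ?c0 x j) = x * det (\<chi> j. ?c1 x j)"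
      by (rule det_replace_row[where w = 0]) (simp_all add: j p vec.span_zero)
    also have "det (\<chi> j. ?c1 x j) = x * det (\<chi> j. ?c2 x j)"
    proof (rule det_replace_row[where w = "- p"])
      show "?c1 x j2 = x *s q + - p" using ne by (simp add: j q)
      show "- p \<in> vec.span {?c1 x j |j. j \<noteq> j2}"
        using ne(1) by (intro vec.span_neg vec.span_base) (auto intro!: exI[of _ j1])
    qed
    also have "det (\<chi> j. ?c2 x j) = x * det (\<chi> j. ?c3 x j)"
    proof (rule det_replace_row[where w = "- (\<alpha> *s p + \<beta> *s q)"])
      show "?c2 x j3 = x *s r + - (\<alpha> *s p + \<beta> *s q)" using ne by (simp add: j r)
      have "p \<in> {?c2 x j |j. j \<noteq> j3}"
        using ne by (auto intro!: exI[of _ j1])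
      moreover have "q \<in> {?c2 x j |j. j \<noteq> j3}"
        using ne by (auto intro!: exI[of _ j2])
      ultimately show "- (\<alpha> *s p + \<beta> *s q) \<in> vec.span {?c2 x j |j. j \<noteq> j3}"
        by (intro vec.span_neg vec.span_add vec.span_scale vec.span_base)
    qed
    finally show ?thesis by (simp add: det_shift_rows D_def)
  qed
  obtain g where g: "continuous_on UNIV g" "g 0 \<noteq> 0" "\<And>x. det (mat x - A) = x\<^sup>2 * g x"
    using charpoly_order_two[OF am] by blast
  have "(\<lambda>x. g x * det (\<chi> j. b j) - x * D x) 0 = 0"
  proof (rule isCont_zero_at)
    show "continuous_on UNIV (\<lambda>x. g x * det (\<chi> j. b j) - x * D x)"
      unfolding D_def
    proof (intro continuous_intros g continuous_on_det_rows)
      show "continuous_on UNIV (\<lambda>x. ?c3 x j)" for j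
        by (cases "j = j1"; cases "j = j2"; cases "j = j3")
          (auto simp: scalar_mult_eq_scaleR intro!: continuous_intros)
    qed
    show "g x * det (\<chi> j. b j) - x * D x = 0" if "x \<noteq> 0" for x
      using D_eq[of x] that by (simp add: g(3) power2_eq_square)
  qed
  then show False using g(2) det_basis_nonzero(2)[OF b(1,2)] by simp
qed

lemma ker_eq_span_of_geom_mult_1:
  fixes A :: "real^'n^'n"
  assumes gm: "geom_mult A 0 = 1" and p: "p \<noteq> 0" "A *v p = 0" and v: "A *v v = 0"
  shows "\<exists>s. v = s *s p"
proof (rule ccontr)
  assume no: "\<nexists>s. v = s *s p"
  then have "v \<notin> vec.span {p}" by (auto simp: vec.span_singleton)
  then have ind: "vec.independent {v, p}"
    using p(1) by (intro vec.independent_insertI) (auto simp: vec.independent_empty)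
  have "{v, p} \<subseteq> {v. A *v v = 0 *s v}" using p v by simp
  from vec.independent_card_le_dim[OF this ind] have "card {v, p} \<le> 1"
    using gm by (simp add: geom_mult_def)
  moreover have "v \<noteq> p" using no[unfolded not_ex, rule_format, of 1] by auto
  ultimately show False by simp
qed

section \<open>Annihilating polynomials and the center subspace\<close>

definition poly_apply :: "complex^'n^'n \<Rightarrow> complex poly \<Rightarrow> complex^'n \<Rightarrow> complex^'n" where
  "poly_apply M p v = (\<Sum>k\<le>degree p. coeff p k *s ((*v) M ^^ k) v)"

lemma poly_apply_le:
  assumes "degree p \<le> N"
  shows "poly_apply M p v = (\<Sum>k\<le>N. coeff p k *s ((*v) M ^^ k) v)"
  unfolding poly_apply_def using assms
  by (intro sum.mono_neutral_left) (auto simp: coeff_eq_0)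

lemma poly_apply_diff: "poly_apply M (p - q) v = poly_apply M p v - poly_apply M q v"
proof -
  let ?N = "max (degree p) (degree q)"
  show ?thesis
    by (simp add: poly_apply_le[of _ ?N] degree_diff_le vec.scale_left_diff_distrib sum_subtractf)
qed

lemma poly_apply_smult: "poly_apply M (smult c p) v = c *s poly_apply M p v"
  by (simp add: poly_apply_le[of _ "degree p"] degree_smult_le vec.scale_sum_right vector_smult_assoc)

lemma poly_apply_pCons: "poly_apply M (pCons a p) v = a *s v + poly_apply M p (M *v v)"
proof -
  have "poly_apply M (pCons a p) v = (\<Sum>k\<le>Suc (degree p). coeff (pCons a p) k *s ((*v) M ^^ k) v)"
    by (rule poly_apply_le) (rule degree_pCons_le)
  also have "\<dots> = a *s v + (\<Sum>k\<le>degree p. coeff p k *s ((*v) M ^^ k) (M *v v))"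
    unfolding sum.atMost_Suc_shift by (simp add: funpow_swap1)
  finally show ?thesis by (simp add: poly_apply_def)
qed

lemma power_apply_diff_scale:
  fixes M :: "complex^'n^'n"
  shows "((*v) M ^^ k) (u - c *s v) = ((*v) M ^^ k) u - c *s ((*v) M ^^ k) (v :: complex^'n)"
  by (induction k) (simp_all add: matrix_vector_mult_diff_distrib vector_scalar_commute)

lemma poly_apply_diff_scale:
  "poly_apply M p (u - c *s v) = poly_apply M p u - c *s poly_apply M p v"
  by (simp add: poly_apply_def power_apply_diff_scale vec.scale_right_diff_distrib sum_subtractf
      vec.scale_sum_right vector_smult_assoc mult.commute)

lemma poly_apply_linear_factor:
  "poly_apply M ([:- l, 1:] * p) v = poly_apply M p (M *v v - l *s v)"
proof -
  have "[:- l, 1:] * p = pCons 0 p - smult l p"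
    by simp
  then show ?thesis
    by (simp only: poly_apply_diff poly_apply_smult poly_apply_pCons poly_apply_diff_scale) simp
qed

lemma poly_apply_commute: "M *v poly_apply M p v = poly_apply M p (M *v v)"
  by (simp add: poly_apply_def vec.linear_sum[OF matrix_vector_mul_linear_gen] vector_scalar_commute funpow_swap1)

text \<open>Splitting off linear factors one by one, a root \<open>l\<close> on the imaginary axis may be
  discarded, since \<open>M - l\<close> is injective on \<open>W\<close>; any other root is kept and the
  argument continues on the image of \<open>M - l\<close>.\<close>

lemma roots_annihilating_subspace:
  assumes "p \<noteq> 0" "\<And>v. v \<in> W \<Longrightarrow> poly_apply M p v = 0"
    and "vec.subspace W" "\<And>v. v \<in> W \<Longrightarrow> M *v v \<in> W"
    and "\<And>l v. v \<in> W \<Longrightarrow> Re l = 0 \<Longrightarrow> M *v v = l *s v \<Longrightarrow> v = 0"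
  shows "\<exists>ls. (\<forall>l\<in>set ls. Re l \<noteq> 0) \<and> (\<forall>v\<in>W. roots_apply M ls v = 0)"
  using assms
proof (induction "degree p" arbitrary: p W)
  case 0
  then obtain a where a: "p = [:a:]" by (metis degree_eq_zeroE)
  have "v = 0" if "v \<in> W" for v
    using 0(3)[OF that] 0(2) by (simp add: a poly_apply_def)
  then show ?case by (intro exI[of _ "[]"]) simp
next
  case (Suc d)
  note sub = Suc.prems(3) and inv = Suc.prems(4) and inj = Suc.prems(5)
  have shift: "M *v v - l *s v \<in> W" if "v \<in> W" for v l
    using that by (intro vec.subspace_diff[OF sub] vec.subspace_scale[OF sub] inv)
  have "\<not> constant (poly p)"
    using Suc.hyps(2) by (simp add: constant_degree)
  then obtain l where "poly p l = 0"
    using fundamental_theorem_of_algebra by blast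
  then obtain q where q: "p = [:- l, 1:] * q"
    using poly_eq_0_iff_dvd by (metis dvdE)
  have q0: "q \<noteq> 0" using q Suc.prems(1) by auto
  then have dq: "d = degree q"
    using Suc.hyps(2) degree_mult_eq[of "[:- l, 1:]" q] by (simp add: q del: mult_pCons_left)
  have ann: "poly_apply M q (M *v v - l *s v) = 0" if "v \<in> W" for v
    using Suc.prems(2)[OF that] by (simp add: q poly_apply_linear_factor del: mult_pCons_left)
  show ?case
  proof (cases "Re l = 0")
    case True
    have "poly_apply M q v = 0" if v: "v \<in> W" for v
    proof (rule inj[OF _ True])
      have pw: "((*v) M ^^ k) v \<in> W" for k
        by (induction k) (auto intro: v inv)
      show "poly_apply M q v \<in> W"
        unfolding poly_apply_def by (intro vec.subspace_sum[OF sub] vec.subspace_scale[OF sub] pw)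
      show "M *v poly_apply M q v = l *s poly_apply M q v"
        using ann[OF v] by (simp add: poly_apply_diff_scale poly_apply_commute)
    qed
    then show ?thesis
      by (intro Suc.hyps(1)[OF dq q0 _ sub]) (use inv inj in auto)
  next
    case False
    let ?W = "(\<lambda>v. M *v v - l *s v) ` W"
    have "\<exists>ls. (\<forall>l\<in>set ls. Re l \<noteq> 0) \<and> (\<forall>v\<in>?W. roots_apply M ls v = 0)"
    proof (rule Suc.hyps(1)[OF dq q0])
      show "vec.subspace ?W"
        unfolding vec.subspace_def
      proof (intro conjI ballI allI)
        show "0 \<in> ?W"
          using vec.subspace_0[OF sub] by (intro image_eqI[of _ _ 0]) auto
        show "x + y \<in> ?W" if "x \<in> ?W" "y \<in> ?W" for x y
        proof -
          from that obtain u v where uv: "u \<in> W" "v \<in> W" "x = M *v u - l *s u" "y = M *v v - l *s v" by blast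
          then show ?thesis
            by (intro image_eqI[of _ _ "u + v"] vec.subspace_add[OF sub])
              (auto simp: matrix_vector_right_distrib vec.scale_right_distrib)
        qed
        show "c *s x \<in> ?W" if "x \<in> ?W" for c x
        proof -
          from that obtain u where u: "u \<in> W" "x = M *v u - l *s u" by blast
          then show ?thesis
            by (intro image_eqI[of _ _ "c *s u"] vec.subspace_scale[OF sub])
              (auto simp: vector_scalar_commute vec.scale_right_diff_distrib vector_smult_assoc mult.commute)
        qed
      qed
      show "M *v v \<in> ?W" if v: "v \<in> ?W" for v
      proof -
        from that obtain u where u: "u \<in> W" "v = M *v u - l *s u" by blast
        then show ?thesis
          by (intro image_eqI[of _ _ "M *v u"] inv) (simp_all add: matrix_vector_mult_diff_distrib vector_scalar_commute)
      qed
      have "?W \<subseteq> W" using shift by blast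
      then show "v = 0" if "v \<in> ?W" "Re k = 0" "M *v v = k *s v" for k v
        using inj[of v k] that by blast
    qed (use ann in auto)
    then obtain ls where "\<forall>l\<in>set ls. Re l \<noteq> 0" "\<forall>v\<in>W. roots_apply M ls (M *v v - l *s v) = 0" by auto
    then show ?thesis
      using False by (intro exI[of _ "l # ls"]) auto
  qed
qed

definition cvec :: "real^'n \<Rightarrow> complex^'n" where "cvec v = (\<chi> i. complex_of_real (v $ i))"
definition re_vec :: "complex^'n \<Rightarrow> real^'n" where "re_vec w = (\<chi> i. Re (w $ i))"
definition im_vec :: "complex^'n \<Rightarrow> real^'n" where "im_vec w = (\<chi> i. Im (w $ i))"

lemma linear_cvec: "linear cvec"
  by (rule linearI) (auto simp: cvec_def vec_eq_iff complex_eq_iff)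

lemma linear_re_vec: "linear re_vec"
  by (rule linearI) (auto simp: re_vec_def vec_eq_iff)

lemma cvec_eq_0_iff: "cvec v = 0 \<longleftrightarrow> v = 0"
  by (simp add: cvec_def vec_eq_iff)

lemma re_vec_cvec: "re_vec (cvec v) = v"
  by (simp add: re_vec_def cvec_def vec_eq_iff)

lemma complex_vec_eq_0_iff: "w = 0 \<longleftrightarrow> re_vec w = 0 \<and> im_vec w = 0"
  by (auto simp: re_vec_def im_vec_def vec_eq_iff complex_eq_iff)

lemma complexify_apply:
  shows "complexify A *v cvec v = cvec (A *v v)"
    and "re_vec (complexify A *v w) = A *v re_vec w"
    and "im_vec (complexify A *v w) = A *v im_vec w"
  by (auto simp: complexify_def map_matrix_def cvec_def re_vec_def im_vec_def vec_eq_iff matrix_vector_mult_def)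

text \<open>More powers of the matrix than the dimension of the matrix space are linearly dependent. The
  coefficients of a relation between them are those of the polynomial.\<close>

lemma matrix_annihilating_polynomial:
  fixes A :: "real^'n^'n"
  obtains p where "p \<noteq> 0" "\<And>v. poly_apply (complexify A) p v = 0"
proof -
  let ?N = "DIM(real^'n^'n)"
  define B where "B k = ((**) A ^^ k) (mat 1)" for k
  have Bv: "((*v) (complexify A) ^^ k) v = complexify (B k) *v v" for k v
  proof (induction k)
    case 0
    have "complexify (mat 1 :: real^'n^'n) = mat 1"
      by (simp add: complexify_def map_matrix_def mat_def vec_eq_iff)
    then show ?case by (simp add: B_def)
  next
    case (Suc k)
    have "complexify (A ** C) = complexify A ** complexify C" for C :: "real^'n^'n"
      by (simp add: complexify_def map_matrix_def matrix_matrix_mult_def vec_eq_iff)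
    then show ?case by (simp add: Suc B_def matrix_vector_mul_assoc)
  qed
  have "\<exists>c. (\<exists>k\<le>?N. c k \<noteq> 0) \<and> (\<Sum>k\<le>?N. c k *\<^sub>R B k) = 0"
  proof (cases "inj_on B {..?N}")
    case True
    then have "card (B ` {..?N}) = ?N + 1" by (simp add: card_image)
    then have "dependent (B ` {..?N})"
      using independent_bound[of "B ` {..?N}"] by (metis add.commute not_less_eq_eq plus_1_eq_Suc le_refl)
    then obtain u v where u: "v \<in> B ` {..?N}" "u v \<noteq> 0" "(\<Sum>v\<in>B ` {..?N}. u v *\<^sub>R v) = 0"
      by (auto simp: dependent_finite)
    have "(\<Sum>k\<le>?N. (u \<circ> B) k *\<^sub>R B k) = (\<Sum>v\<in>B ` {..?N}. u v *\<^sub>R v)"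
      by (subst sum.reindex[OF True]) simp
    with u show ?thesis
      by (intro exI[of _ "u \<circ> B"]) auto
  next
    case False
    then obtain i j where ij: "i \<le> ?N" "j \<le> ?N" "i \<noteq> j" "B i = B j"
      by (auto simp: inj_on_def)
    let ?c = "\<lambda>k. (if k = i then 1 else 0) - (if k = j then 1 else 0 :: real)"
    have "(\<Sum>k\<le>?N. ?c k *\<^sub>R B k) = 0"
      using ij by (simp add: scaleR_diff_left sum_subtractf if_distrib[of "\<lambda>c. c *\<^sub>R _"] cong: if_cong)
    then show ?thesis
      using ij by (intro exI[of _ ?c]) auto
  qed
  then obtain c where c: "\<exists>k\<le>?N. c k \<noteq> 0" "(\<Sum>k\<le>?N. c k *\<^sub>R B k) = 0" by blast
  define p where "p = (\<Sum>k\<le>?N. monom (complex_of_real (c k)) k)"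
  have co: "coeff p k = (if k \<le> ?N then complex_of_real (c k) else 0)" for k
    by (simp add: p_def coeff_sum)
  have "degree p \<le> ?N"
    by (rule degree_le) (simp add: co)
  then have "poly_apply (complexify A) p v = (\<Sum>k\<le>?N. complex_of_real (c k) *s (complexify (B k) *v v))" for v
    by (simp add: poly_apply_le[of p ?N] co Bv)
  also have "\<dots> v = complexify (\<Sum>k\<le>?N. c k *\<^sub>R B k) *v v" for v
    by (simp add: vec_eq_iff matrix_vector_mult_def complexify_def map_matrix_def sum_distrib_left
        sum_distrib_right mult.assoc sum.swap[of _ "UNIV :: 'n set"])
  also have "complexify (\<Sum>k\<le>?N. c k *\<^sub>R B k) *v v = 0" for v
    unfolding c(2) by (simp add: complexify_def map_matrix_def vec_eq_iff matrix_vector_mult_def)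
  finally have "poly_apply (complexify A) p v = 0" for v .
  moreover have "p \<noteq> 0"
    using c(1) co by (metis coeff_0 of_real_eq_0_iff)
  ultimately show thesis using that by blast
qed

lemma complexify_squared_eq_0:
  "complexify A *v (complexify A *v w) = 0 \<longleftrightarrow>
     A *v (A *v re_vec w) = 0 \<and> A *v (A *v im_vec w) = 0"
  by (simp add: complex_vec_eq_0_iff[of "complexify A *v _"] complexify_apply)

text \<open>Zero is the only eigenvalue on the imaginary axis, and its generalised eigenspace is already
  reached by the second power.\<close>

lemma center_subspace_eq:
  fixes A :: "real^'n^'n"
  assumes spec: "\<And>l. is_eigenvalue (complexify A) l \<Longrightarrow> l \<noteq> 0 \<Longrightarrow> Re l \<noteq> 0"
    and stab: "\<And>v. A *v (A *v (A *v v)) = 0 \<Longrightarrow> A *v (A *v v) = 0"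
  shows "center_subspace A = {v. A *v (A *v v) = 0}"
proof -
  let ?M = "complexify A"
  let ?Z = "{w. ?M *v (?M *v w) = 0}"
  have stab': "?M *v (?M *v w) = 0" if "?M *v (?M *v (?M *v w)) = 0" for w
    using that stab unfolding complexify_squared_eq_0
    by (simp add: complex_vec_eq_0_iff[of "?M *v (?M *v (?M *v w))"] complexify_apply)
  have "gen_eigenspace ?M l \<subseteq> ?Z" if l: "Re l = 0" for l
  proof
    fix v assume "v \<in> gen_eigenspace ?M l"
    then obtain k where k: "((*v) (?M - mat l) ^^ k) v = 0" by (auto simp: gen_eigenspace_def)
    show "v \<in> ?Z"
    proof (cases "l = 0")
      case True
      have "?M - mat l = ?M" by (simp add: True mat_def vec_eq_iff)
      then have "((*v) ?M ^^ k) v = 0" using k by simp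
      then show ?thesis
      proof (induction k arbitrary: v)
        case (Suc k)
        then have "?M *v v \<in> ?Z" by (simp add: funpow_swap1)
        then show ?case using stab' by simp
      qed simp
    next
      case False
      have inj: "v = 0" if "(?M - mat l) *v v = 0" for v
      proof -
        have "?M *v v = l *s v"
          using that by (simp add: matrix_vector_mult_diff_rdistrib mat_apply)
        then show ?thesis
          using spec[of l] False l unfolding is_eigenvalue_def by blast
      qed
      from k have "v = 0"
        by (induction k) (auto dest: inj)
      then show ?thesis by simp
    qed
  qed
  moreover have "?Z \<subseteq> gen_eigenspace ?M 0"
  proof
    fix v assume "v \<in> ?Z"
    moreover have "?M - mat 0 = ?M" by (simp add: mat_def vec_eq_iff)
    ultimately have "((*v) (?M - mat 0) ^^ 2) v = 0" by (simp add: numeral_2_eq_2)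
    then show "v \<in> gen_eigenspace ?M 0" unfolding gen_eigenspace_def by blast
  qed
  ultimately have U: "(\<Union>l\<in>{l. Re l = 0}. gen_eigenspace ?M l) = ?Z"
    by (intro equalityI UN_least) (auto intro!: exI[of _ 0] simp: subset_iff)
  have sub: "vec.subspace ?Z"
    by (auto simp: vec.subspace_def matrix_vector_right_distrib vector_scalar_commute)
  have "center_subspace A = {v. cvec v \<in> ?Z}"
    unfolding center_subspace_def cvec_def U vec.span_eq_iff[THEN iffD2, OF sub] ..
  then show ?thesis
    by (simp add: complexify_apply cvec_eq_0_iff)
qed

text \<open>On the image of \<open>A\<^sup>2\<close> no eigenvalue is left on the imaginary axis: a vector
  there that \<open>A\<close> annihilates is zero because \<open>ker A\<^sup>3 = ker
  A\<^sup>2\<close>.\<close>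

lemma hyperbolic_roots_exist:
  fixes A :: "real^'n^'n"
  assumes spec: "\<And>l. is_eigenvalue (complexify A) l \<Longrightarrow> l \<noteq> 0 \<Longrightarrow> Re l \<noteq> 0"
    and stab: "\<And>v. A *v (A *v (A *v v)) = 0 \<Longrightarrow> A *v (A *v v) = 0"
  obtains ls where "\<And>l. l \<in> set ls \<Longrightarrow> Re l \<noteq> 0" "\<And>v. roots_apply (complexify A) ls (cvec (A *v (A *v v))) = 0"
proof -
  let ?M = "complexify A"
  let ?W = "range (\<lambda>w. ?M *v (?M *v w))"
  obtain p where p: "p \<noteq> 0" "\<And>v. poly_apply ?M p v = 0"
    using matrix_annihilating_polynomial by blast
  have stab': "?M *v (?M *v w) = 0" if "?M *v (?M *v (?M *v w)) = 0" for w
    using that stab unfolding complexify_squared_eq_0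
    by (simp add: complex_vec_eq_0_iff[of "?M *v (?M *v (?M *v w))"] complexify_apply)
  have "\<exists>ls. (\<forall>l\<in>set ls. Re l \<noteq> 0) \<and> (\<forall>v\<in>?W. roots_apply ?M ls v = 0)"
  proof (rule roots_annihilating_subspace[OF p(1)])
    show "vec.subspace ?W"
      unfolding vec.subspace_def
    proof (intro conjI ballI allI)
      show "0 \<in> ?W" by (rule image_eqI[of _ _ 0]) auto
      show "x + y \<in> ?W" if "x \<in> ?W" "y \<in> ?W" for x y
        using that by (auto simp: matrix_vector_right_distrib[symmetric])
      show "c *s x \<in> ?W" if "x \<in> ?W" for c x
        using that by (auto simp: vector_scalar_commute[symmetric])
    qed
    show "v = 0" if v: "v \<in> ?W" and l: "Re l = 0" "?M *v v = l *s v" for l v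
    proof (cases "l = 0")
      case True
      obtain w where "v = ?M *v (?M *v w)" using v by blast
      then show ?thesis using stab'[of w] l True by simp
    next
      case False
      then show ?thesis using spec[of l] l unfolding is_eigenvalue_def by blast
    qed
  qed (use p in auto)
  then obtain ls where ls: "\<And>l. l \<in> set ls \<Longrightarrow> Re l \<noteq> 0" "\<And>v. v \<in> ?W \<Longrightarrow> roots_apply ?M ls v = 0"
    by blast
  show thesis
  proof (rule that[OF ls(1)])
    show "roots_apply ?M ls (cvec (A *v (A *v v))) = 0" for v
      by (rule ls(2)) (auto simp: complexify_apply[symmetric])
  qed
qed

text \<open>Since \<open>ker A\<^sup>3 = ker A\<^sup>2\<close>, the map \<open>A\<^sup>2\<close> is injective
  on its own image, hence bijective there, and the space is the direct sum of \<open>ker A\<^sup>2\<close> and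
  the image of \<open>A\<^sup>2\<close>. The components along \<open>p, q\<close> are well defined and linear
  because the decomposition is unique.\<close>

lemma center_projection_exists:
  fixes A :: "real^'n^'n"
  assumes p: "A *v p = 0" and q: "A *v q = p"
    and ker: "\<And>v. A *v (A *v v) = 0 \<Longrightarrow> \<exists>s t. v = s *s p + t *s q"
    and p0: "p \<noteq> 0"
    and stab: "\<And>v. A *v (A *v (A *v v)) = 0 \<Longrightarrow> A *v (A *v v) = 0"
  obtains \<pi> :: "real^'n \<Rightarrow> real^2" where "linear \<pi>" "\<pi> p = axis 1 1" "\<pi> q = axis 2 1"
    "\<And>v. \<pi> (A *v (A *v v)) = 0"
    "\<And>v. \<exists>w. v = \<pi> v $ 1 *\<^sub>R p + \<pi> v $ 2 *\<^sub>R q + A *v (A *v w)"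
proof -
  let ?f = "\<lambda>v. A *v (A *v v)"
  let ?W = "range ?f"
  let ?\<iota> = "\<lambda>c::real^2. c $ 1 *\<^sub>R p + c $ 2 *\<^sub>R q"
  have lin: "linear ?f"
    using linear_compose[OF matrix_vector_mul_linear[of A] matrix_vector_mul_linear[of A]] by (simp add: o_def)
  have subW: "subspace ?W" by (rule linear_subspace_image[OF lin subspace_UNIV])
  have f\<iota>: "?f (?\<iota> c) = 0" for c
    by (simp add: matrix_vector_right_distrib p q flip: scalar_mult_eq_scaleR add: vector_scalar_commute)
  have ker_W: "?f v = 0" if "?f (?f v) = 0" for v
    using stab[OF stab[OF that]] .
  have "inj_on ?f ?W"
  proof (rule inj_onI)
    fix x y assume "x \<in> ?W" "y \<in> ?W" and xy: "?f x = ?f y"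
    then obtain u v where uv: "x = ?f u" "y = ?f v" by blast
    have "?f (?f (u - v)) = 0" using xy uv by (simp add: matrix_vector_mult_diff_distrib)
    from ker_W[OF this] show "x = y" using uv by (simp add: matrix_vector_mult_diff_distrib)
  qed
  then have "dim (?f ` ?W) = dim ?W"
    using subW by (intro dim_image_eq[OF lin]) (simp add: span_eq_iff[THEN iffD2])
  then have W_eq: "?f ` ?W = ?W"
    using subW linear_subspace_image[OF lin subW] by (intro subspace_dim_equal) auto
  have ex: "\<exists>c w. v = ?\<iota> c + ?f w" for v
  proof -
    obtain w where w: "?f v = ?f (?f w)" using W_eq by blast
    then have "?f (v - ?f w) = 0" by (simp add: matrix_vector_mult_diff_distrib)
    then obtain s t where "v - ?f w = s *s p + t *s q" using ker by blast
    then have "v = ?\<iota> (vector [s, t]) + ?f w" by (simp add: scalar_mult_eq_scaleR algebra_simps)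
    then show ?thesis by blast
  qed
  have uniq: "c = c'" if "?\<iota> c + ?f w = ?\<iota> c' + ?f w'" for c c' w w'
  proof -
    have "?f (?\<iota> c + ?f w) = ?f (?\<iota> c' + ?f w')" using that by simp
    then have "?f (?f (w - w')) = 0"
      using f\<iota>[of c] f\<iota>[of c'] by (simp add: matrix_vector_right_distrib matrix_vector_mult_diff_distrib)
    from ker_W[OF this] have ee: "?\<iota> c = ?\<iota> c'"
      using that by (simp add: matrix_vector_mult_diff_distrib)
    then have "A *v ?\<iota> c = A *v ?\<iota> c'" by simp
    then have "c $ 2 *\<^sub>R p = c' $ 2 *\<^sub>R p"
      by (simp add: matrix_vector_right_distrib p q flip: scalar_mult_eq_scaleR add: vector_scalar_commute)
    then have "c $ 2 = c' $ 2" using p0 by simp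
    moreover from ee this have "c $ 1 *\<^sub>R p = c' $ 1 *\<^sub>R p" by simp
    then have "c $ 1 = c' $ 1" using p0 by simp
    ultimately show ?thesis by (simp add: vec_eq_iff forall_2)
  qed
  define \<pi> where "\<pi> v = (SOME c. \<exists>w. v = ?\<iota> c + ?f w)" for v
  have \<pi>: "\<exists>w. v = ?\<iota> (\<pi> v) + ?f w" for v
    unfolding \<pi>_def by (rule someI_ex[OF ex])
  have \<pi>_eq: "\<pi> v = c" if "v = ?\<iota> c + ?f w" for v c w
    using \<pi>[of v] that uniq by metis
  show thesis
  proof (rule that)
    show "linear \<pi>"
    proof (rule linearI)
      fix u v
      obtain w w' where w: "u = ?\<iota> (\<pi> u) + ?f w" "v = ?\<iota> (\<pi> v) + ?f w'" using \<pi> by metis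
      have "?\<iota> (\<pi> u) + ?f w + (?\<iota> (\<pi> v) + ?f w') = ?\<iota> (\<pi> u + \<pi> v) + ?f (w + w')"
        by (simp add: matrix_vector_right_distrib algebra_simps)
      then have "u + v = ?\<iota> (\<pi> u + \<pi> v) + ?f (w + w')" using w by simp
      then show "\<pi> (u + v) = \<pi> u + \<pi> v" by (rule \<pi>_eq)
    next
      fix r v
      obtain w where w: "v = ?\<iota> (\<pi> v) + ?f w" using \<pi> by metis
      have "r *\<^sub>R (?\<iota> (\<pi> v) + ?f w) = ?\<iota> (r *\<^sub>R \<pi> v) + ?f (r *\<^sub>R w)"
        by (simp add: scaleR_add_right linear_cmul[OF lin])
      then have "r *\<^sub>R v = ?\<iota> (r *\<^sub>R \<pi> v) + ?f (r *\<^sub>R w)" using w by simp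
      then show "\<pi> (r *\<^sub>R v) = r *\<^sub>R \<pi> v" by (rule \<pi>_eq)
    qed
    show "\<pi> p = axis 1 1" "\<pi> q = axis 2 1"
      by (rule \<pi>_eq[of _ _ 0], simp add: axis_def)+
    show "\<pi> (?f v) = 0" for v by (rule \<pi>_eq[of _ _ v]) simp
    show "\<exists>w. v = \<pi> v $ 1 *\<^sub>R p + \<pi> v $ 2 *\<^sub>R q + ?f w" for v by (rule \<pi>)
  qed
qed

section \<open>The linear part on center and hyperbolic components\<close>

text \<open>The output of the linear algebra: coordinates \<open>\<pi>\<close> of the center component with
  respect to \<open>p, q\<close>, a complement equal to the image of \<open>A\<^sup>2\<close>, and hyperbolic
  roots that annihilate the complement.\<close>

locale center_splitting =
  fixes A :: "real^'n^'n" and p q :: "real^'n" and \<pi> :: "real^'n \<Rightarrow> real^2" and ls :: "complex list"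
  assumes Ap: "A *v p = 0" and Aq: "A *v q = p" and \<pi>_linear: "linear \<pi>"
    and \<pi>_p: "\<pi> p = axis 1 1" and \<pi>_q: "\<pi> q = axis 2 1"
    and \<pi>_range: "\<And>v. \<pi> (A *v (A *v v)) = 0"
    and complement: "\<And>v. \<exists>w. v = \<pi> v $ 1 *\<^sub>R p + \<pi> v $ 2 *\<^sub>R q + A *v (A *v w)"
    and roots_hyperbolic: "\<And>l. l \<in> set ls \<Longrightarrow> Re l \<noteq> 0"
    and roots_annihilate: "\<And>v. roots_apply (complexify A) ls (cvec (A *v (A *v v))) = 0"
begin

definition center_incl :: "real^2 \<Rightarrow> real^'n" where "center_incl c = c $ 1 *\<^sub>R p + c $ 2 *\<^sub>R q"
definition hyp_part :: "real^'n \<Rightarrow> real^'n" where "hyp_part v = v - center_incl (\<pi> v)"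

lemma center_incl_linear: "linear center_incl"
  by (rule linearI) (auto simp: center_incl_def algebra_simps)

lemma \<pi>_center_incl: "\<pi> (center_incl c) = c"
  by (simp add: center_incl_def linear_add[OF \<pi>_linear] linear_cmul[OF \<pi>_linear] \<pi>_p \<pi>_q vec_eq_iff forall_2 axis_def)

lemma A_linear: "linear ((*v) A)"
  by (rule matrix_vector_mul_linear)

lemma A_center_incl: "A *v center_incl c = c $ 2 *\<^sub>R p"
  by (simp add: center_incl_def linear_add[OF A_linear] linear_cmul[OF A_linear] Ap Aq)

lemma hyp_in_range: "\<exists>w. hyp_part v = A *v (A *v w)"
  using complement[of v] by (metis add_diff_cancel_left' center_incl_def hyp_part_def)

lemma hyp_linear: "linear hyp_part"
  unfolding hyp_part_def[abs_def]
  by (intro linear_compose_sub linear_id[unfolded id_def] linear_compose[OF \<pi>_linear center_incl_linear, unfolded o_def])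

lemma \<pi>_hyp: "\<pi> (hyp_part v) = 0"
  using hyp_in_range \<pi>_range by metis

lemma hyp_eq_self: "\<pi> v = 0 \<Longrightarrow> hyp_part v = v"
  by (simp add: hyp_part_def linear_0[OF center_incl_linear])

lemma hyp_hyp: "hyp_part (hyp_part v) = hyp_part v"
  by (rule hyp_eq_self[OF \<pi>_hyp])

lemma roots_annihilate_hyp: "roots_apply (complexify A) ls (cvec (hyp_part v)) = 0"
  using hyp_in_range roots_annihilate by metis

lemma decompose: "v = center_incl (\<pi> v) + hyp_part v"
  by (simp add: hyp_part_def)

lemma \<pi>_A: "\<pi> (A *v v) = \<pi> v $ 2 *\<^sub>R axis 1 1"
proof -
  obtain w where w: "hyp_part v = A *v (A *v w)" using hyp_in_range by blast
  have "A *v v = A *v center_incl (\<pi> v) + A *v (A *v (A *v w))"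
    by (subst decompose) (simp add: linear_add[OF A_linear] w)
  then show ?thesis
    by (simp add: A_center_incl linear_add[OF \<pi>_linear] linear_cmul[OF \<pi>_linear] \<pi>_range \<pi>_p)
qed

lemma hyp_A: "hyp_part (A *v v) = A *v hyp_part v"
proof -
  have "center_incl (\<pi> (A *v v)) = A *v center_incl (\<pi> v)"
    by (simp add: \<pi>_A A_center_incl) (simp add: center_incl_def axis_def)
  then show ?thesis by (simp add: hyp_part_def linear_diff[OF A_linear])
qed

text \<open>The number 1 keeps the set nonempty when there are no further roots. The rate is chosen such that
  \<open>3 * rate\<close>, the largest exponent in use, is half the gap.\<close>

definition gap :: real where "gap = Min (insert 1 ((\<lambda>l. \<bar>Re l\<bar>) ` set ls))"
definition rate :: real where "rate = gap / 6"

lemma gap_pos: "0 < gap"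
  unfolding gap_def using roots_hyperbolic by (subst Min_gr_iff) auto

lemma gap_le: "l \<in> set ls \<Longrightarrow> gap \<le> \<bar>Re l\<bar>"
  unfolding gap_def by (rule Min_le) auto

lemma rate_pos: "0 < rate"
  using gap_pos by (simp add: rate_def)

text \<open>The normalisation at time zero removes the slowly growing solutions of the homogeneous equation,
  all of which lie in the center component.\<close>

definition bounded_solution :: "(real \<Rightarrow> real^'n) \<Rightarrow> (real \<Rightarrow> real^'n) \<Rightarrow> bool" where
  "bounded_solution w z \<longleftrightarrow> (\<forall>t. (z has_vector_derivative A *v z t + w t) (at t)) \<and> \<pi> (z 0) = 0 \<and>
     (\<exists>C. growth (3 * rate) C z)"

text \<open>The center component of a difference satisfies \<open>a' = b, b' = 0\<close> with zero initial
  values; what remains is hyperbolic and vanishes by its growth.\<close>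

lemma bounded_solution_unique:
  assumes "bounded_solution w z" "bounded_solution w z'"
  shows "z = z'"
proof -
  obtain C C' where C: "growth (3 * rate) C z" "growth (3 * rate) C' z'"
    using assms unfolding bounded_solution_def by blast
  define r where "r t = z t - z' t" for t
  have rg: "growth (3 * rate) (C + C') r"
    unfolding r_def by (rule growth_diff[OF C])
  have rd: "(r has_vector_derivative A *v r t) (at t)" for t
    using assms unfolding bounded_solution_def r_def
    by (auto intro!: derivative_eq_intros simp: linear_diff[OF A_linear])
  have r0: "\<pi> (r 0) = 0"
    using assms by (simp add: bounded_solution_def r_def linear_diff[OF \<pi>_linear])
  have pd: "((\<lambda>t. \<pi> (r t)) has_vector_derivative \<pi> (r t) $ 2 *\<^sub>R axis 1 1) (at t)" for t
    using linear_has_vector_derivative[OF \<pi>_linear rd] by (simp add: \<pi>_A)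
  have "((\<lambda>t. \<pi> (r t) $ 2) has_vector_derivative 0) (at t)" for t
    using bounded_linear.has_vector_derivative[OF bounded_linear_vec_nth pd, of 2] by (simp add: axis_def)
  then have "\<pi> (r t) $ 2 = \<pi> (r 0) $ 2" for t
    using has_vector_derivative_zero_constant[of UNIV "\<lambda>t. \<pi> (r t) $ 2"] by (metis UNIV_I convex_UNIV)
  then have "((\<lambda>t. \<pi> (r t)) has_vector_derivative 0) (at t)" for t
    using pd[of t] by (simp add: r0)
  then have "\<pi> (r t) = \<pi> (r 0)" for t
    using has_vector_derivative_zero_constant[of UNIV "\<lambda>t. \<pi> (r t)"] by (metis UNIV_I convex_UNIV)
  then have hr: "hyp_part (r t) = r t" for t
    by (simp add: hyp_eq_self r0)
  obtain k where "growth (3 * rate) (k * (C + C')) (\<lambda>t. cvec (r t))"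
    using growth_linear[OF linear_cvec] rg by metis
  then have "cvec (r t) = 0" for t
  proof (rule hyperbolic_homogeneous_zero)
    show "3 * rate < \<bar>Re l\<bar>" if "l \<in> set ls" for l
      using gap_le[OF that] gap_pos by (simp add: rate_def)
    show "((\<lambda>t. cvec (r t)) has_vector_derivative complexify A *v cvec (r t)) (at t)" for t
      using linear_has_vector_derivative[OF linear_cvec rd] by (simp add: complexify_apply)
    show "roots_apply (complexify A) ls (cvec (r t)) = 0" for t
      using roots_annihilate_hyp[of "r t"] by (simp add: hr)
  qed
  then show ?thesis by (simp add: cvec_eq_0_iff r_def fun_eq_iff)
qed

text \<open>On the center component the equation reads \<open>Y1' = Y2 + w1, Y2' = w2\<close> and is solved by
  integrating twice from zero, at the price of a factor \<open>1 / rate\<close> each time.\<close>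

lemma center_solution_exists:
  "\<exists>N\<ge>0. \<forall>\<theta> c w. rate \<le> \<theta> \<longrightarrow> growth \<theta> c w \<longrightarrow>
     (\<exists>z. (\<forall>t. (z has_vector_derivative A *v z t + center_incl (\<pi> (w t))) (at t)) \<and> z 0 = 0 \<and> growth \<theta> (N * c) z)"
proof -
  obtain k where k: "0 \<le> k" "\<And>\<theta> c w. growth \<theta> c w \<Longrightarrow> growth \<theta> (k * c) (\<lambda>t. \<pi> (w t))"
    using growth_linear[OF \<pi>_linear] by metis
  obtain kp where kp: "0 \<le> kp" "\<And>\<theta> c w. growth \<theta> c w \<Longrightarrow> growth \<theta> (kp * c) (\<lambda>t. w t *\<^sub>R p)"
    using growth_linear[OF linear_scale_left, of p] by (metis linear_scale_left)
  obtain kq where kq: "0 \<le> kq" "\<And>\<theta> c w. growth \<theta> c w \<Longrightarrow> growth \<theta> (kq * c) (\<lambda>t. w t *\<^sub>R q)"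
    using growth_linear[OF linear_scale_left, of q] by (metis linear_scale_left)
  have antiderivative: "\<exists>W. W 0 = 0 \<and> (\<forall>t. (W has_vector_derivative w t) (at t)) \<and> growth \<theta> (c / rate) W"
    if th: "rate \<le> \<theta>" and w: "growth \<theta> c w" for \<theta> c and w :: "real \<Rightarrow> real"
  proof -
    obtain W where W: "W 0 = 0" "\<And>t. (W has_vector_derivative w t) (at t)"
      using antiderivative_exists[OF growth_cont[OF w]] by blast
    have g: "growth \<theta> (c / \<theta>) W"
      using th rate_pos by (intro antiderivative_growth[OF w _ W]) auto
    have le: "c / \<theta> \<le> c / rate"
      using th rate_pos growth_nonneg[OF w] by (intro divide_left_mono) auto
    have "growth \<theta> (c / rate) W"
      by (rule growth_mono[OF g order_refl le])
    with W show ?thesis by blast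
  qed
  define N where "N = kp * ((k + k / rate) / rate) + kq * (k / rate)"
  show ?thesis
  proof (intro exI[of _ N] conjI allI impI)
    show "0 \<le> N" using k(1) kp(1) kq(1) rate_pos by (simp add: N_def)
    fix \<theta> c and w :: "real \<Rightarrow> real^'n" assume th: "rate \<le> \<theta>" and w: "growth \<theta> c w"
    obtain Y2 where Y2: "Y2 0 = 0" "\<And>t. (Y2 has_vector_derivative \<pi> (w t) $ 2) (at t)" "growth \<theta> (k * c / rate) Y2"
      using antiderivative[OF th growth_component[OF k(2)[OF w], of 2]] by blast
    obtain Y1 where Y1: "Y1 0 = 0" "\<And>t. (Y1 has_vector_derivative \<pi> (w t) $ 1 + Y2 t) (at t)"
      "growth \<theta> ((k * c + k * c / rate) / rate) Y1"
      using antiderivative[OF th growth_add[OF growth_component[OF k(2)[OF w], of 1] Y2(3)]] by blast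
    show "\<exists>z. (\<forall>t. (z has_vector_derivative A *v z t + center_incl (\<pi> (w t))) (at t)) \<and> z 0 = 0 \<and> growth \<theta> (N * c) z"
    proof (intro exI[of _ "\<lambda>t. Y1 t *\<^sub>R p + Y2 t *\<^sub>R q"] conjI allI)
      fix t
      have "((\<lambda>t. Y1 t *\<^sub>R p + Y2 t *\<^sub>R q) has_vector_derivative
          (\<pi> (w t) $ 1 + Y2 t) *\<^sub>R p + \<pi> (w t) $ 2 *\<^sub>R q) (at t)"
        by (intro has_vector_derivative_add linear_has_vector_derivative[OF linear_scale_left] Y1 Y2)
      then show "((\<lambda>t. Y1 t *\<^sub>R p + Y2 t *\<^sub>R q) has_vector_derivative
          A *v (Y1 t *\<^sub>R p + Y2 t *\<^sub>R q) + center_incl (\<pi> (w t))) (at t)"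
        by (simp add: center_incl_def linear_add[OF A_linear] linear_cmul[OF A_linear] Ap Aq algebra_simps)
      show "growth \<theta> (N * c) (\<lambda>t. Y1 t *\<^sub>R p + Y2 t *\<^sub>R q)"
        using growth_add[OF kp(2)[OF Y1(3)] kq(2)[OF Y2(3)]] rate_pos
        by (simp add: N_def field_simps)
    qed (simp add: Y1 Y2)
  qed
qed

text \<open>The complex solution is projected back: taking real parts and then the hyperbolic component
  commutes with \<open>A\<close>.\<close>

lemma hyperbolic_solution_exists:
  "\<exists>N\<ge>0. \<forall>\<theta> c w. rate \<le> \<theta> \<longrightarrow> \<theta> \<le> 3 * rate \<longrightarrow> growth \<theta> c w \<longrightarrow>
     (\<exists>z. (\<forall>t. (z has_vector_derivative A *v z t + hyp_part (w t)) (at t)) \<and> (\<forall>t. \<pi> (z t) = 0) \<and> growth \<theta> (N * c) z)"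
proof -
  obtain k where k: "0 \<le> k" "\<And>\<theta> c w. growth \<theta> c w \<Longrightarrow> growth \<theta> (k * c) (\<lambda>t. (cvec \<circ> hyp_part) (w t))"
    using growth_linear[OF linear_compose[OF hyp_linear linear_cvec]] by metis
  obtain k' where k': "0 \<le> k'" "\<And>\<theta> c w. growth \<theta> c w \<Longrightarrow> growth \<theta> (k' * c) (\<lambda>t. (hyp_part \<circ> re_vec) (w t))"
    using growth_linear[OF linear_compose[OF linear_re_vec hyp_linear]] by metis
  obtain N where N: "0 \<le> N" "\<forall>\<theta> c w. 0 \<le> \<theta> \<longrightarrow> \<theta> \<le> gap / 2 \<longrightarrow> growth \<theta> c w \<longrightarrow> (\<forall>t. roots_apply (complexify A) ls (w t) = 0) \<longrightarrow>
    (\<exists>z. (\<forall>t. (z has_vector_derivative complexify A *v z t + w t) (at t)) \<and> growth \<theta> (N * c) z)"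
    using hyperbolic_resolvent[OF gap_pos gap_le, where M = "complexify A"] by metis
  show ?thesis
  proof (intro exI[of _ "k' * (N * k)"] conjI allI impI)
    fix \<theta> c and w :: "real \<Rightarrow> real^'n"
    assume th: "rate \<le> \<theta>" "\<theta> \<le> 3 * rate" and w: "growth \<theta> c w"
    have "0 \<le> \<theta>" "\<theta> \<le> gap / 2" using th rate_pos by (auto simp: rate_def)
    then obtain Z where Z: "\<And>t. (Z has_vector_derivative complexify A *v Z t + cvec (hyp_part (w t))) (at t)"
      "growth \<theta> (N * (k * c)) Z"
      using N(2)[rule_format, of \<theta> "k * c" "\<lambda>t. cvec (hyp_part (w t))"] k(2)[OF w] roots_annihilate_hyp by auto
    show "\<exists>z. (\<forall>t. (z has_vector_derivative A *v z t + hyp_part (w t)) (at t)) \<and> (\<forall>t. \<pi> (z t) = 0) \<and> growth \<theta> (k' * (N * k) * c) z"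
    proof (intro exI[of _ "\<lambda>t. hyp_part (re_vec (Z t))"] conjI allI)
      show "((\<lambda>t. hyp_part (re_vec (Z t))) has_vector_derivative A *v hyp_part (re_vec (Z t)) + hyp_part (w t)) (at t)" for t
        using linear_has_vector_derivative[OF hyp_linear linear_has_vector_derivative[OF linear_re_vec Z(1)], of t]
        by (simp add: linear_add[OF linear_re_vec] linear_add[OF hyp_linear] complexify_apply re_vec_cvec hyp_A hyp_hyp)
      show "growth \<theta> (k' * (N * k) * c) (\<lambda>t. hyp_part (re_vec (Z t)))"
        using k'(2)[OF Z(2)] by (simp add: mult.assoc)
    qed (rule \<pi>_hyp)
  qed (use N k k' in simp)
qed

lemma bounded_solution_exists:
  "\<exists>N\<ge>0. \<forall>\<theta> c w. rate \<le> \<theta> \<longrightarrow> \<theta> \<le> 3 * rate \<longrightarrow> growth \<theta> c w \<longrightarrow>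
     (\<exists>z. bounded_solution w z \<and> growth \<theta> (N * c) z)"
proof -
  obtain N1 where N1: "0 \<le> N1" "\<forall>\<theta> c w. rate \<le> \<theta> \<longrightarrow> growth \<theta> c w \<longrightarrow>
     (\<exists>z. (\<forall>t. (z has_vector_derivative A *v z t + center_incl (\<pi> (w t))) (at t)) \<and> z 0 = 0 \<and> growth \<theta> (N1 * c) z)"
    using center_solution_exists by (elim exE conjE)
  obtain N2 where N2: "0 \<le> N2" "\<forall>\<theta> c w. rate \<le> \<theta> \<longrightarrow> \<theta> \<le> 3 * rate \<longrightarrow> growth \<theta> c w \<longrightarrow>
     (\<exists>z. (\<forall>t. (z has_vector_derivative A *v z t + hyp_part (w t)) (at t)) \<and> (\<forall>t. \<pi> (z t) = 0) \<and> growth \<theta> (N2 * c) z)"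
    using hyperbolic_solution_exists by (elim exE conjE)
  show ?thesis
  proof (intro exI[of _ "N1 + N2"] conjI allI impI)
    fix \<theta> c and w :: "real \<Rightarrow> real^'n"
    assume th: "rate \<le> \<theta>" "\<theta> \<le> 3 * rate" and w: "growth \<theta> c w"
    obtain x where x: "\<And>t. (x has_vector_derivative A *v x t + center_incl (\<pi> (w t))) (at t)" "x 0 = 0" "growth \<theta> (N1 * c) x"
      using N1(2) th w by blast
    obtain y where y: "\<And>t. (y has_vector_derivative A *v y t + hyp_part (w t)) (at t)" "\<And>t. \<pi> (y t) = 0" "growth \<theta> (N2 * c) y"
      using N2(2) th w by blast
    let ?z = "\<lambda>t. x t + y t"
    have "(?z has_vector_derivative A *v ?z t + w t) (at t)" for t
      by (rule has_vector_derivative_eq_rhs[OF has_vector_derivative_add[OF x(1) y(1)]])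
        (simp add: linear_add[OF A_linear] hyp_part_def)
    moreover have "\<pi> (?z 0) = 0" by (simp add: x y)
    moreover have g: "growth \<theta> ((N1 + N2) * c) ?z"
      using growth_add[OF x(3) y(3)] by (simp add: distrib_right)
    moreover have "growth (3 * rate) ((N1 + N2) * c) ?z"
      by (rule growth_mono[OF g th(2) order_refl])
    ultimately show "\<exists>z. bounded_solution w z \<and> growth \<theta> ((N1 + N2) * c) z"
      unfolding bounded_solution_def by blast
  qed (use N1 N2 in simp)
qed

definition solver :: "(real \<Rightarrow> real^'n) \<Rightarrow> real \<Rightarrow> real^'n" where
  "solver w = (THE z. bounded_solution w z)"

lemma solver_eqI: "bounded_solution w z \<Longrightarrow> solver w = z"
  unfolding solver_def using bounded_solution_unique by blast

lemma solver_solution: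
  assumes "growth (3 * rate) c w"
  shows "bounded_solution w (solver w)"
proof -
  have "rate \<le> 3 * rate" using rate_pos by simp
  then obtain z where "bounded_solution w z"
    using bounded_solution_exists assms by blast
  then show ?thesis using solver_eqI by metis
qed

lemma solver_growth_operator:
  obtains N where "0 \<le> N" "\<And>\<delta>. 0 \<le> \<delta> \<Longrightarrow> N * \<delta> \<le> 1 / 2 \<Longrightarrow> growth_operator solver rate N \<delta>"
proof -
  obtain N where N: "0 \<le> N" "\<forall>\<theta> c w. rate \<le> \<theta> \<longrightarrow> \<theta> \<le> 3 * rate \<longrightarrow> growth \<theta> c w \<longrightarrow>
     (\<exists>z. bounded_solution w z \<and> growth \<theta> (N * c) z)"
    using bounded_solution_exists by (elim exE conjE)
  show thesis
  proof (rule that[OF N(1)])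
    fix \<delta> :: real assume \<delta>: "0 \<le> \<delta>" "N * \<delta> \<le> 1 / 2"
    show "growth_operator solver rate N \<delta>"
    proof
      show "growth \<theta> (N * c) (solver w)" if "rate \<le> \<theta>" "\<theta> \<le> 3 * rate" "growth \<theta> c w" for \<theta> c w
        using N(2) that solver_eqI by metis
      show "solver (\<lambda>t. v t + w t) = (\<lambda>t. solver v t + solver w t)"
        if "growth (3 * rate) c v" "growth (3 * rate) d w" for c d v w
      proof (rule solver_eqI)
        note s = solver_solution[OF that(1)] solver_solution[OF that(2)]
        then obtain C D where CD: "growth (3 * rate) C (solver v)" "growth (3 * rate) D (solver w)"
          unfolding bounded_solution_def by blast
        show "bounded_solution (\<lambda>t. v t + w t) (\<lambda>t. solver v t + solver w t)"
          using s growth_add[OF CD] unfolding bounded_solution_def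
          by (auto intro!: derivative_eq_intros simp: linear_add[OF A_linear] linear_add[OF \<pi>_linear])
      qed
      show "solver (\<lambda>t. r *\<^sub>R v t) = (\<lambda>t. r *\<^sub>R solver v t)"
        if "growth (3 * rate) c v" for c r v
      proof (rule solver_eqI)
        note s = solver_solution[OF that]
        then obtain C where C: "growth (3 * rate) C (solver v)"
          unfolding bounded_solution_def by blast
        show "bounded_solution (\<lambda>t. r *\<^sub>R v t) (\<lambda>t. r *\<^sub>R solver v t)"
          using s growth_scaleR[OF C] unfolding bounded_solution_def
          by (auto intro!: derivative_eq_intros simp: linear_cmul[OF A_linear] linear_cmul[OF \<pi>_linear] scaleR_add_right)
      qed
    qed (use \<delta> N rate_pos in auto)
  qed
qed

definition free_orbit :: "real^2 \<Rightarrow> real \<Rightarrow> real^'n" where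
  "free_orbit y t = center_incl y + t *\<^sub>R (A *v center_incl y)"

lemma free_orbit_add: "free_orbit (u + v) = (\<lambda>t. free_orbit u t + free_orbit v t)"
  by (simp add: free_orbit_def fun_eq_iff linear_add[OF center_incl_linear] linear_add[OF A_linear] algebra_simps)

lemma free_orbit_scaleR: "free_orbit (r *\<^sub>R u) = (\<lambda>t. r *\<^sub>R free_orbit u t)"
  by (simp add: free_orbit_def fun_eq_iff linear_cmul[OF center_incl_linear] linear_cmul[OF A_linear] algebra_simps)

lemma free_orbit_growth:
  obtains L where "0 \<le> L" "\<And>y. growth rate (L * norm y) (free_orbit y)"
proof -
  have "bounded_linear center_incl" using center_incl_linear by (simp add: linear_conv_bounded_linear)
  then obtain k where k: "0 \<le> k" "\<And>x. norm (center_incl x) \<le> norm x * k"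
    using bounded_linear.nonneg_bounded by blast
  show thesis
  proof (rule that[of "k + norm p / rate"])
    fix y
    show "growth rate ((k + norm p / rate) * norm y) (free_orbit y)"
    proof (rule growthI)
      fix t
      let ?E = "exp (rate * \<bar>t\<bar>)"
      have "1 + rate * \<bar>t\<bar> \<le> ?E" by (rule exp_ge_add_one_self)
      moreover have "0 \<le> rate * \<bar>t\<bar>" using rate_pos by simp
      ultimately have "1 \<le> ?E" "rate * \<bar>t\<bar> \<le> ?E" by linarith+
      then have E: "1 \<le> ?E" "\<bar>t\<bar> \<le> ?E / rate"
        using rate_pos by (simp_all add: pos_le_divide_eq mult.commute)
      have "norm (free_orbit y t) \<le> norm (center_incl y) + norm ((t * y $ 2) *\<^sub>R p)"
        unfolding free_orbit_def A_center_incl scaleR_scaleR by (rule norm_triangle_ineq)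
      also have "\<dots> \<le> norm y * k * ?E + ?E / rate * norm y * norm p"
      proof (rule add_mono)
        show "norm (center_incl y) \<le> norm y * k * ?E"
          using mult_mono[OF k(2)[of y] E(1)] k(1) by simp
        have "\<bar>t\<bar> * \<bar>y $ 2\<bar> \<le> ?E / rate * norm y"
          using E rate_pos component_le_norm_cart[of y 2] by (intro mult_mono) auto
        then show "norm ((t * y $ 2) *\<^sub>R p) \<le> ?E / rate * norm y * norm p"
          unfolding norm_scaleR abs_mult by (rule mult_right_mono) simp
      qed
      also have "\<dots> = (k + norm p / rate) * norm y * ?E"
        by (simp add: algebra_simps)
      finally show "norm (free_orbit y t) \<le> \<dots>" .
    qed (auto simp: free_orbit_def intro!: continuous_intros)
  qed (use k rate_pos in simp)
qed

lemma free_orbit_deriv: "(free_orbit y has_vector_derivative A *v free_orbit y t) (at t)"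
proof -
  have "A *v free_orbit y t = A *v center_incl y"
    by (simp add: free_orbit_def linear_add[OF A_linear] linear_cmul[OF A_linear] A_center_incl Ap)
  then show ?thesis
    unfolding free_orbit_def[abs_def] by (auto intro!: derivative_eq_intros)
qed

lemma free_orbit_0: "free_orbit y 0 = center_incl y"
  by (simp add: free_orbit_def)

end

section \<open>The invariant graph\<close>

text \<open>Gronwall's inequality for \<open>z \<bullet> z\<close>, forward and backward in time, on an
  interval that may or may not contain its end points.\<close>

lemma zero_of_linear_bound:
  fixes z :: "real \<Rightarrow> 'a::real_inner"
  assumes J: "is_interval J" and zd: "\<And>t. t \<in> J \<Longrightarrow> (z has_vector_derivative z' t) (at t within J)"
    and bd: "\<And>t. t \<in> J \<Longrightarrow> norm (z' t) \<le> L * norm (z t)"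
    and t0: "t0 \<in> J" "z t0 = 0" and t: "t \<in> J"
  shows "z t = 0"
proof -
  \<comment> \<open>The exponent \<open>s\<close> will be \<open>- 2 L\<close> after \<open>t0\<close> and \<open>2 L\<close> before it.\<close>
  define h where "h s u = (z u \<bullet> z u) * exp (s * u)" for s u :: real
  have zcont: "continuous_on J z"
    unfolding continuous_on_eq_continuous_within using has_vector_derivative_continuous[OF zd] by blast
  have hd: "\<exists>y. DERIV (h s) u :> y \<and> \<bar>y - s * h s u\<bar> \<le> 2 * L * h s u"
    if "a \<in> J" "b \<in> J" "a < u" "u < b" for s a b u
  proof -
    have sub: "{a<..<b} \<subseteq> J"
      using mem_is_interval_1_I[OF J that(1,2)] by auto
    have uJ: "u \<in> J" using sub that by auto
    have "at u within J = at u"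
      by (rule at_within_open_subset[of u "{a<..<b}"]) (use sub that in auto)
    then have "(z has_vector_derivative z' u) (at u)"
      using zd[OF uJ] by simp
    then have zz: "((\<lambda>u. z u \<bullet> z u) has_real_derivative 2 * (z u \<bullet> z' u)) (at u)"
      unfolding has_real_derivative_iff_has_vector_derivative
      by (auto intro!: has_vector_derivative_eq_rhs[OF bounded_bilinear.has_vector_derivative[OF bounded_bilinear_inner]]
          simp: inner_commute)
    have ee: "((\<lambda>u. exp (s * u)) has_real_derivative s * exp (s * u)) (at u)"
      by (rule derivative_eq_intros refl | simp)+
    have "\<bar>z u \<bullet> z' u\<bar> \<le> norm (z u) * norm (z' u)"
      by (rule Cauchy_Schwarz_ineq2)
    also have "\<dots> \<le> norm (z u) * (L * norm (z u))"
      by (intro mult_left_mono bd uJ) auto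
    also have "\<dots> = L * (z u \<bullet> z u)"
      by (simp add: dot_square_norm power2_eq_square)
    finally have "\<bar>2 * (z u \<bullet> z' u) * exp (s * u)\<bar> \<le> 2 * L * h s u"
      by (simp add: h_def abs_mult)
    moreover have "DERIV (h s) u :> 2 * (z u \<bullet> z' u) * exp (s * u) + s * h s u"
      unfolding h_def[abs_def] by (rule DERIV_cong[OF DERIV_mult[OF zz ee]]) (simp add: algebra_simps)
    ultimately show ?thesis by (intro exI[of _ "2 * (z u \<bullet> z' u) * exp (s * u) + s * h s u"]) simp
  qed
  have hcont: "continuous_on {a..b} (h s)" if "a \<in> J" "b \<in> J" for s a b
  proof -
    have "{a..b} \<subseteq> J" using mem_is_interval_1_I[OF J that] by auto
    then show ?thesis
      unfolding h_def[abs_def] by (intro continuous_intros continuous_on_subset[OF zcont])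
  qed
  have "h s t \<le> 0" if s: "s = (if t0 \<le> t then - 2 * L else 2 * L)" for s
  proof (cases "t0 \<le> t")
    case True
    have "h s t \<le> h s t0"
    proof (rule DERIV_nonpos_imp_decreasing_open[OF True _ hcont[OF t0(1) t]])
      show "\<exists>y. DERIV (h s) u :> y \<and> y \<le> 0" if "t0 < u" "u < t" for u
        using hd[OF t0(1) t that, of s] True s by (auto simp: abs_le_iff)
    qed
    then show ?thesis by (simp add: h_def t0)
  next
    case False
    have "h s t \<le> h s t0"
    proof (rule DERIV_nonneg_imp_increasing_open[OF _ _ hcont[OF t t0(1)]])
      show "\<exists>y. DERIV (h s) u :> y \<and> 0 \<le> y" if "t < u" "u < t0" for u
        using hd[OF t t0(1) that, of s] False s by (auto simp: abs_le_iff)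
    qed (use False in simp)
    then show ?thesis by (simp add: h_def t0)
  qed
  then have "z t \<bullet> z t \<le> 0"
    by (auto simp: h_def mult_le_0_iff dest: order.strict_trans2[OF exp_gt_zero])
  then show ?thesis by (metis inner_gt_zero_iff not_less)
qed

context center_splitting
begin

text \<open>The constant \<open>\<delta>\<close> depends on the linear part only, so it is available before
  the nonlinearity is modified.\<close>

lemma parametrization_exists:
  "\<exists>\<delta>>0. \<forall>g g' g'' B. has_C2_derivs g g' g'' \<longrightarrow> (\<forall>x. norm (g' x) \<le> \<delta>) \<longrightarrow> (\<forall>x. norm (g'' x) \<le> B) \<longrightarrow>
     (\<forall>\<epsilon>>0. \<exists>C\<ge>0. \<forall>a b. norm (g'' a - g'' b) \<le> \<epsilon> + C * norm (a - b)) \<longrightarrow>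
     (\<forall>s. g (s *\<^sub>R p) = 0) \<longrightarrow> g' 0 = 0 \<longrightarrow>
     (\<exists>\<phi> \<phi>' \<phi>'' C. has_C2_derivs \<phi> \<phi>' \<phi>'' \<and> (\<forall>y. \<pi> (\<phi> y) = y) \<and> (\<forall>s. \<phi> (s *\<^sub>R axis 1 1) = s *\<^sub>R p) \<and>
        (\<forall>v. \<phi>' 0 v = center_incl v) \<and> (\<forall>y. norm (\<phi>' y) \<le> C) \<and>
        (\<forall>y. A *v \<phi> y + g (\<phi> y) = \<phi>' y (\<pi> (A *v \<phi> y + g (\<phi> y)))))"
proof -
  obtain N where N: "0 \<le> N" "\<And>\<delta>. 0 \<le> \<delta> \<Longrightarrow> N * \<delta> \<le> 1 / 2 \<Longrightarrow> growth_operator solver rate N \<delta>"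
    using solver_growth_operator by blast
  obtain L where L: "0 \<le> L" "\<And>y. growth rate (L * norm y) (free_orbit y)"
    using free_orbit_growth by blast
  define \<delta> where "\<delta> = 1 / (2 * (N + 1))"
  have \<delta>: "0 < \<delta>" "N * \<delta> \<le> 1 / 2"
    using N(1) by (auto simp: \<delta>_def field_simps)
  show ?thesis
  proof (intro exI[of _ \<delta>] conjI allI impI)
    fix g :: "real^'n \<Rightarrow> real^'n" and g' g'' and B :: real
    assume g: "has_C2_derivs g g' g''" and g'_bd: "\<forall>x. norm (g' x) \<le> \<delta>" and g''_bd: "\<forall>x. norm (g'' x) \<le> B"
      and modulus: "\<forall>\<epsilon>>0. \<exists>C\<ge>0. \<forall>a b. norm (g'' a - g'' b) \<le> \<epsilon> + C * norm (a - b)"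
      and gp: "\<forall>s. g (s *\<^sub>R p) = 0" and g'0: "g' 0 = 0"
    interpret smooth_growth_problem solver rate N \<delta> free_orbit L B g g' g''
    proof (intro smooth_growth_problem.intro smooth_growth_problem_axioms.intro N(2) free_orbit_add free_orbit_scaleR L)
      show "g 0 = 0" using gp[rule_format, of 0] by simp
    qed (use g g'_bd g''_bd modulus \<delta> in \<open>auto simp: has_C2_derivs_def\<close>)
    let ?F = "\<lambda>x. A *v x + g x"
    let ?\<phi> = "\<lambda>y. orbit y 0"
    have g_orbit: "bounded_solution (\<lambda>t. g (orbit y t)) (solver (\<lambda>t. g (orbit y t)))" for y
      by (rule solver_solution[OF g_orbit_growth3])
    have orbit_deriv: "(orbit y has_vector_derivative ?F (orbit y t)) (at t)" for y t
    proof -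
      have "((\<lambda>t. free_orbit y t + solver (\<lambda>t. g (orbit y t)) t) has_vector_derivative
        A *v free_orbit y t + (A *v solver (\<lambda>t. g (orbit y t)) t + g (orbit y t))) (at t)"
        using g_orbit[of y] unfolding bounded_solution_def
        by (intro has_vector_derivative_add free_orbit_deriv) blast
      then have "(orbit y has_vector_derivative
        A *v free_orbit y t + (A *v solver (\<lambda>t. g (orbit y t)) t + g (orbit y t))) (at t)"
        unfolding orbit_eq[of y, symmetric] .
      moreover have "A *v free_orbit y t + (A *v solver (\<lambda>t. g (orbit y t)) t + g (orbit y t)) = ?F (orbit y t)"
        using fun_cong[OF orbit_eq[of y], of t] by (simp add: linear_add[OF A_linear])
      ultimately show ?thesis by simp
    qed
    have \<pi>_orbit: "\<pi> (orbit y 0) = y" for y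
      using fun_cong[OF orbit_eq[of y], of 0] g_orbit[of y]
      by (simp add: bounded_solution_def linear_add[OF \<pi>_linear] free_orbit_0 \<pi>_center_incl)
    have solution_is_orbit: "z = orbit (\<pi> (z 0))"
      if zg: "growth (3 * rate) C z" and zd: "\<And>t. (z has_vector_derivative ?F (z t)) (at t)" for C z
    proof (rule orbit_unique[OF zg])
      let ?y = "\<pi> (z 0)"
      have "bounded_solution (\<lambda>t. g (z t)) (\<lambda>t. z t - free_orbit ?y t)"
        unfolding bounded_solution_def
      proof (intro conjI allI exI)
        show "((\<lambda>t. z t - free_orbit ?y t) has_vector_derivative A *v (z t - free_orbit ?y t) + g (z t)) (at t)" for t
          by (rule has_vector_derivative_eq_rhs[OF has_vector_derivative_diff[OF zd free_orbit_deriv]])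
            (simp add: linear_diff[OF A_linear])
        show "\<pi> (z 0 - free_orbit ?y 0) = 0"
          by (simp add: linear_diff[OF \<pi>_linear] free_orbit_0 \<pi>_center_incl)
        show "growth (3 * rate) (C + L * norm ?y) (\<lambda>t. z t - free_orbit ?y t)"
          by (rule growth_diff[OF zg e_growth3])
      qed
      from solver_eqI[OF this] show "z = (\<lambda>t. free_orbit ?y t + solver (\<lambda>t. g (z t)) t)"
        by simp
    qed
    \<comment> \<open>A time shift changes only the growth constant, so the shifted orbit is the orbit of its own initial point.\<close>
    have shift: "orbit y \<tau> = ?\<phi> (\<pi> (orbit y \<tau>))" for y \<tau>
    proof -
      let ?z = "\<lambda>t. orbit y (t + \<tau>)"
      let ?c = "2 * (L * norm y) * exp (rate * \<bar>\<tau>\<bar>)"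
      have "growth rate ?c ?z"
      proof (rule growthI)
        fix t
        have "rate * \<bar>t + \<tau>\<bar> \<le> rate * \<bar>\<tau>\<bar> + rate * \<bar>t\<bar>"
          using rate_pos by (simp flip: distrib_left)
        then have "exp (rate * \<bar>t + \<tau>\<bar>) \<le> exp (rate * \<bar>\<tau>\<bar>) * exp (rate * \<bar>t\<bar>)"
          by (simp flip: exp_add)
        then have "2 * (L * norm y) * exp (rate * \<bar>t + \<tau>\<bar>) \<le> 2 * (L * norm y) * (exp (rate * \<bar>\<tau>\<bar>) * exp (rate * \<bar>t\<bar>))"
          using L(1) by (intro mult_left_mono) auto
        then show "norm (?z t) \<le> ?c * exp (rate * \<bar>t\<bar>)"
          using growthD[OF orbit_growth, of y "t + \<tau>"] by (simp add: mult.assoc)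
      qed (intro continuous_on_compose2[OF orbit_cont[of UNIV y]] continuous_intros, simp)
      then have g3: "growth (3 * rate) ?c ?z"
        by (rule growth_mono) (use rate_pos in auto)
      have "((\<lambda>t. t + \<tau>) has_vector_derivative 1) (at t)" for t
        by (auto intro!: derivative_eq_intros)
      from vector_diff_chain_at[OF this orbit_deriv]
      have "(?z has_vector_derivative ?F (?z t)) (at t)" for t
        by (simp add: o_def)
      from solution_is_orbit[OF g3 this] have "?z 0 = orbit (\<pi> (?z 0)) 0" by (rule fun_cong)
      then show ?thesis by simp
    qed
    have \<phi>C2: "has_C2_derivs ?\<phi> initial' initial''"
      using initial_has_derivative initial'_has_derivative initial''_cont by (simp add: has_C2_derivs_def)
    \<comment> \<open>Equilibria are constant, hence slowly growing solutions.\<close>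
    have orbit_p: "orbit (s *\<^sub>R axis 1 1) = (\<lambda>t. s *\<^sub>R p)" for s
    proof -
      have "(\<lambda>t. s *\<^sub>R p) = orbit (\<pi> (s *\<^sub>R p))"
      proof (rule solution_is_orbit[where C = "norm (s *\<^sub>R p)"])
        show "growth (3 * rate) (norm (s *\<^sub>R p)) (\<lambda>t. s *\<^sub>R p)"
          using rate_pos mult_left_mono[of 1 "exp (3 * rate * \<bar>_\<bar>)" "norm (s *\<^sub>R p)"]
          by (intro growthI) (auto simp del: norm_scaleR)
        show "((\<lambda>t. s *\<^sub>R p) has_vector_derivative ?F (s *\<^sub>R p)) (at t)" for t
          using gp by (simp add: linear_cmul[OF A_linear] Ap)
      qed
      then show ?thesis by (simp add: linear_cmul[OF \<pi>_linear] \<pi>_p)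
    qed
    show "\<exists>\<phi> \<phi>' \<phi>'' C. has_C2_derivs \<phi> \<phi>' \<phi>'' \<and> (\<forall>y. \<pi> (\<phi> y) = y) \<and> (\<forall>s. \<phi> (s *\<^sub>R axis 1 1) = s *\<^sub>R p) \<and>
        (\<forall>v. \<phi>' 0 v = center_incl v) \<and> (\<forall>y. norm (\<phi>' y) \<le> C) \<and>
        (\<forall>y. A *v \<phi> y + g (\<phi> y) = \<phi>' y (\<pi> (A *v \<phi> y + g (\<phi> y))))"
    proof (intro exI conjI allI)
      show "has_C2_derivs ?\<phi> initial' initial''" by (rule \<phi>C2)
      show "\<pi> (?\<phi> y) = y" for y by (rule \<pi>_orbit)
      show "?\<phi> (s *\<^sub>R axis 1 1) = s *\<^sub>R p" for s by (simp add: orbit_p)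
      show "initial' 0 v = center_incl v" for v
      proof -
        have "orbit 0 = (\<lambda>t. 0)" using orbit_p[of 0] by simp
        then have "variation 0 v = free_orbit v"
          using variation_eq[of 0 v] by (simp add: g'0 K_zero)
        then show ?thesis by (simp add: initial'_apply free_orbit_0)
      qed
      show "norm (initial' y) \<le> 2 * L" for y
        by (rule norm_blinfun_bound)
          (use L(1) growth_at_0[OF variation_growth[of _ y]] in \<open>auto simp: initial'_apply\<close>)
      show "?F (?\<phi> y) = initial' y (\<pi> (?F (?\<phi> y)))" for y
      proof (rule vector_derivative_unique_at[OF orbit_deriv])
        have "((\<lambda>\<tau>. \<pi> (orbit y \<tau>)) has_derivative (\<lambda>h. h *\<^sub>R \<pi> (?F (orbit y 0)))) (at 0)"
          using linear_has_vector_derivative[OF \<pi>_linear orbit_deriv] by (simp add: has_vector_derivative_def)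
        from has_C2_derivs_deriv(1)[OF \<phi>C2 this]
        have "((\<lambda>\<tau>. ?\<phi> (\<pi> (orbit y \<tau>))) has_vector_derivative initial' y (\<pi> (?F (orbit y 0)))) (at 0)"
          by (simp add: has_vector_derivative_def \<pi>_orbit blinfun.scaleR_right)
        then show "(orbit y has_vector_derivative initial' y (\<pi> (?F (?\<phi> y)))) (at 0)"
          unfolding shift[symmetric] .
      qed
    qed
  qed (rule \<delta>(1))
qed

end

section \<open>Coordinates on an invariant graph\<close>

lemma C2_derivs_local:
  assumes g: "has_C2_derivs g g' g''" and h: "has_C2_derivs h h' h''"
    and S: "open S" "\<And>x. x \<in> S \<Longrightarrow> g x = h x" and x: "x \<in> S"
  shows "g' x = h' x" "g'' x = h'' x"
proof -
  have 1: "g' y = h' y" if "y \<in> S" for y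
  proof -
    have "(g has_derivative blinfun_apply (g' y)) (at y)" using g by (simp add: has_C2_derivs_def)
    then have "(h has_derivative blinfun_apply (g' y)) (at y)"
      by (rule has_derivative_transform_within_open[OF _ S(1) that S(2)])
    moreover have "(h has_derivative blinfun_apply (h' y)) (at y)" using h by (simp add: has_C2_derivs_def)
    ultimately show ?thesis by (metis blinfun_apply_inject has_derivative_unique)
  qed
  have "(g' has_derivative blinfun_apply (g'' x)) (at x)" using g by (simp add: has_C2_derivs_def)
  then have "(h' has_derivative blinfun_apply (g'' x)) (at x)"
    by (rule has_derivative_transform_within_open[OF _ S(1) x 1])
  moreover have "(h' has_derivative blinfun_apply (h'' x)) (at x)" using h by (simp add: has_C2_derivs_def)
  ultimately show "g'' x = h'' x" by (metis blinfun_apply_inject has_derivative_unique)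
  show "g' x = h' x" by (rule 1[OF x])
qed

lemma has_C2_derivs_linear:
  fixes l :: "'a::euclidean_space \<Rightarrow> 'b::real_normed_vector"
  assumes "linear l"
  shows "has_C2_derivs l (\<lambda>x. Blinfun l) (\<lambda>x. 0)"
proof -
  have "bounded_linear l" using assms by (simp add: linear_conv_bounded_linear)
  then show ?thesis
    by (simp add: has_C2_derivs_def bounded_linear_Blinfun_apply bounded_linear_imp_has_derivative
        zero_blinfun.rep_eq)
qed

lemma partial_derivative_eq:
  assumes "(h has_derivative h') (at u)"
  shows "partial_derivative j h u = h' (axis j 1)"
proof -
  have ax: "axis j t = t *\<^sub>R axis j (1::real)" for t
    by (simp add: vec_eq_iff axis_def)
  have "((\<lambda>t. u + t *\<^sub>R axis j (1::real)) has_derivative (\<lambda>t. t *\<^sub>R axis j 1)) (at 0)"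
    by (auto intro!: derivative_eq_intros)
  from has_derivative_compose[OF this, of h h'] assms
  have "((\<lambda>t. h (u + t *\<^sub>R axis j 1)) has_derivative (\<lambda>t. h' (t *\<^sub>R axis j 1))) (at 0)"
    by simp
  then have hd: "((\<lambda>t. h (u + axis j t)) has_derivative (\<lambda>t. h' (axis j t))) (at 0)"
    by (simp only: ax[symmetric])
  have "h' (axis j t) = h' (axis j 1) * t" for t
    using linear_cmul[OF has_derivative_linear[OF assms], of t "axis j 1"] ax[of t] by simp
  then have "(\<lambda>t. h' (axis j t)) = (*) (h' (axis j 1))" by (rule ext)
  then have "((\<lambda>t. h (u + axis j t)) has_real_derivative h' (axis j 1)) (at 0)"
    using hd unfolding has_field_derivative_def by (simp only:)
  then show ?thesis
    unfolding partial_derivative_def by (rule DERIV_imp_deriv)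
qed

text \<open>The image of \<open>\<phi>\<close> is a graph, invariant under a globally Lipschitz vector field
  \<open>F\<close> that agrees with \<open>f\<close> near the origin. The linear left inverse
  \<open>\<pi>\<close> of \<open>\<phi>\<close> serves as a global coordinate map.\<close>

locale center_parametrization =
  fixes f F :: "real^'n \<Rightarrow> real^'n" and \<pi> :: "real^'n \<Rightarrow> real^2"
    and \<phi> :: "real^2 \<Rightarrow> real^'n" and \<phi>' :: "real^2 \<Rightarrow> (real^2) \<Rightarrow>\<^sub>L (real^'n)" and \<phi>'' and \<rho> C k :: real
  assumes \<pi>_lin: "linear \<pi>" and \<phi>_C2: "has_C2_derivs \<phi> \<phi>' \<phi>''" and \<pi>\<phi>: "\<And>y. \<pi> (\<phi> y) = y"
    and \<phi>_0: "\<phi> 0 = 0" and \<phi>'_bound: "\<And>y. norm (\<phi>' y) \<le> C"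
    and \<rho>_pos: "0 < \<rho>" and F_eq: "\<And>x. norm x < \<rho> \<Longrightarrow> F x = f x"
    and F_lip: "\<And>a b. norm (F a - F b) \<le> k * norm (a - b)"
    and invariance: "\<And>y. F (\<phi> y) = \<phi>' y (\<pi> (F (\<phi> y)))"
begin

text \<open>The parameters of points at which \<open>F\<close> and \<open>f\<close> agree.\<close>

definition chart :: "(real^2) set" where "chart = {y. norm (\<phi> y) < \<rho>}"

lemma \<pi>_bounded_linear: "bounded_linear \<pi>"
  using \<pi>_lin by (simp add: linear_conv_bounded_linear)

lemma \<pi>_cont: "continuous_on S \<pi>"
  by (rule bounded_linear.continuous_on[OF \<pi>_bounded_linear continuous_on_id])

lemma \<phi>_deriv: "(\<phi> has_derivative blinfun_apply (\<phi>' y)) (at y)"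
  using \<phi>_C2 by (simp add: has_C2_derivs_def)

lemma \<phi>_cont: "continuous_on S \<phi>"
  by (rule has_C2_derivs_cont(1)[OF \<phi>_C2 continuous_on_id])

lemma chart_open: "open chart"
  unfolding chart_def by (intro open_Collect_less continuous_intros \<phi>_cont)

lemma zero_in_chart: "0 \<in> chart"
  by (simp add: chart_def \<phi>_0 \<rho>_pos)

lemma \<pi>_\<phi>': "\<pi> (\<phi>' y v) = v"
proof -
  have "((\<lambda>y. \<pi> (\<phi> y)) has_derivative (\<lambda>v. \<pi> (\<phi>' y v))) (at y)"
    by (rule bounded_linear.has_derivative[OF \<pi>_bounded_linear \<phi>_deriv])
  then have "(\<lambda>v. \<pi> (\<phi>' y v)) = (\<lambda>v. v)"
    unfolding \<pi>\<phi> using has_derivative_ident has_derivative_unique by blast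
  then show ?thesis by (simp add: fun_eq_iff)
qed

lemma C2_param_chart: "C2_param (\<phi> ` chart) \<phi> chart"
  unfolding C2_param_def
proof (intro conjI ballI)
  show "inj (frechet_derivative \<phi> (at u))" for u
  proof -
    have "frechet_derivative \<phi> (at u) = blinfun_apply (\<phi>' u)"
      using frechet_derivative_at[OF \<phi>_deriv] by simp
    then show ?thesis by (metis \<pi>_\<phi>' injI)
  qed
  have "homeomorphism chart (\<phi> ` chart) \<phi> \<pi>"
    by (auto simp: homeomorphism_def \<phi>_cont \<pi>_cont \<pi>\<phi> image_image)
  then show "\<exists>\<psi>. homeomorphism chart (\<phi> ` chart) \<phi> \<psi>" by blast
qed (auto simp: chart_open has_C2_derivs_imp_C2_on[OF \<phi>_C2])

lemma C2_surface_image: "C2_surface (\<phi> ` chart)"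
  unfolding C2_surface_def using C2_param_chart by blast

text \<open>A curve in the image satisfies \<open>\<gamma> = \<phi> \<circ> \<pi> \<circ> \<gamma>\<close>,
  and this identity can be differentiated at zero.\<close>

lemma tangent_space_image: "tangent_space (\<phi> ` chart) 0 = range (blinfun_apply (\<phi>' 0))"
proof (intro equalityI subsetI)
  fix v assume "v \<in> tangent_space (\<phi> ` chart) 0"
  then obtain \<gamma> where \<gamma>: "\<gamma> 0 = 0" "eventually (\<lambda>t. \<gamma> t \<in> \<phi> ` chart) (nhds (0::real))"
    "(\<gamma> has_vector_derivative v) (at 0)"
    unfolding tangent_space_def by blast
  have "((\<lambda>t. \<pi> (\<gamma> t)) has_derivative (\<lambda>h. h *\<^sub>R \<pi> v)) (at 0)"
    using linear_has_vector_derivative[OF \<pi>_lin \<gamma>(3)] by (simp add: has_vector_derivative_def)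
  from has_C2_derivs_deriv(1)[OF \<phi>_C2 this]
  have d: "((\<lambda>t. \<phi> (\<pi> (\<gamma> t))) has_vector_derivative \<phi>' 0 (\<pi> v)) (at 0)"
    using linear_0[OF \<pi>_lin] by (simp add: has_vector_derivative_def \<gamma>(1) blinfun.scaleR_right)
  have "eventually (\<lambda>t. \<gamma> t = \<phi> (\<pi> (\<gamma> t))) (nhds 0)"
    using \<gamma>(2) by eventually_elim (auto simp: \<pi>\<phi>)
  then have "eventually (\<lambda>t. \<phi> (\<pi> (\<gamma> t)) = \<gamma> t) (at 0)"
    by (auto simp: eventually_at_filter elim: eventually_mono)
  moreover have "\<phi> (\<pi> (\<gamma> 0)) = \<gamma> 0"
    using linear_0[OF \<pi>_lin] by (simp add: \<phi>_0 \<gamma>(1))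
  ultimately have "(\<gamma> has_vector_derivative \<phi>' 0 (\<pi> v)) (at 0)"
    using has_derivative_transform_eventually[OF d[unfolded has_vector_derivative_def]]
    unfolding has_vector_derivative_def by blast
  then have "v = \<phi>' 0 (\<pi> v)"
    using \<gamma>(3) vector_derivative_unique_at by blast
  then show "v \<in> range (blinfun_apply (\<phi>' 0))" by blast
next
  fix v assume "v \<in> range (blinfun_apply (\<phi>' 0))"
  then obtain u where u: "v = \<phi>' 0 u" by blast
  have cont: "isCont (\<lambda>t. t *\<^sub>R u) (0::real)" by (intro continuous_intros)
  have lim: "((\<lambda>t. t *\<^sub>R u) \<longlongrightarrow> 0 *\<^sub>R u) (nhds (0::real))"
    using cont tendsto_at_iff_tendsto_nhds[of "\<lambda>t. t *\<^sub>R u" "0::real"] unfolding isCont_def by blast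
  have "((\<lambda>t. t *\<^sub>R u) has_derivative (\<lambda>h. h *\<^sub>R u)) (at 0)"
    by (auto intro!: derivative_eq_intros)
  from has_C2_derivs_deriv(1)[OF \<phi>_C2 this]
  have "((\<lambda>t. \<phi> (t *\<^sub>R u)) has_vector_derivative v) (at 0)"
    by (simp add: has_vector_derivative_def u blinfun.scaleR_right)
  moreover have "eventually (\<lambda>t. t *\<^sub>R u \<in> chart) (nhds 0)"
    by (rule topological_tendstoD[OF lim chart_open]) (simp add: zero_in_chart)
  then have "eventually (\<lambda>t. \<phi> (t *\<^sub>R u) \<in> \<phi> ` chart) (nhds 0)"
    by eventually_elim blast
  ultimately show "v \<in> tangent_space (\<phi> ` chart) 0"
    unfolding tangent_space_def by (auto intro!: exI[of _ "\<lambda>t. \<phi> (t *\<^sub>R u)"] simp: \<phi>_0)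
qed

text \<open>By invariance of the image, the deviation \<open>z = x - \<phi> (\<pi> x)\<close> of a solution
  from the image has derivative \<open>d - \<phi>' (\<pi> d)\<close> with \<open>d = F x - F (\<phi> (\<pi>
  x))\<close>, which is bounded by a multiple of \<open>z\<close>. So \<open>z\<close> vanishes on the whole
  interval as soon as it vanishes once.\<close>

lemma locally_invariant_image: "locally_invariant f (\<phi> ` chart)"
  unfolding locally_invariant_def
proof (intro exI[of _ "{x. norm x < \<rho> \<and> norm (\<phi> (\<pi> x)) < \<rho>}"] conjI allI impI)
  let ?V = "{x. norm x < \<rho> \<and> norm (\<phi> (\<pi> x)) < \<rho>}"
  have c: "continuous_on UNIV (\<lambda>x. \<phi> (\<pi> x))"
    by (rule continuous_on_compose2[OF \<phi>_cont \<pi>_cont]) auto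
  show "open ?V"
    by (intro open_Collect_conj open_Collect_less continuous_intros c)
  show "\<phi> ` chart \<subseteq> ?V"
    by (auto simp: chart_def \<pi>\<phi>)
  fix x J assume "solves x f J \<and> x ` J \<subseteq> ?V \<and> (\<exists>t\<in>J. x t \<in> \<phi> ` chart)"
  then obtain t0 where sol: "solves x f J" and V: "\<And>t. t \<in> J \<Longrightarrow> x t \<in> ?V"
    and t0: "t0 \<in> J" "x t0 \<in> \<phi> ` chart" by blast
  obtain c\<pi> where c\<pi>: "0 \<le> c\<pi>" "\<And>v. norm (\<pi> v) \<le> norm v * c\<pi>"
    using bounded_linear.nonneg_bounded[OF \<pi>_bounded_linear] by blast
  have C: "0 \<le> C" using \<phi>'_bound norm_ge_zero order_trans by blast
  let ?z = "\<lambda>t. x t - \<phi> (\<pi> (x t))"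
  let ?d = "\<lambda>t. F (x t) - F (\<phi> (\<pi> (x t)))"
  have z0: "?z t = 0" if "t \<in> J" for t
  proof (rule zero_of_linear_bound[OF _ _ _ t0(1) _ that])
    show "is_interval J" using sol by (simp add: solves_def)
    show "?z t0 = 0" using t0(2) by (auto simp: \<pi>\<phi>)
    fix t assume t: "t \<in> J"
    have xd: "(x has_vector_derivative F (x t)) (at t within J)"
      using sol t V[OF t] by (simp add: solves_def F_eq)
    have "((\<lambda>t. \<pi> (x t)) has_derivative (\<lambda>h. h *\<^sub>R \<pi> (F (x t)))) (at t within J)"
      using linear_has_vector_derivative[OF \<pi>_lin xd] by (simp add: has_vector_derivative_def)
    from has_C2_derivs_deriv(1)[OF \<phi>_C2 this]
    have "((\<lambda>t. \<phi> (\<pi> (x t))) has_vector_derivative \<phi>' (\<pi> (x t)) (\<pi> (F (x t)))) (at t within J)"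
      by (simp add: has_vector_derivative_def blinfun.scaleR_right)
    from has_vector_derivative_diff[OF xd this]
    show "(?z has_vector_derivative ?d t - \<phi>' (\<pi> (x t)) (\<pi> (?d t))) (at t within J)"
      by (rule has_vector_derivative_eq_rhs)
        (simp add: linear_diff[OF \<pi>_lin] blinfun.diff_right invariance[symmetric])
    have "norm (?d t - \<phi>' (\<pi> (x t)) (\<pi> (?d t))) \<le> norm (?d t) + C * (norm (?d t) * c\<pi>)"
      by (rule norm_triangle_le_diff, rule add_left_mono, rule order_trans[OF norm_blinfun])
        (intro mult_mono \<phi>'_bound c\<pi> C; simp)
    also have "\<dots> = (1 + C * c\<pi>) * norm (?d t)" by (simp add: algebra_simps)
    also have "\<dots> \<le> (1 + C * c\<pi>) * (k * norm (?z t))"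
      using C c\<pi>(1) by (intro mult_left_mono F_lip) auto
    finally show "norm (?d t - \<phi>' (\<pi> (x t)) (\<pi> (?d t))) \<le> (1 + C * c\<pi>) * k * norm (?z t)"
      by (simp add: mult.assoc)
  qed
  show "x ` J \<subseteq> \<phi> ` chart"
  proof (rule image_subsetI)
    fix t assume t: "t \<in> J"
    then have "x t = \<phi> (\<pi> (x t))" "\<pi> (x t) \<in> chart"
      using z0[OF t] V[OF t] by (auto simp: chart_def)
    then show "x t \<in> \<phi> ` chart" by (rule image_eqI)
  qed
qed

text \<open>Applying the linear map \<open>\<pi>\<close> turns differentiability of \<open>\<phi> \<circ>
  u\<close> into differentiability of \<open>u = \<pi> \<circ> \<phi> \<circ> u\<close>.\<close>

lemma reads_in_coordinates_chart: "reads_in_coordinates f \<phi> chart (\<lambda>y. \<pi> (F (\<phi> y)))"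
  unfolding reads_in_coordinates_def
proof (intro allI impI iffI)
  fix u :: "real \<Rightarrow> real^2" and J assume uJ: "u ` J \<subseteq> chart"
  then have Ff: "f (\<phi> (u t)) = F (\<phi> (u t))" if "t \<in> J" for t
    using that by (auto simp: chart_def F_eq)
  show "solves u (\<lambda>y. \<pi> (F (\<phi> y))) J" if "solves (\<phi> \<circ> u) f J"
    unfolding solves_def
  proof (intro conjI ballI)
    fix t assume t: "t \<in> J"
    have "(\<phi> \<circ> u has_vector_derivative F (\<phi> (u t))) (at t within J)"
      using that t by (simp add: solves_def Ff)
    from linear_has_vector_derivative[OF \<pi>_lin this]
    show "(u has_vector_derivative \<pi> (F (\<phi> (u t)))) (at t within J)"
      by (simp add: \<pi>\<phi>)
  qed (use that in \<open>simp add: solves_def\<close>)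
  show "solves (\<phi> \<circ> u) f J" if "solves u (\<lambda>y. \<pi> (F (\<phi> y))) J"
    unfolding solves_def
  proof (intro conjI ballI)
    fix t assume t: "t \<in> J"
    have "(u has_derivative (\<lambda>h. h *\<^sub>R \<pi> (F (\<phi> (u t))))) (at t within J)"
      using that t by (simp add: solves_def has_vector_derivative_def)
    from has_C2_derivs_deriv(1)[OF \<phi>_C2 this]
    have "((\<lambda>t. \<phi> (u t)) has_vector_derivative \<phi>' (u t) (\<pi> (F (\<phi> (u t))))) (at t within J)"
      by (simp add: has_vector_derivative_def blinfun.scaleR_right)
    then show "(\<phi> \<circ> u has_vector_derivative f ((\<phi> \<circ> u) t)) (at t within J)"
      unfolding invariance[symmetric] by (simp add: o_def Ff[OF t])
  qed (use that in \<open>simp add: solves_def\<close>)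
qed

end

section \<open>The reduced system\<close>

lemma jordan_chain:
  fixes A :: "real^'n^'n"
  assumes double: "double_index_two_zero_eigenvalue A" and p: "p \<noteq> 0" "A *v p = 0"
  obtains q where "A *v q = p" "\<And>v. A *v (A *v v) = 0 \<Longrightarrow> \<exists>s t. v = s *s p + t *s q"
    "\<And>v. A *v (A *v (A *v v)) = 0 \<Longrightarrow> A *v (A *v v) = 0"
proof -
  have am: "alg_mult A 0 = 2" and gm: "geom_mult A 0 = 1"
    using double by (auto simp: double_index_two_zero_eigenvalue_def)
  note ker = ker_eq_span_of_geom_mult_1[OF gm p]
  obtain q where q: "A *v q = p"
    using jordan_chain_exists[OF am p ker] by blast
  have ker2: "\<exists>s t. v = s *s p + t *s q" if v: "A *v (A *v v) = 0" for v
  proof -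
    obtain s where "A *v v = s *s p" using ker[OF v] by blast
    then have "A *v v = s *s p + 0 *s q" by simp
    from jordan_chain_maximal[OF am p q this] show ?thesis .
  qed
  have "A *v (A *v v) = 0" if v: "A *v (A *v (A *v v)) = 0" for v
  proof -
    obtain s t where "A *v v = s *s p + t *s q" using ker2[OF v] by blast
    from jordan_chain_maximal[OF am p q this] obtain s t where "v = s *s p + t *s q" by blast
    then show ?thesis by (simp add: matrix_vector_right_distrib vector_scalar_commute p q)
  qed
  with q ker2 that show thesis by blast
qed

lemma double_zero_splitting:
  fixes A :: "real^'n^'n"
  assumes double: "double_index_two_zero_eigenvalue A" and p: "p \<noteq> 0" "A *v p = 0"
    and spec: "\<And>l. is_eigenvalue (complexify A) l \<Longrightarrow> l \<noteq> 0 \<Longrightarrow> Re l \<noteq> 0"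
  obtains q \<pi> ls where "center_splitting A p q \<pi> ls"
    "center_subspace A = range (\<lambda>c::real^2. c $ 1 *\<^sub>R p + c $ 2 *\<^sub>R q)"
proof -
  obtain q where q: "A *v q = p" and ker2: "\<And>v. A *v (A *v v) = 0 \<Longrightarrow> \<exists>s t. v = s *s p + t *s q"
    and stab: "\<And>v. A *v (A *v (A *v v)) = 0 \<Longrightarrow> A *v (A *v v) = 0"
    using jordan_chain[OF double p] by blast
  obtain ls where ls: "\<And>l. l \<in> set ls \<Longrightarrow> Re l \<noteq> 0" "\<And>v. roots_apply (complexify A) ls (cvec (A *v (A *v v))) = 0"
    using hyperbolic_roots_exist[OF spec stab] by blast
  obtain \<pi> :: "real^'n \<Rightarrow> real^2" where \<pi>: "linear \<pi>" "\<pi> p = axis 1 1" "\<pi> q = axis 2 1"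
    "\<And>v. \<pi> (A *v (A *v v)) = 0"
    "\<And>v. \<exists>w. v = \<pi> v $ 1 *\<^sub>R p + \<pi> v $ 2 *\<^sub>R q + A *v (A *v w)"
    using center_projection_exists[OF p(2) q ker2 p(1) stab] by blast
  have cs: "center_subspace A = {v. A *v (A *v v) = 0}"
    by (rule center_subspace_eq) (fact spec, fact stab)
  have "center_splitting A p q \<pi> ls"
    by (intro center_splitting.intro p q ls \<pi>)
  moreover have "center_subspace A = range (\<lambda>c::real^2. c $ 1 *\<^sub>R p + c $ 2 *\<^sub>R q)"
    unfolding cs
  proof (intro equalityI subsetI)
    fix v assume "v \<in> {v. A *v (A *v v) = 0}"
    then obtain s t where "v = s *s p + t *s q" using ker2 by blast
    then show "v \<in> range (\<lambda>c::real^2. c $ 1 *\<^sub>R p + c $ 2 *\<^sub>R q)"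
      by (intro image_eqI[of _ _ "vector [s, t]"]) (simp_all add: scalar_mult_eq_scaleR)
  next
    fix v assume "v \<in> range (\<lambda>c::real^2. c $ 1 *\<^sub>R p + c $ 2 *\<^sub>R q)"
    then show "v \<in> {v. A *v (A *v v) = 0}"
      by (auto simp: matrix_vector_right_distrib p q vector_scalar_commute simp flip: scalar_mult_eq_scaleR)
  qed
  ultimately show thesis by (rule that)
qed

theorem theorem2:
  fixes f :: "real^'n \<Rightarrow> real^'n" and i1 :: 'n
  defines "A \<equiv> jacobian f (at 0)"
  assumes "C2_on UNIV f"
    and "\<And>s. f (axis i1 s) = 0"
    and "double_index_two_zero_eigenvalue A"
    and "\<And>l. is_eigenvalue (complexify A) l \<Longrightarrow> l \<noteq> 0 \<Longrightarrow> Re l \<noteq> 0"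
    and "\<And>p q. p \<in> mat_ker A - {0} \<Longrightarrow> q \<in> mat_ker (A ** A) - mat_ker A \<Longrightarrow>
           second_derivative f 0 p q \<notin> range ((*v) A)"
  shows "\<exists>M (\<phi> :: real^2 \<Rightarrow> real^'n) U (\<xi> :: real^2 \<Rightarrow> real^2).
           local_C2_center_manifold_2 f M \<and>
           C2_param M \<phi> U \<and> 0 \<in> U \<and> \<phi> 0 = 0 \<and>
           C2_on U \<xi> \<and> reads_in_coordinates f \<phi> U \<xi> \<and>
           eventually (\<lambda>s. \<xi> (vector [s, 0]) = 0) (nhds 0) \<and>
           partial_derivative 2 (\<lambda>u. \<xi> u $ 2) 0 = 0 \<and>
           partial_derivative 2 (\<lambda>u. \<xi> u $ 1) 0 \<noteq> 0 \<and>
           partial_derivative 1 (partial_derivative 2 (\<lambda>u. \<xi> u $ 2)) 0 \<noteq> 0"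
proof -
  define p :: "real^'n" where "p = axis i1 1"
  have sp: "axis i1 s = s *\<^sub>R p" for s
    by (simp add: p_def vec_eq_iff axis_def)
  have f_line: "f (s *\<^sub>R p) = 0" for s
    using assms(3)[of s] by (simp add: sp)
  have p0: "p \<noteq> 0" by (simp add: p_def axis_eq_0_iff)
  obtain f' f'' where f: "has_C2_derivs f f' f''"
    using assms(2) by (auto simp: C2_on_UNIV_iff)
  have fd: "(f has_derivative blinfun_apply (f' x)) (at x)" for x
    using f by (simp add: has_C2_derivs_def)
  have A_eq: "f' 0 v = A *v v" for v
  proof -
    have "f differentiable (at 0)" using fd differentiable_def by blast
    then have "(f has_derivative (*v) A) (at 0)"
      unfolding A_def using jacobian_works by blast
    then show ?thesis using fd has_derivative_unique by metis
  qed
  have Ap: "A *v p = 0"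
  proof -
    have "((\<lambda>s. s *\<^sub>R p) has_derivative (\<lambda>h. h *\<^sub>R p)) (at 0)"
      by (auto intro!: derivative_eq_intros)
    from has_C2_derivs_deriv(1)[OF f this]
    have "((\<lambda>s::real. 0 :: real^'n) has_derivative (\<lambda>h. f' 0 (h *\<^sub>R p))) (at 0)"
      by (simp add: f_line)
    then have "(\<lambda>h. f' 0 (h *\<^sub>R p)) = (\<lambda>h::real. 0)"
      using has_derivative_const has_derivative_unique by blast
    from fun_cong[OF this, of 1] show ?thesis by (simp add: A_eq)
  qed
  obtain q \<pi> ls where split: "center_splitting A p q \<pi> ls"
    and center: "center_subspace A = range (\<lambda>c::real^2. c $ 1 *\<^sub>R p + c $ 2 *\<^sub>R q)"
    using double_zero_splitting[OF assms(4) p0 Ap assms(5)] by blast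
  interpret center_splitting A p q \<pi> ls by (rule split)
  obtain \<delta> where \<delta>: "0 < \<delta>" and param: "\<forall>g g' g'' B. has_C2_derivs g g' g'' \<longrightarrow> (\<forall>x. norm (g' x) \<le> \<delta>) \<longrightarrow> (\<forall>x. norm (g'' x) \<le> B) \<longrightarrow>
     (\<forall>\<epsilon>>0. \<exists>C\<ge>0. \<forall>a b. norm (g'' a - g'' b) \<le> \<epsilon> + C * norm (a - b)) \<longrightarrow>
     (\<forall>s. g (s *\<^sub>R p) = 0) \<longrightarrow> g' 0 = 0 \<longrightarrow>
     (\<exists>\<phi> \<phi>' \<phi>'' C. has_C2_derivs \<phi> \<phi>' \<phi>'' \<and> (\<forall>y. \<pi> (\<phi> y) = y) \<and> (\<forall>s. \<phi> (s *\<^sub>R axis 1 1) = s *\<^sub>R p) \<and>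
        (\<forall>v. \<phi>' 0 v = center_incl v) \<and> (\<forall>y. norm (\<phi>' y) \<le> C) \<and>
        (\<forall>y. A *v \<phi> y + g (\<phi> y) = \<phi>' y (\<pi> (A *v \<phi> y + g (\<phi> y)))))"
    using parametrization_exists by (elim exE conjE)
  define lA where "lA = Blinfun ((*v) A)"
  have lA: "blinfun_apply lA = (*v) A"
    unfolding lA_def by (rule bounded_linear_Blinfun_apply) (rule matrix_vector_mul_bounded_linear)
  have G: "has_C2_derivs (\<lambda>x. (- lA) x + f x) (\<lambda>x. - lA + f' x) f''"
    by (rule has_C2_derivs_add_linear[OF f])
  have G_eq: "(- lA) x + f x = f x - A *v x" for x
    by (simp add: blinfun.minus_left lA)
  have G'0: "- lA + f' 0 = 0"
    by (rule blinfun_eqI) (simp add: blinfun.diff_left lA A_eq)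
  have G0: "(- lA) 0 + f 0 = 0" using f_line[of 0] by simp
  obtain \<rho> g g' g'' B where \<rho>: "0 < \<rho>" and g: "has_C2_derivs g g' g''"
    and g_loc: "\<And>x. norm x < \<rho> \<Longrightarrow> g x = (- lA) x + f x" and g_scale: "\<And>x. \<exists>c. g x = (- lA) (c *\<^sub>R x) + f (c *\<^sub>R x)"
    and g'_bd: "\<And>x. norm (g' x) \<le> \<delta>" and g''_bd: "\<And>x. norm (g'' x) \<le> B"
    and modulus: "\<And>\<epsilon>. 0 < \<epsilon> \<Longrightarrow> \<exists>C\<ge>0. \<forall>a b. norm (g'' a - g'' b) \<le> \<epsilon> + C * norm (a - b)"
    by (rule flat_extension[OF G G0 G'0 \<delta>]) blast
  have g_line: "g (s *\<^sub>R p) = 0" for s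
  proof -
    obtain c where "g (s *\<^sub>R p) = (- lA) (c *\<^sub>R s *\<^sub>R p) + f (c *\<^sub>R s *\<^sub>R p)" using g_scale by blast
    then show ?thesis
      by (simp add: blinfun.minus_left lA f_line linear_cmul[OF A_linear] Ap)
  qed
  have in_ball: "0 \<in> ball (0::real^'n) \<rho>" using \<rho> by simp
  have "g' 0 = - lA + f' 0" "g'' 0 = f'' 0"
    by (rule C2_derivs_local[OF g G open_ball _ in_ball]; simp add: g_loc)+
  then have g'0: "g' 0 = 0" and g''0: "g'' 0 = f'' 0" using G'0 by simp_all
  obtain \<phi> \<phi>' \<phi>'' C where \<phi>: "has_C2_derivs \<phi> \<phi>' \<phi>''" and \<pi>\<phi>: "\<And>y. \<pi> (\<phi> y) = y"
    and \<phi>_line: "\<And>s. \<phi> (s *\<^sub>R axis 1 1) = s *\<^sub>R p" and \<phi>'0: "\<And>v. \<phi>' 0 v = center_incl v"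
    and \<phi>'_bd: "\<And>y. norm (\<phi>' y) \<le> C"
    and inv: "\<And>y. A *v \<phi> y + g (\<phi> y) = \<phi>' y (\<pi> (A *v \<phi> y + g (\<phi> y)))"
    using param[rule_format, OF g g'_bd g''_bd modulus g_line g'0] by blast
  define F where "F x = A *v x + g x" for x
  have F_C2: "has_C2_derivs F (\<lambda>x. lA + g' x) g''"
    using has_C2_derivs_add_linear[OF g, of lA] by (simp add: F_def[abs_def] lA)
  obtain kA where kA: "\<And>v. norm (A *v v) \<le> norm v * kA"
    using bounded_linear.bounded[OF matrix_vector_mul_bounded_linear[of A]] by blast
  have \<phi>_0: "\<phi> 0 = 0" using \<phi>_line[of 0] by simp
  interpret center_parametrization f F \<pi> \<phi> \<phi>' \<phi>'' \<rho> C "kA + \<delta>"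
  proof (rule center_parametrization.intro[OF \<pi>_linear \<phi> \<pi>\<phi> \<phi>_0 \<phi>'_bd \<rho>])
    show "F x = f x" if "norm x < \<rho>" for x
      using g_loc[OF that] by (simp add: F_def G_eq)
    show "norm (F a - F b) \<le> (kA + \<delta>) * norm (a - b)" for a b
    proof -
      have "norm (g a - g b) \<le> \<delta> * norm (a - b)"
        using g g'_bd by (intro differentiable_bound_blinfun[of g g']) (auto simp: has_C2_derivs_def)
      moreover have "norm (A *v (a - b)) \<le> kA * norm (a - b)"
        using kA[of "a - b"] by (simp add: mult.commute)
      moreover have "F a - F b = A *v (a - b) + (g a - g b)"
        by (simp add: F_def matrix_vector_mult_diff_distrib)
      ultimately show ?thesis
        by (simp add: distrib_right) (meson add_mono norm_triangle_le)
    qed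
    show "F (\<phi> y) = \<phi>' y (\<pi> (F (\<phi> y)))" for y
      unfolding F_def by (rule inv)
  qed
  \<comment> \<open>Since \<open>\<pi>\<close> is linear, \<open>\<xi>\<close> is a composition of \<open>C\<^sup>2\<close> maps.\<close>
  define \<xi> where "\<xi> y = \<pi> (F (\<phi> y))" for y
  obtain d d2 where d: "has_C2_derivs (\<lambda>y. F (\<phi> y)) d d2" "\<And>y v. d y v = (lA + g' (\<phi> y)) (\<phi>' y v)"
    "\<And>y u v. d2 y u v = g'' (\<phi> y) (\<phi>' y u) (\<phi>' y v) + (lA + g' (\<phi> y)) (\<phi>'' y u v)"
    using has_C2_derivs_compose[OF \<phi> F_C2] by blast
  have b\<pi>: "bounded_linear \<pi>" using \<pi>_linear by (simp add: linear_conv_bounded_linear)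
  obtain \<xi>' \<xi>'' where \<xi>: "has_C2_derivs \<xi> \<xi>' \<xi>''" "\<And>y v. \<xi>' y v = \<pi> (d y v)" "\<And>y u v. \<xi>'' y u v = \<pi> (d2 y u v)"
    using has_C2_derivs_compose[OF d(1) has_C2_derivs_linear[OF \<pi>_linear]]
    by (auto simp: \<xi>_def[abs_def] bounded_linear_Blinfun_apply[OF b\<pi>])
  have \<xi>d: "((\<lambda>y. \<xi> y $ i) has_derivative (\<lambda>v. \<xi>' y v $ i)) (at y)" for y i
    using \<xi>(1) by (intro bounded_linear.has_derivative[OF bounded_linear_vec_nth]) (simp add: has_C2_derivs_def)
  have partial_eq: "partial_derivative j (\<lambda>u. \<xi> u $ i) y = \<xi>' y (axis j 1) $ i" for i j y
    by (rule partial_derivative_eq[OF \<xi>d])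
  have \<xi>'0: "\<xi>' 0 (axis 2 1) = axis 1 1"
    by (simp add: \<xi>(2) d(2) \<phi>_0 g'0 \<phi>'0 lA A_center_incl \<pi>_p)
  have partials_0: "partial_derivative 2 (\<lambda>u. \<xi> u $ 2) 0 = 0" "partial_derivative 2 (\<lambda>u. \<xi> u $ 1) 0 \<noteq> 0"
    unfolding partial_eq \<xi>'0 by (simp_all add: axis_def)
  have e1: "center_incl (axis 1 1) = p" and e2: "center_incl (axis 2 1) = q"
    by (simp_all add: center_incl_def axis_def)
  have mixed: "partial_derivative 1 (partial_derivative 2 (\<lambda>u. \<xi> u $ 2)) 0 = \<pi> (f'' 0 p q) $ 2"
  proof -
    have "((\<lambda>y. \<xi>' y (axis 2 1) $ 2) has_derivative (\<lambda>h. \<xi>'' 0 h (axis 2 1) $ 2)) (at 0)"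
      using \<xi>(1) by (intro bounded_linear.has_derivative[OF bounded_linear_vec_nth]
          bounded_linear.has_derivative[OF blinfun.bounded_linear_left]) (simp add: has_C2_derivs_def)
    from partial_derivative_eq[OF this, of 1]
    have "partial_derivative 1 (partial_derivative 2 (\<lambda>u. \<xi> u $ 2)) 0 = \<xi>'' 0 (axis 1 1) (axis 2 1) $ 2"
      unfolding partial_eq[abs_def] .
    also have "\<xi>'' 0 (axis 1 1) (axis 2 1) = \<pi> (f'' 0 p q) + \<pi> (A *v \<phi>'' 0 (axis 1 1) (axis 2 1))"
      by (simp add: \<xi>(3) d(3) \<phi>_0 g'0 \<phi>'0 e1 e2 g''0 lA linear_add[OF \<pi>_linear])
    finally show ?thesis by (simp add: \<pi>_A axis_def)
  qed
  \<comment> \<open>A vector whose second center coordinate vanishes is \<open>s p + A\<^sup>2 w = A (s q + A w)\<close>.\<close>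
  have "\<pi> (f'' 0 p q) $ 2 \<noteq> 0"
  proof
    assume "\<pi> (f'' 0 p q) $ 2 = 0"
    then obtain w where "f'' 0 p q = \<pi> (f'' 0 p q) $ 1 *\<^sub>R p + A *v (A *v w)"
      using complement[of "f'' 0 p q"] by auto
    also have "\<dots> = A *v (\<pi> (f'' 0 p q) $ 1 *\<^sub>R q + A *v w)"
      by (simp add: linear_add[OF A_linear] linear_cmul[OF A_linear] Aq)
    finally have "f'' 0 p q \<in> range ((*v) A)" by blast
    moreover have "second_derivative f 0 p q = f'' 0 p q"
    proof -
      have fr: "frechet_derivative f (at y) = blinfun_apply (f' y)" for y
        using frechet_derivative_at[OF fd] by simp
      have "((\<lambda>y. f' y q) has_derivative (\<lambda>h. f'' 0 h q)) (at 0)"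
        using f by (intro bounded_linear.has_derivative[OF blinfun.bounded_linear_left]) (simp add: has_C2_derivs_def)
      from frechet_derivative_at[OF this] show ?thesis
        unfolding second_derivative_def fr by (rule fun_cong[symmetric])
    qed
    moreover have "p \<in> mat_ker A - {0}" "q \<in> mat_ker (A ** A) - mat_ker A"
      using Ap Aq p0 by (auto simp: mat_ker_def simp flip: matrix_vector_mul_assoc)
    ultimately show False using assms(6) by metis
  qed
  moreover have "\<xi> (vector [s, 0]) = 0" for s
  proof -
    have "vector [s, 0] = s *\<^sub>R (axis 1 1 :: real^2)"
      by (simp add: vec_eq_iff forall_2 axis_def)
    then show ?thesis
      by (simp add: \<xi>_def \<phi>_line F_def g_line linear_cmul[OF A_linear] Ap linear_0[OF \<pi>_linear])
  qed
  moreover have "local_C2_center_manifold_2 f (\<phi> ` chart)"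
    unfolding local_C2_center_manifold_2_def
  proof (intro conjI C2_surface_image locally_invariant_image)
    show "0 \<in> \<phi> ` chart" using zero_in_chart \<phi>_0 by (metis image_eqI)
    have "range (blinfun_apply (\<phi>' 0)) = range center_incl" by (simp add: \<phi>'0)
    then show "tangent_space (\<phi> ` chart) 0 = center_subspace (jacobian f (at 0))"
      unfolding tangent_space_image A_def[symmetric] center by (simp add: center_incl_def[abs_def])
  qed
  ultimately show ?thesis
    by (intro exI[of _ "\<phi> ` chart"] exI[of _ \<phi>] exI[of _ chart] exI[of _ \<xi>] conjI C2_param_chart
        zero_in_chart \<phi>_0 has_C2_derivs_imp_C2_on[OF \<xi>(1)] always_eventually allI partials_0)
      (simp_all add: reads_in_coordinates_chart[folded \<xi>_def] mixed)
qed

end
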